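(* Let $s\ge2$ and let $(Y_i)_{i=1}^s$ be i.i.d. from $P_0$. For any $c_1>0$, $\delta>0$ and $\lambda$ with $$\max\Big\{\frac{140\kappa}s\log\frac{16\kappa s}\delta,\ \frac{4c_1\kappa}s\log\frac2\delta\Big\}\le\lambda\le\|\Sigma_0\|_{\mathcal L^\infty(\mathscr H)},$$ one has $$P_0^s\left\{(Y_i)_{i=1}^s:\ \hat{\mathcal N}_2^2(\lambda)\ge\Big(\frac49-\frac{16}{3\sqrt{3c_1}}-\frac{32}{9c_1}\Big)\mathcal N_2^2(\lambda)\right\}\ge1-3\delta .$$ Furthermore, if $C:=\sup_i\|\phi_i\|_\infty<\infty$, the same bound holds when $\lambda\le\|\Sigma_0\|_{\mathcal L^\infty(\mathscr H)}$ and $C^2\mathcal N_1(\lambda)\max\{4c_1\log\frac2\delta,\ 136\log\frac{8\mathcal N_1(\lambda)}\delta\}\le s$.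
   Context: $(\mathcal X,\mathcal B)$ is a second countable space with its Borel $\sigma$-algebra; $\mathscr H$ is an RKHS of real functions on $\mathcal X$ with continuous reproducing kernel $K$, $\sup_xK(x,x)\le\kappa$. $P_0$ is a probability measure on $\mathcal X$, $\mu_0=\int K(\cdot,x)\,dP_0(x)$; $\lambda>0$ throughout. $\mathfrak I:\mathscr H\to L^2(P_0)$, $f\mapsto[f-\mathbb E_{P_0}f]_\sim$, with adjoint $\mathfrak I^*$; $\mathcal T=\mathfrak I\mathfrak I^*=\sum_i\lambda_i\,\tilde\phi_i\otimes\tilde\phi_i$ on $L^2(P_0)$ (infinitely many positive decreasing eigenvalues $\lambda_i$, orthonormal $\tilde\phi_i$); $\phi_i=\lambda_i^{-1}\mathfrak I^*\tilde\phi_i\in\mathscr H$, $\|\phi_i\|_\infty=\sup_x|\phi_i(x)|$. $\Sigma_0=\mathfrak I^*\mathfrak I=\int(K(\cdot,x)-\mu_0)\otimes_{\mathscr H}(K(\cdot,x)-\mu_0)\,dP_0(x)$, $\Sigma_{0,\lambda}=\Sigma_0+\lambda I$, $\mathcal N_1(\lambda)=\mathrm{Tr}(\Sigma_{0,\lambda}^{-1/2}\Sigma_0\Sigma_{0,\lambda}^{-1/2})$, $\mathcal N_2(\lambda)=\|\Sigma_{0,\lambda}^{-1/2}\Sigma_0\Sigma_{0,\lambda}^{-1/2}\|_{\mathcal L^2(\mathscr H)}$. $\hat\Sigma_0=\frac1{2s(s-1)}\sum_{i\ne j}(K(\cdot,Y_i)-K(\cdot,Y_j))\otimes_{\mathscr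 H}(K(\cdot,Y_i)-K(\cdot,Y_j))$, $\hat\Sigma_{0,\lambda}=\hat\Sigma_0+\lambda I$, $\hat{\mathcal N}_2(\lambda)=\|\hat\Sigma_{0,\lambda}^{-1/2}\hat\Sigma_0\hat\Sigma_{0,\lambda}^{-1/2}\|_{\mathcal L^2(\mathscr H)}$. $\|\cdot\|_{\mathcal L^\infty}$ and $\|\cdot\|_{\mathcal L^2}$ are operator and Hilbert–Schmidt norms. *)

theory Defs
  imports "HOL-Probability.Probability"
begin

section \<open>Operators on a real Hilbert space\<close>

definition tensor :: "'h::real_inner \<Rightarrow> 'h \<Rightarrow> 'h \<Rightarrow> 'h" where
  "tensor u v = (\<lambda>f. (v \<bullet> f) *\<^sub>R u)"

definition positive_op :: "('h::real_inner \<Rightarrow> 'h) \<Rightarrow> bool" where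
  "positive_op A \<longleftrightarrow>
     bounded_linear A \<and> (\<forall>f g. A f \<bullet> g = f \<bullet> A g) \<and> (\<forall>f. 0 \<le> A f \<bullet> f)"

definition op_sqrt :: "('h::real_inner \<Rightarrow> 'h) \<Rightarrow> 'h \<Rightarrow> 'h" where
  "op_sqrt A = (THE B. positive_op B \<and> B \<circ> B = A)"

definition op_inv_sqrt :: "('h::real_inner \<Rightarrow> 'h) \<Rightarrow> 'h \<Rightarrow> 'h" where
  "op_inv_sqrt A = inv (op_sqrt A)"

definition orthonormal_basis :: "'h::real_inner set \<Rightarrow> bool" where
  "orthonormal_basis E \<longleftrightarrow>
     pairwise orthogonal E \<and> (\<forall>e\<in>E. norm e = 1) \<and> closure (span E) = UNIV"

text \<open>The trace of a trace-class operator and the norm of a Hilbert--Schmidt operator do not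
  depend on the orthonormal basis, so an arbitrary one is chosen.  Outside these classes the
  values carry no meaning.\<close>

definition op_trace :: "('h::real_inner \<Rightarrow> 'h) \<Rightarrow> real" where
  "op_trace A = (\<Sum>\<^sub>\<infinity>e\<in>(SOME E. orthonormal_basis E). A e \<bullet> e)"

definition hs_norm :: "('h::real_inner \<Rightarrow> 'h) \<Rightarrow> real" where
  "hs_norm A = sqrt (\<Sum>\<^sub>\<infinity>e\<in>(SOME E. orthonormal_basis E). (norm (A e))\<^sup>2)"

definition regularized :: "('h::real_inner \<Rightarrow> 'h) \<Rightarrow> real \<Rightarrow> 'h \<Rightarrow> 'h" where
  "regularized A l = (\<lambda>f. A f + l *\<^sub>R f)"

definition whitened :: "('h::real_inner \<Rightarrow> 'h) \<Rightarrow> real \<Rightarrow> 'h \<Rightarrow> 'h" where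
  "whitened A l = op_inv_sqrt (regularized A l) \<circ> A \<circ> op_inv_sqrt (regularized A l)"

section \<open>Reproducing kernel Hilbert spaces\<close>

text \<open>The Hilbert space is a type; \<open>evl f\<close> is the real function on the space \<open>'x\<close> that the
  element \<open>f\<close> is.  Injectivity and linearity of \<open>evl\<close> identify the Hilbert space with a
  vector space of functions under pointwise operations.\<close>

definition rkhs ::
    "('h::{real_inner,banach} \<Rightarrow> 'x \<Rightarrow> real) \<Rightarrow> ('x \<Rightarrow> 'x \<Rightarrow> real) \<Rightarrow> bool" where
  "rkhs evl K \<longleftrightarrow>
     inj evl \<and> (\<forall>x. linear (\<lambda>f. evl f x)) \<and>
     (\<forall>x. \<exists>k. evl k = (\<lambda>y. K y x) \<and> (\<forall>f. evl f x = f \<bullet> k))"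

text \<open>The function \<open>K(\<cdot>,x)\<close> as an element of the Hilbert space.\<close>

definition kernel_at :: "('h \<Rightarrow> 'x \<Rightarrow> real) \<Rightarrow> ('x \<Rightarrow> 'x \<Rightarrow> real) \<Rightarrow> 'x \<Rightarrow> 'h" where
  "kernel_at evl K x = inv evl (\<lambda>y. K y x)"

section \<open>The centred inclusion into \<open>L\<^sup>2(P)\<close> and the operators built from it\<close>

text \<open>Elements of \<open>L\<^sup>2(P)\<close> are given by square-integrable representatives.  All notions below
  depend only on the classes modulo \<open>P\<close>-almost everywhere equality: inner products are integrals
  and convergence is convergence of \<open>L\<^sup>2\<close> distances.\<close>

definition L2_fun :: "'x measure \<Rightarrow> ('x \<Rightarrow> real) set" where
  "L2_fun P = {g \<in> borel_measurable P. integrable P (\<lambda>x. (g x)\<^sup>2)}"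

definition L2_inner :: "'x measure \<Rightarrow> ('x \<Rightarrow> real) \<Rightarrow> ('x \<Rightarrow> real) \<Rightarrow> real" where
  "L2_inner P g h = (LINT x|P. g x * h x)"

definition L2_norm :: "'x measure \<Rightarrow> ('x \<Rightarrow> real) \<Rightarrow> real" where
  "L2_norm P g = sqrt (L2_inner P g g)"

definition centred_incl :: "'x measure \<Rightarrow> ('h \<Rightarrow> 'x \<Rightarrow> real) \<Rightarrow> 'h \<Rightarrow> 'x \<Rightarrow> real" where
  "centred_incl P evl f = (\<lambda>x. evl f x - (LINT y|P. evl f y))"

definition centred_incl_adj ::
    "'x measure \<Rightarrow> ('h::real_inner \<Rightarrow> 'x \<Rightarrow> real) \<Rightarrow> ('x \<Rightarrow> real) \<Rightarrow> 'h" where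
  "centred_incl_adj P evl g = (THE h. \<forall>f. h \<bullet> f = L2_inner P g (centred_incl P evl f))"

definition integral_op ::
    "'x measure \<Rightarrow> ('h::real_inner \<Rightarrow> 'x \<Rightarrow> real) \<Rightarrow> ('x \<Rightarrow> real) \<Rightarrow> 'x \<Rightarrow> real" where
  "integral_op P evl = centred_incl P evl \<circ> centred_incl_adj P evl"

definition cov_op :: "'x measure \<Rightarrow> ('h::real_inner \<Rightarrow> 'x \<Rightarrow> real) \<Rightarrow> 'h \<Rightarrow> 'h" where
  "cov_op P evl = centred_incl_adj P evl \<circ> centred_incl P evl"

text \<open>\<open>T = \<Sum>\<^sub>i \<lambda>\<^sub>i e\<^sub>i \<otimes> e\<^sub>i\<close> on \<open>L\<^sup>2(P)\<close> with infinitely many positive, non-increasing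
  \<open>\<lambda>\<^sub>i\<close> and orthonormal \<open>e\<^sub>i\<close>.\<close>

definition spectral_decomposition ::
    "'x measure \<Rightarrow> (('x \<Rightarrow> real) \<Rightarrow> 'x \<Rightarrow> real) \<Rightarrow> (nat \<Rightarrow> real) \<Rightarrow> (nat \<Rightarrow> 'x \<Rightarrow> real) \<Rightarrow> bool"
  where
  "spectral_decomposition P T lam e \<longleftrightarrow>
     (\<forall>i. lam i > 0) \<and> decseq lam \<and> (\<forall>i. e i \<in> L2_fun P) \<and>
     (\<forall>i j. L2_inner P (e i) (e j) = (if i = j then 1 else 0)) \<and>
     (\<forall>g\<in>L2_fun P.
        (\<lambda>n. L2_norm P (\<lambda>x. T g x - (\<Sum>i<n. lam i * L2_inner P (e i) g * e i x)))
          \<longlonglongrightarrow> 0)"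

definition eigen_fun ::
    "'x measure \<Rightarrow> ('h::real_inner \<Rightarrow> 'x \<Rightarrow> real) \<Rightarrow> (nat \<Rightarrow> real) \<Rightarrow> (nat \<Rightarrow> 'x \<Rightarrow> real) \<Rightarrow>
       nat \<Rightarrow> 'h" where
  "eigen_fun P evl lam e i = (1 / lam i) *\<^sub>R centred_incl_adj P evl (e i)"

definition sup_norm :: "('x \<Rightarrow> real) \<Rightarrow> real" where
  "sup_norm f = (SUP x. \<bar>f x\<bar>)"

definition N1 :: "'x measure \<Rightarrow> ('h::real_inner \<Rightarrow> 'x \<Rightarrow> real) \<Rightarrow> real \<Rightarrow> real" where
  "N1 P evl l = op_trace (whitened (cov_op P evl) l)"

definition N2 :: "'x measure \<Rightarrow> ('h::real_inner \<Rightarrow> 'x \<Rightarrow> real) \<Rightarrow> real \<Rightarrow> real" where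
  "N2 P evl l = hs_norm (whitened (cov_op P evl) l)"

section \<open>Empirical versions\<close>

definition emp_cov_op ::
    "('h::real_inner \<Rightarrow> 'x \<Rightarrow> real) \<Rightarrow> ('x \<Rightarrow> 'x \<Rightarrow> real) \<Rightarrow> nat \<Rightarrow> (nat \<Rightarrow> 'x) \<Rightarrow> 'h \<Rightarrow> 'h" where
  "emp_cov_op evl K s Y = (\<lambda>f. (1 / (2 * real s * (real s - 1))) *\<^sub>R
     (\<Sum>i\<in>{1..s}. \<Sum>j\<in>{1..s} - {i}.
        tensor (kernel_at evl K (Y i) - kernel_at evl K (Y j))
               (kernel_at evl K (Y i) - kernel_at evl K (Y j)) f))"

definition emp_N2 ::
    "('h::real_inner \<Rightarrow> 'x \<Rightarrow> real) \<Rightarrow> ('x \<Rightarrow> 'x \<Rightarrow> real) \<Rightarrow> nat \<Rightarrow> real \<Rightarrow> (nat \<Rightarrow> 'x) \<Rightarrow> real" where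
  "emp_N2 evl K s l Y = hs_norm (whitened (emp_cov_op evl K s Y) l)"

end

theory Submission
  imports Defs
begin

text \<open>
  Let \<open>h(x) = x / (x + l)\<close>, so that the whitened operators are \<open>h(\<Sigma>)\<close> and \<open>h(S)\<close>, with \<open>S\<close> the
  empirical covariance.  No operator-norm concentration is needed: by the Cauchy--Schwarz inequality
  the Hilbert--Schmidt norm of \<open>h(S)\<close> is bounded below by its inner product with \<open>h(\<Sigma>)\<close>, and the
  operator inequality \<open>h(S) \<ge> R S + S R - R (S\<^sup>2 + l S) R\<close> with \<open>R = (\<Sigma> + l)\<^sup>-\<^sup>1\<close> bounds that inner
  product below by
  \<open>\<parallel>h(\<Sigma>)\<parallel>\<^sup>2 - \<parallel>(S - \<Sigma>) M\<^sup>1\<^sup>/\<^sup>2\<parallel>\<^sup>2 - l tr (M (\<Sigma> - S))\<close>, where \<open>M = \<Sigma> (\<Sigma> + l)\<^sup>-\<^sup>3\<close>.  The weight \<open>M\<close> makes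
  both error terms dimension-free: they are the norm of a vector-valued U-statistic and a scalar
  U-statistic, to which Hoeffding's averaging over disjoint pairs and a Bernstein-type inequality for
  norms of independent sums apply.  To use only the whitened size of the feature vectors, \<open>S\<close> is
  first replaced by \<open>T S T\<close>, where the contraction \<open>T\<close> cuts the eigenvalues of \<open>\<Sigma>\<close> at \<open>3 l\<close> and
  projects onto finitely many eigenvectors; this can only decrease the norm of \<open>h(S)\<close>.
\<close>


section \<open>Orthonormal bases of a Hilbert space\<close>

text \<open>Both error terms are small relative to the quantity being estimated. If the truncated
  features have squared norm at most b, the mean squares over m independent pairs are at most b/(l
  m) times l tr(M Sigma), and l tr(M Sigma) <= tr h(Sigma)^2. So confidence and sample size enter
  only through b ln(2/\<delta>) / (l s). Each hypothesis of the theorem bounds this by 2/c1, with b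
  = 2 \<kappa> from the kernel bound in the first and b = 8 l C^2 N1 from the sup norms in the
  second; the rest is common. Since h(Sigma) is diagonal in the eigenvectors of Sigma, the operator
  inequality is used only on the diagonal there, where the resolvent acts as a scalar. M is h(Sigma)
  R^2, the weight that the quadratic term gets when tested against h(Sigma). Cutting at 3 l costs
  (3/4)^2 and keeping finitely many eigenvectors costs 49/50. The product exceeds 4/9, and this gap
  pays for the fluctuations. If \<delta> < 1/3 and the claimed factor is positive, then c1 >= 62 and
  s >= 47, so the passage from s to s div 2 pairs is cheap.\<close>

lemma quadratic_nonneg_imp_linear_zero:
  fixes a b :: real
  assumes "\<And>t. 0 \<le> t\<^sup>2 * a + 2 * t * b"
  shows "b = 0"
proof (rule ccontr)
  assume "b \<noteq> 0"
  have "0 \<le> a" using assms[of 1] assms[of "-1"] by simp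
  \<comment> \<open>Dividing by \<open>a + 1\<close> instead of \<open>a\<close> also covers
    \<open>a = 0\<close>; the witness is \<open>t = - b / (a + 1)\<close>.\<close>
  define d where "d = a + 1"
  have "0 < d" and a: "a = d - 1" using \<open>0 \<le> a\<close> by (auto simp: d_def)
  have "(- b / d)\<^sup>2 * a + 2 * (- b / d) * b = - ((b / d)\<^sup>2 + b\<^sup>2 / d)"
    using \<open>0 < d\<close> by (simp add: a field_simps power2_eq_square)
  also have "\<dots> < 0"
    using \<open>b \<noteq> 0\<close> \<open>0 < d\<close> by (simp only: neg_less_0_iff_less) (intro add_pos_pos; simp)
  finally show False using assms[of "- b / d"] by simp
qed

text \<open>The minimiser of \<open>J\<close> over \<open>S\<close> represents
  \<open>\<phi>\<close>: minimising sequences are Cauchy, and the first variation vanishes at the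
  limit. For \<open>S = UNIV\<close> this is the Riesz theorem; for \<open>\<phi>\<close> the inner
  product with v it gives the orthogonal projection of v to \<open>S\<close>.\<close>

lemma riesz_closed_subspace:
  fixes \<phi> :: "'h::{real_inner,banach} \<Rightarrow> real"
  assumes S: "subspace S" "closed S" and \<phi>: "bounded_linear \<phi>"
  shows "\<exists>h\<in>S. \<forall>f\<in>S. \<phi> f = h \<bullet> f"
proof -
  interpret bounded_linear \<phi> by fact
  obtain B where B: "\<And>f. norm (\<phi> f) \<le> norm f * B" using bounded by blast
  define J where "J f = f \<bullet> f - 2 * \<phi> f" for f
  have J_lower: "- B\<^sup>2 \<le> J f" for f
  proof -
    have "\<phi> f \<le> norm f * B" using B[of f] by simp
    moreover have "0 \<le> (norm f - B)\<^sup>2" by simp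
    ultimately show ?thesis
      by (simp add: J_def power2_eq_square algebra_simps dot_square_norm)
  qed
  have bdd: "bdd_below (J ` S)" using J_lower by (meson bdd_belowI2)
  have "0 \<in> S" using S(1) by (rule subspace_0)
  define j where "j = Inf (J ` S)"
  have j_le: "j \<le> J f" if "f \<in> S" for f
    unfolding j_def using bdd that by (auto intro: cInf_lower)
  have "\<exists>f\<in>S. J f < j + 1 / real (Suc n)" for n
    using cInf_lessD[of "J ` S" "j + 1 / real (Suc n)"] \<open>0 \<in> S\<close> by (auto simp: j_def)
  then obtain F where F: "\<And>n. F n \<in> S" "\<And>n. J (F n) < j + 1 / real (Suc n)" by metis
  \<comment> \<open>Parallelogram law: the left side is \<open>2 * J f + 2 * J g\<close> minus four
    times the value of \<open>J\<close> at the midpoint, which is at least \<open>j\<close>.\<close>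
  have dist_bound: "(norm (f - g))\<^sup>2 \<le> 2 * (J f - j) + 2 * (J g - j)" if "f \<in> S" "g \<in> S" for f g
  proof -
    have "(1/2) *\<^sub>R (f + g) \<in> S" using S(1) that by (simp add: subspace_add subspace_scale)
    from j_le[OF this] show ?thesis
      unfolding J_def power2_norm_eq_inner
      by (simp add: scaleR add inner_simps inner_commute algebra_simps)
  qed
  have "Cauchy F"
  proof (rule metric_CauchyI)
    fix \<epsilon> :: real assume "0 < \<epsilon>"
    obtain N where N: "1 / real (Suc N) < \<epsilon>\<^sup>2 / 4"
      using nat_approx_posE[of "\<epsilon>\<^sup>2 / 4"] \<open>0 < \<epsilon>\<close> by auto
    have "dist (F m) (F n) < \<epsilon>" if "m \<ge> N" "n \<ge> N" for m n
    proof -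
      have "1 / real (Suc k) \<le> 1 / real (Suc N)" if "k \<ge> N" for k
        using that by (auto simp: field_simps)
      then have "J (F k) - j < \<epsilon>\<^sup>2 / 4" if "k \<ge> N" for k
        using F(2)[of k] N that by fastforce
      from this[OF that(1)] this[OF that(2)] have "(norm (F m - F n))\<^sup>2 < \<epsilon>\<^sup>2"
        using dist_bound[OF F(1) F(1), of m n] by (simp add: field_simps)
      then show ?thesis using \<open>0 < \<epsilon>\<close> by (simp add: dist_norm power2_less_imp_less)
    qed
    then show "\<exists>M. \<forall>m\<ge>M. \<forall>n\<ge>M. dist (F m) (F n) < \<epsilon>" by blast
  qed
  then obtain h where h: "F \<longlonglongrightarrow> h" using Cauchy_convergent_iff convergent_def by blast
  have "h \<in> S" using S(2) F(1) h closed_sequentially by blast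
  have "(\<lambda>n. J (F n)) \<longlonglongrightarrow> J h"
    unfolding J_def by (intro tendsto_intros h tendsto)
  moreover have "(\<lambda>n. j + 1 / real (Suc n)) \<longlonglongrightarrow> j + 0"
    by (intro tendsto_intros LIMSEQ_Suc[OF lim_1_over_n])
  ultimately have "J h \<le> j"
    using F(2) by (intro LIMSEQ_le[of "\<lambda>n. J (F n)" _ "\<lambda>n. j + 1 / real (Suc n)"]) (auto intro: less_imp_le)
  have "\<phi> f = h \<bullet> f" if "f \<in> S" for f
  proof -
    have "0 \<le> t\<^sup>2 * (f \<bullet> f) + 2 * t * (h \<bullet> f - \<phi> f)" for t
    proof -
      have "h + t *\<^sub>R f \<in> S" using S(1) that \<open>h \<in> S\<close> by (simp add: subspace_add subspace_scale)
      then have "J h \<le> J (h + t *\<^sub>R f)" using j_le \<open>J h \<le> j\<close> by force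
      then show ?thesis
        by (simp add: J_def scaleR add inner_simps inner_commute algebra_simps power2_eq_square)
    qed
    from quadratic_nonneg_imp_linear_zero[OF this] show ?thesis by simp
  qed
  then show ?thesis using \<open>h \<in> S\<close> by blast
qed

section \<open>Bessel, Parseval and Hilbert-Schmidt sums\<close>

definition orthonormal_set :: "'h::real_inner set \<Rightarrow> bool" where
  "orthonormal_set E \<longleftrightarrow> pairwise orthogonal E \<and> (\<forall>e\<in>E. norm e = 1)"

lemma orthonormal_set_inner:
  assumes "orthonormal_set E" "e \<in> E" "e' \<in> E"
  shows "e \<bullet> e' = (if e = e' then 1 else 0)"
  using assms by (auto simp: orthonormal_set_def pairwise_def orthogonal_def dot_square_norm)

lemma orthonormal_set_subset: "orthonormal_set E \<Longrightarrow> F \<subseteq> E \<Longrightarrow> orthonormal_set F"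
  by (auto simp: orthonormal_set_def intro: pairwise_subset)

lemma orthonormal_basis_orthonormal_set: "orthonormal_basis E \<Longrightarrow> orthonormal_set E"
  by (simp add: orthonormal_basis_def orthonormal_set_def)

lemma norm_combination_orthonormal:
  assumes "orthonormal_set F" "finite F"
  shows "(norm (\<Sum>e\<in>F. c e *\<^sub>R e))\<^sup>2 = (\<Sum>e\<in>F. (c e)\<^sup>2)"
proof -
  have "(norm (\<Sum>e\<in>F. c e *\<^sub>R e))\<^sup>2 = (\<Sum>e\<in>F. \<Sum>e'\<in>F. c e * c e' * (e \<bullet> e'))"
    by (simp add: power2_norm_eq_inner inner_sum_left inner_sum_right sum_distrib_left mult_ac
        inner_commute)
  also have "\<dots> = (\<Sum>e\<in>F. \<Sum>e'\<in>F. if e = e' then (c e)\<^sup>2 else 0)"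
    using assms by (intro sum.cong refl) (simp add: orthonormal_set_inner power2_eq_square)
  finally show ?thesis using assms by simp
qed

text \<open>Kept for arbitrary coefficients: \<open>c e = v \<bullet> e\<close> gives Bessel, while
  \<open>parseval\<close> needs the unknown coefficients of an approximant from the span.\<close>

lemma dist_combination_orthonormal:
  assumes "orthonormal_set F" "finite F"
  shows "(norm (v - (\<Sum>e\<in>F. c e *\<^sub>R e)))\<^sup>2
       = (norm v)\<^sup>2 - (\<Sum>e\<in>F. (v \<bullet> e)\<^sup>2) + (\<Sum>e\<in>F. (v \<bullet> e - c e)\<^sup>2)"
proof -
  have "(norm (v - (\<Sum>e\<in>F. c e *\<^sub>R e)))\<^sup>2
      = (norm v)\<^sup>2 - 2 * (\<Sum>e\<in>F. c e * (v \<bullet> e)) + (\<Sum>e\<in>F. (c e)\<^sup>2)"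
    unfolding norm_combination_orthonormal[OF assms, symmetric]
    by (simp add: power2_norm_eq_inner inner_simps inner_commute inner_sum_right algebra_simps)
  then show ?thesis
    by (simp add: power2_diff sum.distrib sum_subtractf sum_distrib_left mult_ac)
qed

lemma bessel:
  assumes "orthonormal_set F" "finite F"
  shows "(\<Sum>e\<in>F. (v \<bullet> e)\<^sup>2) \<le> (norm v)\<^sup>2"
proof -
  have "0 \<le> (norm (v - (\<Sum>e\<in>F. (v \<bullet> e) *\<^sub>R e)))\<^sup>2" by simp
  then show ?thesis unfolding dist_combination_orthonormal[OF assms] by simp
qed

lemma subspace_closure:
  fixes S :: "'h::real_normed_vector set"
  assumes "subspace S"
  shows "subspace (closure S)"
  unfolding subspace_def
proof (intro conjI ballI allI)
  show "0 \<in> closure S" using subspace_0[OF assms] closure_subset by blast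
next
  fix x y assume "x \<in> closure S" "y \<in> closure S"
  then obtain f g where "\<And>n. f n \<in> S" "f \<longlonglongrightarrow> x" "\<And>n. g n \<in> S" "g \<longlonglongrightarrow> y"
    by (auto simp: closure_sequential)
  then have "\<And>n. f n + g n \<in> S" "(\<lambda>n. f n + g n) \<longlonglongrightarrow> x + y"
    using assms by (auto intro!: subspace_add tendsto_add)
  then show "x + y \<in> closure S"
    unfolding closure_sequential by (intro exI[of _ "\<lambda>n. f n + g n"]) auto
next
  fix c x assume "x \<in> closure S"
  then obtain f where "\<And>n. f n \<in> S" "f \<longlonglongrightarrow> x"
    by (auto simp: closure_sequential)
  then have "\<And>n. c *\<^sub>R f n \<in> S" "(\<lambda>n. c *\<^sub>R f n) \<longlonglongrightarrow> c *\<^sub>R x"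
    using assms by (auto intro!: subspace_scale tendsto_intros)
  then show "c *\<^sub>R x \<in> closure S"
    unfolding closure_sequential by (intro exI[of _ "\<lambda>n. c *\<^sub>R f n"]) auto
qed

text \<open>Used with \<open>E0\<close> empty to have some basis at all, and with the eigenvectors
  of the covariance as \<open>E0\<close> to obtain a basis that diagonalises it.\<close>

lemma orthonormal_set_extend_basis:
  fixes E0 :: "'h::{real_inner,banach} set"
  assumes "orthonormal_set E0"
  shows "\<exists>E. E0 \<subseteq> E \<and> orthonormal_basis E"
proof -
  let ?C = "{E. E0 \<subseteq> E \<and> orthonormal_set E}"
  have "\<exists>M\<in>?C. \<forall>X\<in>?C. M \<subseteq> X \<longrightarrow> X = M"
  proof (rule subset_Zorn_nonempty)
    show "?C \<noteq> {}" using assms by auto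
  next
    fix c assume c: "c \<noteq> {}" "subset.chain ?C c"
    have "orthonormal_set (\<Union>c)"
      unfolding orthonormal_set_def pairwise_def
    proof (intro conjI ballI impI)
      fix x y assume "x \<in> \<Union>c" "y \<in> \<Union>c" "x \<noteq> y"
      then obtain X Y where XY: "X \<in> c" "Y \<in> c" "x \<in> X" "y \<in> Y" by auto
      then have "X \<subseteq> Y \<or> Y \<subseteq> X" using c(2) by (meson subset_chain_def)
      moreover have "orthonormal_set X" "orthonormal_set Y"
        using XY c(2) by (auto simp: subset.chain_def)
      ultimately show "orthogonal x y"
        using XY \<open>x \<noteq> y\<close> by (auto simp: orthonormal_set_def pairwise_def)
    next
      fix x assume "x \<in> \<Union>c"
      then show "norm x = 1" using c(2) by (auto simp: subset.chain_def orthonormal_set_def)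
    qed
    moreover have "E0 \<subseteq> \<Union>c"
    proof -
      obtain X where "X \<in> c" using c(1) by auto
      moreover from this have "E0 \<subseteq> X" using c(2) by (auto simp: subset.chain_def)
      ultimately show ?thesis by auto
    qed
    ultimately show "\<Union>c \<in> ?C" by auto
  qed
  then obtain M where M: "E0 \<subseteq> M" "orthonormal_set M"
    and maximal: "\<And>X. orthonormal_set X \<Longrightarrow> M \<subseteq> X \<Longrightarrow> X = M" 
    by (auto intro: order_trans)
  have "closure (span M) = UNIV"
  proof (rule ccontr)
    assume "closure (span M) \<noteq> UNIV"
    then obtain v where v: "v \<notin> closure (span M)" by auto
    have "\<exists>h\<in>closure (span M). \<forall>f\<in>closure (span M). v \<bullet> f = h \<bullet> f"
      by (intro riesz_closed_subspace subspace_closure subspace_span closed_closure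
          bounded_linear_inner_right)
    then obtain h where h: "h \<in> closure (span M)" "\<And>f. f \<in> closure (span M) \<Longrightarrow> (v - h) \<bullet> f = 0"
      by (auto simp: inner_simps)
    \<comment> \<open>The normalised difference of \<open>v\<close> and its projection would enlarge
      the maximal family.\<close>
    define w where "w = (1 / norm (v - h)) *\<^sub>R (v - h)"
    have "v \<noteq> h" using v h(1) by auto
    then have "norm w = 1" by (simp add: w_def)
    have ortho: "w \<bullet> f = 0" if "f \<in> M" for f
      using h(2)[of f] that by (simp add: w_def span_base subsetD[OF closure_subset])
    have "orthonormal_set (insert w M)"
      using M(2) ortho \<open>norm w = 1\<close>
      by (auto simp: orthonormal_set_def pairwise_def orthogonal_def inner_commute)
    then have "w \<in> M" using maximal[of "insert w M"] by auto
    with ortho[of w] \<open>norm w = 1\<close> show False by (auto simp: dot_square_norm)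
  qed
  then show ?thesis using M by (auto simp: orthonormal_basis_def orthonormal_set_def)
qed

text \<open>Makes the \<open>SOME\<close> in \<open>op_trace\<close> and \<open>hs_norm\<close>
  denote an actual basis.\<close>

lemma orthonormal_basis_some:
  "orthonormal_basis (SOME E :: 'h::{real_inner,banach} set. orthonormal_basis E)"
proof -
  have "\<exists>E :: 'h set. orthonormal_basis E"
    using orthonormal_set_extend_basis[of "{}"] by (auto simp: orthonormal_set_def)
  then show ?thesis by (rule someI_ex)
qed

lemma parseval:
  assumes "orthonormal_basis E"
  shows "((\<lambda>e. (v \<bullet> e)\<^sup>2) has_sum (norm v)\<^sup>2) E"
proof -
  have on: "orthonormal_set F" if "F \<subseteq> E" for F
    using orthonormal_set_subset[OF orthonormal_basis_orthonormal_set[OF assms] that] .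
  have le: "(\<Sum>e\<in>F. (v \<bullet> e)\<^sup>2) \<le> (norm v)\<^sup>2" if "F \<subseteq> E" "finite F" for F
    using that by (intro bessel on)
  have summable: "(\<lambda>e. (v \<bullet> e)\<^sup>2) summable_on E"
    using le by (intro nonneg_bdd_above_summable_on) (auto intro!: bdd_aboveI2[where M = "(norm v)\<^sup>2"])
  have "infsum (\<lambda>e. (v \<bullet> e)\<^sup>2) E \<le> (norm v)\<^sup>2"
    using le summable by (intro infsum_le_finite_sums) auto
  moreover have "(norm v)\<^sup>2 \<le> infsum (\<lambda>e. (v \<bullet> e)\<^sup>2) E"
  proof (rule field_le_epsilon)
    fix \<epsilon> :: real assume "\<epsilon> > 0"
    have "v \<in> closure (span E)" using assms by (simp add: orthonormal_basis_def)
    then obtain u where u: "u \<in> span E" "dist u v < sqrt \<epsilon>"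
      using \<open>\<epsilon> > 0\<close> by (auto simp: closure_approachable dest: spec[of _ "sqrt \<epsilon>"])
    then obtain F c where F: "finite F" "F \<subseteq> E" "u = (\<Sum>e\<in>F. c e *\<^sub>R e)"
      by (auto simp: span_explicit)
    have "(norm (v - u))\<^sup>2 < \<epsilon>"
      using power_strict_mono[OF u(2), of 2] \<open>\<epsilon> > 0\<close> by (simp add: dist_norm norm_minus_commute)
    moreover have "(norm v)\<^sup>2 - (\<Sum>e\<in>F. (v \<bullet> e)\<^sup>2) \<le> (norm (v - u))\<^sup>2"
      unfolding F(3) dist_combination_orthonormal[OF on[OF F(2)] F(1)] by (simp add: sum_nonneg)
    moreover have "(\<Sum>e\<in>F. (v \<bullet> e)\<^sup>2) \<le> infsum (\<lambda>e. (v \<bullet> e)\<^sup>2) E"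
      using F summable by (intro finite_sum_le_infsum) auto
    ultimately show "(norm v)\<^sup>2 \<le> infsum (\<lambda>e. (v \<bullet> e)\<^sup>2) E + \<epsilon>" by simp
  qed
  ultimately show ?thesis using summable by (metis has_sum_infsum antisym)
qed

lemma parseval_inner:
  assumes "orthonormal_basis E"
  shows "((\<lambda>e. (v \<bullet> e) * (w \<bullet> e)) has_sum (v \<bullet> w)) E"
proof -
  have "((\<lambda>e. ((v + w) \<bullet> e)\<^sup>2 + (- ((v \<bullet> e)\<^sup>2) + - ((w \<bullet> e)\<^sup>2))) has_sum
      ((norm (v + w))\<^sup>2 + (- ((norm v)\<^sup>2) + - ((norm w)\<^sup>2)))) E"
    by (intro has_sum_add has_sum_uminusI parseval assms)
  then have "((\<lambda>e. (((v + w) \<bullet> e)\<^sup>2 + (- ((v \<bullet> e)\<^sup>2) + - ((w \<bullet> e)\<^sup>2))) * (1/2)) has_sum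
      ((norm (v + w))\<^sup>2 + (- ((norm v)\<^sup>2) + - ((norm w)\<^sup>2))) * (1/2)) E"
    by (rule has_sum_cmult_left)
  moreover have "((norm (v + w))\<^sup>2 + (- ((norm v)\<^sup>2) + - ((norm w)\<^sup>2))) * (1/2) = v \<bullet> w"
    by (simp add: power2_norm_eq_inner inner_simps inner_commute algebra_simps)
  moreover have "(((v + w) \<bullet> e)\<^sup>2 + (- ((v \<bullet> e)\<^sup>2) + - ((w \<bullet> e)\<^sup>2))) * (1/2) = (v \<bullet> e) * (w \<bullet> e)" for e
    by (simp add: inner_simps power2_eq_square algebra_simps)
  ultimately show ?thesis by simp
qed

lemma has_sum_sum:
  fixes f :: "'i \<Rightarrow> 'a \<Rightarrow> real"
  assumes "finite F" "\<And>i. i \<in> F \<Longrightarrow> (f i has_sum s i) A"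
  shows "((\<lambda>x. \<Sum>i\<in>F. f i x) has_sum (\<Sum>i\<in>F. s i)) A"
  using assms by (induction F) (auto intro!: has_sum_add)

text \<open>For a finite part of \<open>E\<close>, expand each norm by Parseval in \<open>B\<close>,
  transpose the matrix by symmetry, and apply Bessel to each column. Only one of the two sums is
  ever infinite, and \<open>E\<close> may be incomplete.\<close>

lemma hs_sum_le_basis:
  fixes H :: "'h::{real_inner,banach} \<Rightarrow> 'h"
  assumes sym: "\<And>f g. H f \<bullet> g = f \<bullet> H g" and E: "orthonormal_set E"
    and B: "orthonormal_basis B" and summable: "(\<lambda>e. (norm (H e))\<^sup>2) summable_on B"
  shows "(\<lambda>e. (norm (H e))\<^sup>2) summable_on E"
    and "infsum (\<lambda>e. (norm (H e))\<^sup>2) E \<le> infsum (\<lambda>e. (norm (H e))\<^sup>2) B"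
proof -
  have le: "(\<Sum>e\<in>F. (norm (H e))\<^sup>2) \<le> infsum (\<lambda>e. (norm (H e))\<^sup>2) B" if F: "finite F" "F \<subseteq> E" for F
  proof (rule has_sum_mono)
    show "((\<lambda>b. \<Sum>e\<in>F. (H e \<bullet> b)\<^sup>2) has_sum (\<Sum>e\<in>F. (norm (H e))\<^sup>2)) B"
      by (intro has_sum_sum F(1) parseval B)
    show "((\<lambda>b. (norm (H b))\<^sup>2) has_sum infsum (\<lambda>e. (norm (H e))\<^sup>2) B) B"
      using summable by simp
    show "(\<Sum>e\<in>F. (H e \<bullet> b)\<^sup>2) \<le> (norm (H b))\<^sup>2" for b
    proof -
      have "H e \<bullet> b = H b \<bullet> e" for e by (metis sym inner_commute)
      then have "(\<Sum>e\<in>F. (H e \<bullet> b)\<^sup>2) = (\<Sum>e\<in>F. (H b \<bullet> e)\<^sup>2)" by (simp only:)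
      also have "\<dots> \<le> (norm (H b))\<^sup>2"
        using F E orthonormal_set_subset by (intro bessel) auto
      finally show ?thesis .
    qed
  qed
  show *: "(\<lambda>e. (norm (H e))\<^sup>2) summable_on E"
    using le by (intro nonneg_bdd_above_summable_on) (auto intro!: bdd_aboveI2)
  show "infsum (\<lambda>e. (norm (H e))\<^sup>2) E \<le> infsum (\<lambda>e. (norm (H e))\<^sup>2) B"
    using le * by (intro infsum_le_finite_sums) auto
qed


section \<open>Resolvents and the whitened operator\<close>

locale positive_regularization =
  fixes A :: "'h::{real_inner,banach} \<Rightarrow> 'h" and l :: real
  assumes pos: "positive_op A" and l: "0 < l"
begin

definition R :: "'h \<Rightarrow> 'h" where "R = regularized A l"

text \<open>The resolvent, called R in the overview; in the code \<open>R\<close> is the regularized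
  operator itself.\<close>

definition G :: "'h \<Rightarrow> 'h" where "G = inv R"

lemma R_apply: "R f = A f + l *\<^sub>R f"
  by (simp add: R_def regularized_def)

lemma A_linear: "bounded_linear A"
  and A_sym: "A f \<bullet> g = f \<bullet> A g"
  and A_nonneg: "0 \<le> A f \<bullet> f"
  using pos by (auto simp: positive_op_def)

sublocale A: bounded_linear A by (rule A_linear)

lemma R_linear: "bounded_linear R"
  unfolding R_apply[abs_def]
  by (intro bounded_linear_add A_linear bounded_linear_scaleR_right)

sublocale R: bounded_linear R by (rule R_linear)

lemma R_sym: "R f \<bullet> g = f \<bullet> R g"
  by (simp add: R_apply inner_simps A_sym)

lemma R_coercive: "l * (norm f)\<^sup>2 \<le> R f \<bullet> f"
  using A_nonneg[of f] by (simp add: R_apply inner_simps power2_norm_eq_inner)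

lemma R_nonneg: "0 \<le> R f \<bullet> f"
  using A_nonneg[of f] l by (simp add: R_apply inner_simps)

lemma R_A_commute: "R (A f) = A (R f)"
  by (simp add: R_apply A.add A.scaleR)

text \<open>Expand the square with coercivity from below and \<open>B\<close> from above: the step
  \<alpha> gives the factor 1 - 2 \<alpha> l + \<alpha>^2 B^2, which is least at \<alpha> = l /
  B^2.\<close>

lemma contraction_bound:
  assumes B: "l \<le> B" "\<And>f. norm (R f) \<le> B * norm f"
  shows "norm (f - (l / B\<^sup>2) *\<^sub>R R f) \<le> sqrt (1 - (l / B)\<^sup>2) * norm f"
proof -
  let ?\<alpha> = "l / B\<^sup>2"
  have "0 < B" using B(1) l by simp
  have "(l / B)\<^sup>2 \<le> 1" using B(1) l \<open>0 < B\<close> by (simp add: power_le_one)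
  have "(norm (f - ?\<alpha> *\<^sub>R R f))\<^sup>2
      = (norm f)\<^sup>2 - 2 * ?\<alpha> * (R f \<bullet> f) + ?\<alpha>\<^sup>2 * (norm (R f))\<^sup>2"
    unfolding power2_norm_eq_inner
    by (simp add: inner_simps inner_commute power2_eq_square algebra_simps)
  also have "\<dots> \<le> (norm f)\<^sup>2 - 2 * ?\<alpha> * (l * (norm f)\<^sup>2) + ?\<alpha>\<^sup>2 * (B * norm f)\<^sup>2"
    using R_coercive[of f] B(2)[of f] l
    by (intro add_mono diff_mono mult_left_mono power_mono) auto
  also have "\<dots> = (1 - (l / B)\<^sup>2) * (norm f)\<^sup>2"
    using \<open>0 < B\<close> by (simp add: field_simps power2_eq_square)
  finally have "(norm (f - ?\<alpha> *\<^sub>R R f))\<^sup>2 \<le> (sqrt (1 - (l / B)\<^sup>2) * norm f)\<^sup>2"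
    using \<open>(l / B)\<^sup>2 \<le> 1\<close> by (simp add: power_mult_distrib)
  then show ?thesis by (rule power2_le_imp_le) (use \<open>(l / B)\<^sup>2 \<le> 1\<close> in simp)
qed

lemma contraction:
  obtains c \<tau> :: real where "0 < c" "0 \<le> \<tau>" "\<tau> < 1"
    "\<And>f. norm (f - (1 / c) *\<^sub>R R f) \<le> \<tau> * norm f"
proof -
  obtain K where K: "\<And>f. norm (R f) \<le> norm f * K" using R.bounded by blast
  \<comment> \<open>The maximum gives \<open>l \<le> B\<close>, so that \<open>B\<close> is positive
    and \<open>1 - (l / B)\<^sup>2\<close> is nonnegative.\<close>
  define B where "B = max K l"
  have B: "l \<le> B" "norm (R f) \<le> B * norm f" for f
    using K[of f] mult_left_mono[of K B "norm f"] by (auto simp: B_def mult.commute)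
  have "0 < B" using B(1) l by simp
  show thesis
  proof (rule that)
    show "0 < B\<^sup>2 / l" using l \<open>0 < B\<close> by simp
    show "0 \<le> sqrt (1 - (l / B)\<^sup>2)" using B(1) l \<open>0 < B\<close> by (simp add: power_le_one)
    show "sqrt (1 - (l / B)\<^sup>2) < 1" using l \<open>0 < B\<close> by simp
    show "norm (f - (1 / (B\<^sup>2 / l)) *\<^sub>R R f) \<le> sqrt (1 - (l / B)\<^sup>2) * norm f" for f
      using contraction_bound[OF B] by simp
  qed
qed

text \<open>Injectivity is coercivity. For surjectivity, the fixed points of \<open>\<Phi>\<close>
  below are the solutions of \<open>R x = y\<close>, and \<open>\<Phi>\<close> is a
  contraction.\<close>

lemma R_bij: "bij R"
proof (rule bijI)
  show "inj R"
  proof (rule injI)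
    fix f g assume "R f = R g"
    then have "R (f - g) = 0" by (simp add: R.diff)
    then show "f = g" using R_coercive[of "f - g"] l by (simp add: mult_le_0_iff)
  qed
next
  show "surj R"
  proof (rule surjI)
    fix y
    obtain c \<tau> where c: "0 < c" "0 \<le> \<tau>" "\<tau> < 1"
      "\<And>f. norm (f - (1 / c) *\<^sub>R R f) \<le> \<tau> * norm f" by (rule contraction) blast
    define \<Phi> where "\<Phi> x = (1 / c) *\<^sub>R y + (x - (1 / c) *\<^sub>R R x)" for x
    have "dist (\<Phi> x) (\<Phi> x') \<le> \<tau> * dist x x'" for x x'
      using c(4)[of "x - x'"] by (simp add: \<Phi>_def dist_norm R.diff algebra_simps)
    then obtain x where "\<Phi> x = x" using banach_fix_type[of \<tau> \<Phi>] c by blast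
    then have "(1 / c) *\<^sub>R y = (1 / c) *\<^sub>R R x" by (simp add: \<Phi>_def)
    then show "R (SOME x. R x = y) = y"
      using c(1) by (intro someI[of "\<lambda>x. R x = y" x]) simp
  qed
qed

lemma R_G [simp]: "R (G f) = f"
  unfolding G_def using R_bij by (simp add: bij_is_surj surj_f_inv_f)

lemma G_R [simp]: "G (R f) = f"
  unfolding G_def using R_bij by (simp add: bij_is_inj)

lemma G_eqI: "R f = g \<Longrightarrow> G g = f"
  by auto

lemma norm_G_le: "norm (G f) \<le> norm f / l"
proof -
  have "l * (norm (G f))\<^sup>2 \<le> f \<bullet> G f" using R_coercive[of "G f"] by simp
  also have "\<dots> \<le> norm f * norm (G f)" by (rule norm_cauchy_schwarz)
  finally have "norm (G f) = 0 \<or> l * norm (G f) \<le> norm f"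
    by (auto simp: power2_eq_square mult.assoc[symmetric] mult_le_cancel_right)
  then show ?thesis using l by (auto simp: field_simps)
qed

lemma G_linear: "bounded_linear G"
proof (rule bounded_linear_intro)
  show "G (f + g) = G f + G g" for f g by (rule G_eqI) (simp add: R.add)
  show "G (a *\<^sub>R f) = a *\<^sub>R G f" for a f by (rule G_eqI) (simp add: R.scaleR)
  show "norm (G f) \<le> norm f * (1 / l)" for f using norm_G_le[of f] by simp
qed

sublocale G: bounded_linear G by (rule G_linear)

lemma G_sym: "G f \<bullet> g = f \<bullet> G g"
  using R_sym[of "G f" "G g"] by simp

lemma G_A_commute: "G (A f) = A (G f)"
  by (rule G_eqI) (simp add: R_A_commute)

text \<open>Exhibits the resolvent as a limit of polynomials in \<open>R\<close> whose coefficients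
  depend on \<open>B\<close> and \<open>l\<close> alone. A bound \<open>B\<close> valid for all
  samples therefore gives one series for all of them, from which measurability in the sample
  follows.\<close>

lemma G_neumann_series:
  assumes B: "l \<le> B" "\<And>f. norm (R f) \<le> B * norm f"
  shows "(\<lambda>n. \<Sum>k<n. (l / B\<^sup>2) *\<^sub>R ((\<lambda>f. f - (l / B\<^sup>2) *\<^sub>R R f) ^^ k) f) \<longlonglongrightarrow> G f"
proof -
  let ?\<alpha> = "l / B\<^sup>2"
  define T where "T f = f - ?\<alpha> *\<^sub>R R f" for f
  define \<tau> where "\<tau> = sqrt (1 - (l / B)\<^sup>2)"
  have "0 < B" using B(1) l by simp
  have \<tau>: "0 \<le> \<tau>" "\<tau> < 1" using B(1) l \<open>0 < B\<close> by (auto simp: \<tau>_def power_le_one)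
  have power: "norm ((T ^^ n) f) \<le> \<tau> ^ n * norm f" for n
  proof (induction n)
    case (Suc n)
    have "norm (T ((T ^^ n) f)) \<le> \<tau> * norm ((T ^^ n) f)"
      unfolding T_def[of "(T ^^ n) f"] \<tau>_def by (rule contraction_bound[OF B])
    also have "\<dots> \<le> \<tau> * (\<tau> ^ n * norm f)" using Suc \<tau>(1) by (rule mult_left_mono)
    finally show ?case by simp
  qed simp
  have telescope: "R (\<Sum>k<n. ?\<alpha> *\<^sub>R (T ^^ k) f) = f - (T ^^ n) f" for n
  proof (induction n)
    case (Suc n)
    have "(T ^^ Suc n) f = (T ^^ n) f - ?\<alpha> *\<^sub>R R ((T ^^ n) f)"
      unfolding funpow.simps comp_apply by (rule T_def)
    then show ?case unfolding sum.lessThan_Suc R.add R.scaleR Suc by (simp only:) simp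
  qed simp
  have "(\<Sum>k<n. ?\<alpha> *\<^sub>R (T ^^ k) f) = G f - G ((T ^^ n) f)" for n
    unfolding G.diff[symmetric] telescope[symmetric] by (rule G_R[symmetric])
  moreover have "(\<lambda>n. G ((T ^^ n) f)) \<longlonglongrightarrow> 0"
  proof (rule Lim_null_comparison)
    have "norm (G ((T ^^ n) f)) \<le> \<tau> ^ n * norm f / l" for n
      using norm_G_le[of "(T ^^ n) f"] divide_right_mono[OF power[of n], of l] l by simp
    then show "\<forall>\<^sub>F n in sequentially. norm (G ((T ^^ n) f)) \<le> \<tau> ^ n * (norm f / l)" by simp
    show "(\<lambda>n. \<tau> ^ n * (norm f / l)) \<longlonglongrightarrow> 0"
      using \<tau> by (intro tendsto_mult_left_zero LIMSEQ_realpow_zero)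
  qed
  then have "(\<lambda>n. G f - G ((T ^^ n) f)) \<longlonglongrightarrow> G f - 0"
    by (rule tendsto_diff[OF tendsto_const])
  ultimately show ?thesis by (simp add: T_def[abs_def])
qed

lemma G_eigen:
  assumes "A f = a *\<^sub>R f" "0 \<le> a"
  shows "G f = (1 / (a + l)) *\<^sub>R f"
proof (rule G_eqI)
  have "a + l \<noteq> 0" using assms l by simp
  then show "R ((1 / (a + l)) *\<^sub>R f) = f"
    by (simp add: R.scaleR) (simp add: R_apply assms scaleR_add_left[symmetric])
qed

text \<open>Variational form of the resolvent: positivity of \<open>R\<close> at
  \<open>G f - g\<close>, with equality for \<open>g = G f\<close>.\<close>

lemma inner_G_lower: "2 * (f \<bullet> g) - g \<bullet> R g \<le> f \<bullet> G f"
proof -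
  have "0 \<le> R (G f - g) \<bullet> (G f - g)" by (rule R_nonneg)
  also have "\<dots> = f \<bullet> G f - 2 * (f \<bullet> g) + g \<bullet> R g"
    using R_sym[of g "G f"] by (simp add: R.diff inner_simps inner_commute)
  finally show ?thesis by simp
qed

text \<open>The tangent inequality for x/(x + l), obtained from positivity of A(A + l) at the vector
  \<open>G f - r *\<^sub>R f\<close>. A scalar \<open>r\<close> suffices because \<open>f\<close>
  will be an eigenvector of the population operator.\<close>

lemma inner_A_G_lower:
  "2 * r * (f \<bullet> A f) - r\<^sup>2 * ((norm (A f))\<^sup>2 + l * (f \<bullet> A f)) \<le> f \<bullet> A (G f)"
proof -
  let ?u = "G f - r *\<^sub>R f"
  have "0 \<le> A ?u \<bullet> A ?u + l * (A ?u \<bullet> ?u)"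
    using A_nonneg[of ?u] l by simp
  also have "\<dots> = A ?u \<bullet> R ?u" by (simp add: R_apply inner_simps)
  also have "\<dots> = f \<bullet> A (G f) - 2 * r * (f \<bullet> A f) + r\<^sup>2 * (A f \<bullet> R f)"
  proof -
    have "A (G f) \<bullet> R f = f \<bullet> A f" by (metis A_sym G_sym R_A_commute G_R)
    then show ?thesis
      by (simp add: A.diff R.diff A.scaleR R.scaleR inner_simps inner_commute power2_eq_square
          algebra_simps)
  qed
  also have "A f \<bullet> R f = (norm (A f))\<^sup>2 + l * (f \<bullet> A f)"
    by (simp add: R_apply inner_simps power2_norm_eq_inner inner_commute)
  finally show ?thesis by simp
qed

text \<open>The square root of \<open>R = c (1 - T)\<close> is \<open>\<surd>c (1 - Y)\<close>, where \<open>Y\<close> is the fixed point of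
  \<open>Y \<mapsto> (T + Y\<^sup>2) / 2\<close>, a contraction of a ball of radius less than one because
  \<open>\<parallel>T\<parallel> < 1\<close>.  As a limit of polynomials in \<open>T\<close> it commutes with everything that commutes
  with \<open>R\<close>.\<close>

lemma sqrt_exists:
  obtains B \<beta> where "positive_op B" "\<And>f. B (B f) = R f" "0 < \<beta>"
    "\<And>f. \<beta> * (norm f)\<^sup>2 \<le> B f \<bullet> f"
    "\<And>C f. bounded_linear C \<Longrightarrow> (\<And>f. C (R f) = R (C f)) \<Longrightarrow> C (B f) = B (C f)"
proof -
  obtain c \<tau> where c: "0 < c" "0 \<le> \<tau>" "\<tau> < 1"
    "\<And>f. norm (f - (1 / c) *\<^sub>R R f) \<le> \<tau> * norm f" by (rule contraction) blast
  define T where "T = Blinfun (\<lambda>f. f - (1 / c) *\<^sub>R R f)"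
  have T: "blinfun_apply T f = f - (1 / c) *\<^sub>R R f" for f
    unfolding T_def
    by (subst bounded_linear_Blinfun_apply)
      (intro bounded_linear_sub bounded_linear_ident
        bounded_linear_compose[OF bounded_linear_scaleR_right R_linear], simp)
  have norm_T: "norm T \<le> \<tau>" by (rule norm_blinfun_bound) (use c in \<open>auto simp: T\<close>)
  \<comment> \<open>The smaller root of (\<tau> + \<rho>^2)/2 = \<rho>: the ball of radius
    \<open>\<rho>\<close> is mapped into itself, and the map has Lipschitz constant
    \<open>\<rho>\<close> on it.\<close>
  define \<rho> where "\<rho> = 1 - sqrt (1 - \<tau>)"
  have \<rho>: "0 \<le> \<rho>" "\<rho> < 1" "(\<tau> + \<rho> * \<rho>) / 2 = \<rho>"
    using c by (auto simp: \<rho>_def field_simps)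
  \<comment> \<open>Symmetry and commutation are closed conditions preserved by
    \<open>\<Phi>\<close>; building them into the invariant set hands them to the fixed
    point.\<close>
  define Z where "Z = {Y :: 'h \<Rightarrow>\<^sub>L 'h. norm Y \<le> \<rho> \<and>
    (\<forall>f g. blinfun_apply Y f \<bullet> g = f \<bullet> blinfun_apply Y g) \<and>
    (\<forall>C. bounded_linear C \<and> (\<forall>f. C (R f) = R (C f)) \<longrightarrow>
      (\<forall>f. C (blinfun_apply Y f) = blinfun_apply Y (C f)))}"
  define \<Phi> where "\<Phi> Y = (1/2) *\<^sub>R (T + (Y o\<^sub>L Y))" for Y
  have "closed Z"
  proof -
    have cont: "continuous_on UNIV (\<lambda>Y :: 'h \<Rightarrow>\<^sub>L 'h. blinfun_apply Y f)" for f
      by (intro continuous_intros)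
    have C: "closed {Y :: 'h \<Rightarrow>\<^sub>L 'h. (\<forall>f. C (blinfun_apply Y f) = blinfun_apply Y (C f))}" if "bounded_linear C" for C
      by (intro closed_Collect_all closed_Collect_eq cont
          continuous_on_compose2[OF linear_continuous_on[OF that, of UNIV] cont]) auto
    have "Z = {Y. norm Y \<le> \<rho>} \<inter> {Y. \<forall>f g. blinfun_apply Y f \<bullet> g = f \<bullet> blinfun_apply Y g} \<inter>
      (\<Inter>C\<in>{C. bounded_linear C \<and> (\<forall>f. C (R f) = R (C f))}.
        {Y. \<forall>f. C (blinfun_apply Y f) = blinfun_apply Y (C f)})"
      by (auto simp: Z_def)
    also have "closed \<dots>"
      using C by (intro closed_Int closed_INT closed_Collect_all closed_Collect_le closed_Collect_eq
          continuous_intros cont ballI) auto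
    finally show ?thesis .
  qed
  then have "uniform_space_class.complete Z" by (simp add: complete_eq_closed)
  moreover have "0 \<in> Z" by (auto simp: Z_def \<rho> linear_simps bounded_linear.linear linear_0)
  moreover have "\<Phi> ` Z \<subseteq> Z"
  proof (rule image_subsetI)
    fix Y assume Y: "Y \<in> Z"
    have "norm (\<Phi> Y) \<le> (\<tau> + \<rho> * \<rho>) / 2"
      unfolding \<Phi>_def using Y norm_T \<rho>(1)
      by (auto simp: Z_def intro!: norm_triangle_le add_mono order_trans[OF norm_blinfun_compose]
          mult_mono)
    then show "\<Phi> Y \<in> Z"
      using Y unfolding Z_def \<Phi>_def
      by (auto simp: \<rho> T inner_simps R_sym blinfun.add_left blinfun.scaleR_left linear_simps)
  qed
  moreover have "\<forall>Y\<in>Z. \<forall>Y'\<in>Z. dist (\<Phi> Y) (\<Phi> Y') \<le> \<rho> * dist Y Y'"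
  proof (intro ballI)
    fix Y Y' assume Y: "Y \<in> Z" "Y' \<in> Z"
    have "\<Phi> Y - \<Phi> Y' = (1/2) *\<^sub>R ((Y o\<^sub>L (Y - Y')) + ((Y - Y') o\<^sub>L Y'))"
      by (rule blinfun_eqI)
        (simp add: \<Phi>_def blinfun.add_left blinfun.diff_left blinfun.diff_right blinfun.scaleR_left
          algebra_simps)
    then have "dist (\<Phi> Y) (\<Phi> Y') \<le> (1/2) * (\<rho> * norm (Y - Y') + norm (Y - Y') * \<rho>)"
      unfolding dist_norm norm_scaleR
      using Y \<rho>(1) by (simp only: norm_scaleR) (intro mult_mono norm_triangle_le add_mono
          order_trans[OF norm_blinfun_compose] mult_mono, auto simp: Z_def)
    then show "dist (\<Phi> Y) (\<Phi> Y') \<le> \<rho> * dist Y Y'" by (simp add: dist_norm mult.commute)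
  qed
  ultimately obtain Y where Y: "Y \<in> Z" "\<Phi> Y = Y"
    using Banach_fix[of Z \<rho> \<Phi>] \<rho> by blast
  have Y_sym: "Y f \<bullet> g = f \<bullet> Y g" and Y_norm: "norm Y \<le> \<rho>" for f g
    using Y(1) by (auto simp: Z_def)
  have Y_eq: "2 *\<^sub>R Y f = T f + Y (Y f)" for f
  proof -
    have "blinfun_apply (\<Phi> Y) f = Y f" using Y(2) by simp
    then show ?thesis by (simp add: \<Phi>_def blinfun.add_left blinfun.scaleR_left) (metis (no_types, opaque_lifting) scaleR_half_double scaleR_add_right scaleR_2 )
  qed
  define B where "B f = sqrt c *\<^sub>R (f - Y f)" for f
  have B_linear: "bounded_linear B"
    unfolding B_def
    by (intro bounded_linear_compose[OF bounded_linear_scaleR_right] bounded_linear_sub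
        bounded_linear_ident blinfun.bounded_linear_right)
  have B_coercive: "sqrt c * (1 - \<rho>) * (norm f)\<^sup>2 \<le> B f \<bullet> f" for f
  proof -
    have "Y f \<bullet> f \<le> norm (Y f) * norm f" by (rule norm_cauchy_schwarz)
    also have "\<dots> \<le> (\<rho> * norm f) * norm f"
      using Y_norm by (intro mult_right_mono order_trans[OF norm_blinfun]) auto
    finally have "(1 - \<rho>) * (norm f)\<^sup>2 \<le> (f - Y f) \<bullet> f"
      by (simp add: inner_simps power2_norm_eq_inner[symmetric] power2_eq_square algebra_simps)
    then show ?thesis using c(1) by (simp add: B_def mult.assoc)
  qed
  show thesis
  proof (rule that)
    have "0 \<le> B f \<bullet> f" for f
      using B_coercive[of f] \<rho> c by (smt (verit) mult_nonneg_nonneg real_sqrt_ge_zero zero_le_power2)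
    then show "positive_op B"
      using B_linear by (auto simp: positive_op_def B_def inner_simps Y_sym)
    show "B (B f) = R f" for f
    proof -
      have "B (B f) = c *\<^sub>R (f - 2 *\<^sub>R Y f + Y (Y f))"
        using c(1) by (simp add: B_def blinfun.diff_right blinfun.scaleR_right algebra_simps scaleR_2)
      also have "\<dots> = R f" using c(1) by (simp add: Y_eq T)
      finally show ?thesis .
    qed
    show "0 < sqrt c * (1 - \<rho>)" using c \<rho> by simp
    show "sqrt c * (1 - \<rho>) * (norm f)\<^sup>2 \<le> B f \<bullet> f" for f by (rule B_coercive)
    show "C (B f) = B (C f)" if "bounded_linear C" "\<And>f. C (R f) = R (C f)" for C f
      using Y(1) that by (auto simp: Z_def B_def linear_simps)
  qed
qed

text \<open>\<open>op_sqrt\<close> is given by \<open>THE\<close>, so the positive root must be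
  unique. Another root B' commutes with its square, hence with B, so (B + B')(B - B') = 0, and
  coercivity of B forces B = B'. As A commutes with B, both inverse roots can be moved to one
  side.\<close>

lemma whitened_eq: "whitened A l f = A (G f)"
proof -
  obtain B \<beta> where B: "positive_op B" "\<And>f. B (B f) = R f" "0 < \<beta>"
    "\<And>f. \<beta> * (norm f)\<^sup>2 \<le> B f \<bullet> f"
    "\<And>C f. bounded_linear C \<Longrightarrow> (\<And>f. C (R f) = R (C f)) \<Longrightarrow> C (B f) = B (C f)"
    by (rule sqrt_exists) blast
  have sqrt: "op_sqrt R = B"
    unfolding op_sqrt_def
  proof (rule the_equality)
    show "positive_op B \<and> B \<circ> B = R" using B by auto
  next
    fix B' assume B': "positive_op B' \<and> B' \<circ> B' = R"
    then interpret B': bounded_linear B' by (simp add: positive_op_def)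
    interpret B: bounded_linear B using B(1) by (simp add: positive_op_def)
    have sq: "B' (B' f) = R f" for f using B' by (metis comp_apply)
    have comm: "B' (B f) = B (B' f)" for f
      using B'.bounded_linear_axioms by (intro B(5)) (simp_all add: sq[symmetric])
    have "B' f = B f" for f
    proof -
      let ?g = "B f - B' f"
      have "B ?g + B' ?g = 0" by (simp add: B.diff B'.diff B(2) sq comm)
      then have "B ?g \<bullet> ?g + B' ?g \<bullet> ?g = 0" by (simp add: inner_add_left[symmetric])
      moreover have "0 \<le> B' ?g \<bullet> ?g" using B' by (auto simp: positive_op_def)
      ultimately have "\<beta> * (norm ?g)\<^sup>2 \<le> 0" using B(4)[of ?g] by linarith
      then show ?thesis using B(3) by (simp add: mult_le_0_iff)
    qed
    then show "B' = B" by auto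
  qed
  have "bij B"
  proof (rule bijI)
    show "inj B"
    proof (rule injI)
      fix f g assume "B f = B g"
      then have "R f = R g" by (simp only: B(2)[symmetric])
      then have "G (R f) = G (R g)" by (rule arg_cong)
      then show "f = g" by (simp only: G_R)
    qed
    have "f = B (B (G f))" for f using B(2)[of "G f"] by simp
    then show "surj B" unfolding surj_def by blast
  qed
  have A_B: "A (B f) = B (A f)" for f
    by (rule B(5)[OF A_linear]) (rule R_A_commute[symmetric])
  define g where "g = inv B (inv B f)"
  have "f = B (B g)" using \<open>bij B\<close> by (simp add: g_def bij_is_surj surj_f_inv_f)
  then have "G f = g" by (simp add: B(2))
  moreover have "inv B (A (inv B f)) = A g"
  proof -
    have "inv B f = B g" using \<open>bij B\<close> by (simp add: g_def bij_is_surj surj_f_inv_f)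
    then show ?thesis using \<open>bij B\<close> by (simp add: A_B bij_is_inj)
  qed
  ultimately show ?thesis
    by (simp add: whitened_def op_inv_sqrt_def R_def[symmetric] sqrt)
qed

lemma hs_norm_whitened:
  "(hs_norm (whitened A l))\<^sup>2 = infsum (\<lambda>e. (norm (A (G e)))\<^sup>2) (SOME E. orthonormal_basis E)"
  unfolding hs_norm_def whitened_eq by (simp add: infsum_nonneg)

lemma A_G_sym: "A (G f) \<bullet> g = f \<bullet> A (G g)"
  by (simp add: A_sym G_sym G_A_commute[symmetric])

end

section \<open>Finite sums of rank-one operators\<close>

definition frame_op :: "('i \<Rightarrow> 'h::real_inner) \<Rightarrow> 'i set \<Rightarrow> 'h \<Rightarrow> 'h" where
  "frame_op d I f = (\<Sum>p\<in>I. (d p \<bullet> f) *\<^sub>R d p)"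

lemma frame_op_inner: "frame_op d I f \<bullet> g = (\<Sum>p\<in>I. (d p \<bullet> f) * (d p \<bullet> g))"
  by (simp add: frame_op_def inner_sum_left)

lemma norm_frame_op_le: "norm (frame_op d I f) \<le> (\<Sum>p\<in>I. (norm (d p))\<^sup>2) * norm f"
  unfolding frame_op_def sum_distrib_right
proof (intro sum_norm_le)
  fix p
  have "norm ((d p \<bullet> f) *\<^sub>R d p) \<le> (norm (d p) * norm f) * norm (d p)"
    unfolding norm_scaleR by (intro mult_right_mono Cauchy_Schwarz_ineq2) simp
  then show "norm ((d p \<bullet> f) *\<^sub>R d p) \<le> (norm (d p))\<^sup>2 * norm f"
    by (simp add: power2_eq_square mult_ac)
qed

lemma positive_op_frame_op: "positive_op (frame_op d I)"
  unfolding positive_op_def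
proof (intro conjI allI)
  show "bounded_linear (frame_op d I)"
    by (rule bounded_linear_intro[where K = "\<Sum>p\<in>I. (norm (d p))\<^sup>2"])
      (use norm_frame_op_le in \<open>auto simp: frame_op_def inner_simps scaleR_add_left sum.distrib
        scaleR_sum_right mult.commute\<close>)
  show "frame_op d I f \<bullet> g = f \<bullet> frame_op d I g" for f g
    by (simp add: frame_op_inner inner_commute[of f] mult.commute)
  show "0 \<le> frame_op d I f \<bullet> f" for f
    by (simp add: frame_op_inner sum_nonneg)
qed

locale finite_frame =
  fixes d :: "'i \<Rightarrow> 'h::{real_inner,banach}" and I :: "'i set" and l :: real
  assumes l_pos: "0 < l"
begin

sublocale positive_regularization "frame_op d I" l
  by unfold_locales (use positive_op_frame_op l_pos in auto)

text \<open>Write \<open>frame_op d I\<close> as D D^T, where D has the columns \<open>d p\<close>.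
  This is the squared Frobenius norm of D^T G D, which has the same nonzero eigenvalues as the
  whitened operator. No basis occurs in it, which opens it to measurability and to
  comparison.\<close>

definition hs2 :: real where "hs2 = (\<Sum>p\<in>I. \<Sum>q\<in>I. (d p \<bullet> G (d q))\<^sup>2)"

lemma hs2_has_sum:
  assumes "finite I" "orthonormal_basis E"
  shows "((\<lambda>e. (norm (frame_op d I (G e)))\<^sup>2) has_sum hs2) E"
proof -
  have norm2: "(norm (frame_op d I (G e)))\<^sup>2
      = (\<Sum>p\<in>I. \<Sum>q\<in>I. (d p \<bullet> d q) * ((G (d p) \<bullet> e) * (G (d q) \<bullet> e)))" for e
    unfolding power2_norm_eq_inner frame_op_inner
    by (simp add: frame_op_def inner_sum_right sum_distrib_left G_sym mult_ac)
  \<comment> \<open>Summing over the basis leaves the products of \<open>G (d p)\<close> and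
    \<open>G (d q)\<close>; commuting \<open>G\<close> past the frame operator turns each row into a
    sum of squares.\<close>
  have row: "(\<Sum>q\<in>I. (d p \<bullet> d q) * (G (d p) \<bullet> G (d q))) = (\<Sum>q\<in>I. (d p \<bullet> G (d q))\<^sup>2)" for p
  proof -
    have "(\<Sum>q\<in>I. (d p \<bullet> d q) * (G (d p) \<bullet> G (d q))) = G (d p) \<bullet> G (frame_op d I (d p))"
      by (simp add: frame_op_def G.sum G.scaleR inner_sum_right inner_commute)
    also have "\<dots> = frame_op d I (G (d p)) \<bullet> G (d p)"
      by (simp add: G_A_commute inner_commute)
    also have "\<dots> = (\<Sum>q\<in>I. (d p \<bullet> G (d q))\<^sup>2)"
    proof -
      have "d q \<bullet> G (d p) = d p \<bullet> G (d q)" for q by (metis G_sym inner_commute)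
      then show ?thesis by (simp add: frame_op_inner power2_eq_square)
    qed
    finally show ?thesis .
  qed
  have "((\<lambda>e. \<Sum>p\<in>I. \<Sum>q\<in>I. (d p \<bullet> d q) * ((G (d p) \<bullet> e) * (G (d q) \<bullet> e))) has_sum
      (\<Sum>p\<in>I. \<Sum>q\<in>I. (d p \<bullet> d q) * (G (d p) \<bullet> G (d q)))) E"
    by (intro has_sum_sum has_sum_cmult_right parseval_inner assms)
  then show ?thesis by (simp add: norm2 row hs2_def)
qed

lemma hs_norm_whitened_frame_op:
  assumes "finite I"
  shows "(hs_norm (whitened (frame_op d I) l))\<^sup>2 = hs2"
  unfolding hs_norm_whitened using hs2_has_sum[OF assms orthonormal_basis_some]
  by (rule infsumI)

text \<open>Diagonal entries are all that the test against h(Sigma) sees, since that operator is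
  diagonal in the eigenvectors.\<close>

lemma hs2_ge_diagonal:
  assumes "finite I" "finite E" "orthonormal_set E"
  shows "(\<Sum>e\<in>E. (e \<bullet> frame_op d I (G e))\<^sup>2) \<le> hs2"
proof -
  obtain B :: "'h set" where B: "orthonormal_basis B" using orthonormal_basis_some ..
  have "(\<Sum>e\<in>E. (e \<bullet> frame_op d I (G e))\<^sup>2) \<le> (\<Sum>e\<in>E. (norm (frame_op d I (G e)))\<^sup>2)"
  proof (rule sum_mono)
    fix e assume "e \<in> E"
    then have "norm e = 1" using assms(3) by (simp add: orthonormal_set_def)
    then show "(e \<bullet> frame_op d I (G e))\<^sup>2 \<le> (norm (frame_op d I (G e)))\<^sup>2"
      using Cauchy_Schwarz_ineq[of e "frame_op d I (G e)"] by (simp add: power2_norm_eq_inner[symmetric])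
  qed
  also have "\<dots> \<le> infsum (\<lambda>e. (norm (frame_op d I (G e)))\<^sup>2) B"
    using hs_sum_le_basis(2)[OF A_G_sym assms(3) B] hs2_has_sum[OF assms(1) B] assms(2)
    by (auto simp: summable_on_def)
  also have "\<dots> = hs2" using hs2_has_sum[OF assms(1) B] by (rule infsumI)
  finally show ?thesis .
qed

end

text \<open>Only scalar products of the vectors are assumed measurable. Entries of the resolvent are
  limits of polynomials in them, by the Neumann series.\<close>

lemma hs2_measurable:
  fixes d :: "'y \<Rightarrow> 'i \<Rightarrow> 'h::{real_inner,banach}"
  assumes fin: "finite I" and l: "0 < l"
    and meas: "\<And>p q. p \<in> I \<Longrightarrow> q \<in> I \<Longrightarrow> (\<lambda>y. d y p \<bullet> d y q) \<in> borel_measurable M"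
    and bound: "\<And>y p. y \<in> space M \<Longrightarrow> p \<in> I \<Longrightarrow> (norm (d y p))\<^sup>2 \<le> c"
  shows "(\<lambda>y. finite_frame.hs2 (d y) I l) \<in> borel_measurable M"
proof -
  have frame: "finite_frame l" using l by unfold_locales
  \<comment> \<open>A bound for the norm of the regularized operator at every \<open>y\<close> at
    once, so that the step size does not vary with the sample.\<close>
  define B where "B = card I * \<bar>c\<bar> + l"
  define T where "T y f = f - (l / B\<^sup>2) *\<^sub>R (frame_op (d y) I f + l *\<^sub>R f)" for y f
  have power_meas: "(\<lambda>y. d y p \<bullet> (T y ^^ k) (d y q)) \<in> borel_measurable M"
    if "p \<in> I" "q \<in> I" for p q k
    using that(1)
  proof (induction k arbitrary: p)
    case (Suc k)
    have "d y p \<bullet> T y g = (1 - l / B\<^sup>2 * l) * (d y p \<bullet> g)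
        - l / B\<^sup>2 * (\<Sum>r\<in>I. (d y r \<bullet> g) * (d y p \<bullet> d y r))" for y g
      by (simp add: T_def frame_op_def inner_simps inner_sum_right algebra_simps)
    then show ?case using Suc meas by simp
  qed (use that meas in simp)
  have "(\<lambda>y. d y p \<bullet> positive_regularization.G (frame_op (d y) I) l (d y q)) \<in> borel_measurable M"
    if "p \<in> I" "q \<in> I" for p q
  proof (rule borel_measurable_LIMSEQ_real)
    fix y assume y: "y \<in> space M"
    interpret finite_frame "d y" I l by (rule frame)
    have "(\<Sum>p\<in>I. (norm (d y p))\<^sup>2) \<le> card I * \<bar>c\<bar>"
      using bound[OF y] by (intro sum_bounded_above) (meson abs_ge_self order_trans)
    then have "norm (R f) \<le> B * norm f" for f
    proof -
      have "norm (R f) \<le> norm (frame_op (d y) I f) + norm (l *\<^sub>R f)"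
        unfolding R_apply by (rule norm_triangle_ineq)
      also have "\<dots> \<le> (card I * \<bar>c\<bar>) * norm f + l * norm f"
        using norm_frame_op_le[of "d y" I f] l
          mult_right_mono[OF \<open>(\<Sum>p\<in>I. (norm (d y p))\<^sup>2) \<le> card I * \<bar>c\<bar>\<close>, of "norm f"] by simp
      finally show ?thesis by (simp add: B_def algebra_simps)
    qed
    moreover have "l \<le> B" by (simp add: B_def)
    ultimately have "(\<lambda>n. \<Sum>k<n. (l / B\<^sup>2) *\<^sub>R (T y ^^ k) (d y q)) \<longlonglongrightarrow> G (d y q)"
      using G_neumann_series[of B "d y q"] by (simp add: T_def[abs_def] R_apply)
    then show "(\<lambda>n. d y p \<bullet> (\<Sum>k<n. (l / B\<^sup>2) *\<^sub>R (T y ^^ k) (d y q))) \<longlonglongrightarrow> d y p \<bullet> G (d y q)"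
      by (intro tendsto_intros)
  next
    show "(\<lambda>y. d y p \<bullet> (\<Sum>k<n. (l / B\<^sup>2) *\<^sub>R (T y ^^ k) (d y q))) \<in> borel_measurable M" for n
      unfolding inner_sum_right inner_scaleR_right
      using power_meas[OF that] by measurable
  qed
  then show ?thesis
    unfolding finite_frame.hs2_def[OF frame] using fin by measurable
qed

text \<open>If \<open>T\<close> is a contraction, \<open>T (T S T + l)\<^sup>-\<^sup>1 T \<le> (S + l)\<^sup>-\<^sup>1\<close>, which orders the two
  matrices \<open>(d\<^sub>p \<bullet> G d\<^sub>q)\<close>; the Schur product theorem then orders their Frobenius norms.\<close>

lemma hs2_contraction_le:
  fixes d :: "'i \<Rightarrow> 'h::{real_inner,banach}"
  assumes fin: "finite I" and l: "0 < l" and lin: "linear T"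
    and sym: "\<And>f g. T f \<bullet> g = f \<bullet> T g" and contr: "\<And>f. norm (T f) \<le> norm f"
  shows "finite_frame.hs2 (\<lambda>p. T (d p)) I l \<le> finite_frame.hs2 d I l"
proof -
  interpret d: finite_frame d I l by unfold_locales fact
  interpret x: finite_frame "\<lambda>p. T (d p)" I l by unfold_locales fact
  let ?x = "\<lambda>p. T (d p)"
  have order: "T v \<bullet> x.G (T v) \<le> v \<bullet> d.G v" for v
  proof -
    let ?u = "x.G (T v)"
    let ?w = "T ?u"
    have "frame_op d I ?w \<bullet> ?w = frame_op ?x I ?u \<bullet> ?u"
      by (simp add: frame_op_inner sym)
    moreover have "(norm ?w)\<^sup>2 \<le> (norm ?u)\<^sup>2" using contr by (simp add: power_mono)
    ultimately have "?w \<bullet> d.R ?w \<le> x.R ?u \<bullet> ?u"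
      using l unfolding d.R_apply x.R_apply
      by (simp add: inner_simps inner_commute power2_norm_eq_inner)
    also have "\<dots> = T v \<bullet> ?u" by simp
    finally show ?thesis using d.inner_G_lower[of v ?w] by (simp add: sym)
  qed
  define D where "D p q = d p \<bullet> d.G (d q) - ?x p \<bullet> x.G (?x q)" for p q
  have psd: "0 \<le> (\<Sum>p\<in>I. \<Sum>q\<in>I. D p q * (c p * c q))" for c
  proof -
    let ?v = "\<Sum>p\<in>I. c p *\<^sub>R d p"
    have "?v \<bullet> d.G ?v = (\<Sum>p\<in>I. \<Sum>q\<in>I. (d p \<bullet> d.G (d q)) * (c p * c q))"
      unfolding inner_sum_left by (simp add: d.G.sum d.G.scaleR inner_sum_right sum_distrib_left mult_ac)
    moreover have "T ?v \<bullet> x.G (T ?v) = (\<Sum>p\<in>I. \<Sum>q\<in>I. (?x p \<bullet> x.G (?x q)) * (c p * c q))"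
      unfolding linear_sum[OF lin] inner_sum_left
      by (simp add: linear_scale[OF lin] x.G.sum x.G.scaleR inner_sum_right sum_distrib_left mult_ac)
    ultimately have "(\<Sum>p\<in>I. \<Sum>q\<in>I. D p q * (c p * c q)) = ?v \<bullet> d.G ?v - T ?v \<bullet> x.G (T ?v)"
      by (simp add: D_def sum_subtractf left_diff_distrib)
    then show ?thesis using order[of ?v] by simp
  qed
  define y where "y p = x.G (?x p)" for p
  obtain E :: "'h set" where E: "orthonormal_basis E" using orthonormal_basis_some ..
  \<comment> \<open>Splits the compressed matrix into Gram matrices. The sum of its entrywise
    products with \<open>D\<close> then becomes a sum of values of the quadratic form of
    \<open>D\<close>, which is the Schur argument.\<close>
  have gram: "?x p \<bullet> x.G (?x q) = (\<Sum>r\<in>I. (?x r \<bullet> y p) * (?x r \<bullet> y q)) + l * (y p \<bullet> y q)" for p q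
  proof -
    have "?x p \<bullet> x.G (?x q) = x.R (y p) \<bullet> y q" by (simp add: y_def)
    then show ?thesis by (simp add: x.R_apply inner_simps frame_op_inner)
  qed
  have "0 \<le> (\<Sum>p\<in>I. \<Sum>q\<in>I. D p q * (y p \<bullet> y q))"
  proof (rule has_sum_nonneg)
    show "((\<lambda>e. \<Sum>p\<in>I. \<Sum>q\<in>I. D p q * ((y p \<bullet> e) * (y q \<bullet> e))) has_sum
        (\<Sum>p\<in>I. \<Sum>q\<in>I. D p q * (y p \<bullet> y q))) E"
      by (intro has_sum_sum has_sum_cmult_right parseval_inner fin E)
  qed (rule psd)
  moreover have "0 \<le> (\<Sum>p\<in>I. \<Sum>q\<in>I. D p q * (\<Sum>r\<in>I. (?x r \<bullet> y p) * (?x r \<bullet> y q)))"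
  proof -
    have "(\<Sum>p\<in>I. \<Sum>q\<in>I. D p q * (\<Sum>r\<in>I. (?x r \<bullet> y p) * (?x r \<bullet> y q)))
        = (\<Sum>p\<in>I. \<Sum>q\<in>I. \<Sum>r\<in>I. D p q * ((?x r \<bullet> y p) * (?x r \<bullet> y q)))"
      by (simp add: sum_distrib_left)
    also have "\<dots> = (\<Sum>p\<in>I. \<Sum>r\<in>I. \<Sum>q\<in>I. D p q * ((?x r \<bullet> y p) * (?x r \<bullet> y q)))"
      by (intro sum.cong refl sum.swap)
    also have "\<dots> = (\<Sum>r\<in>I. \<Sum>p\<in>I. \<Sum>q\<in>I. D p q * ((?x r \<bullet> y p) * (?x r \<bullet> y q)))"
      by (rule sum.swap)
    also have "0 \<le> \<dots>" by (intro sum_nonneg psd)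
    finally show ?thesis .
  qed
  ultimately have "0 \<le> (\<Sum>p\<in>I. \<Sum>q\<in>I. D p q * (?x p \<bullet> x.G (?x q)))"
    using l unfolding gram
    by (simp add: distrib_left sum.distrib mult.left_commute[of _ l] sum_distrib_left[symmetric])
  then have "0 \<le> (\<Sum>p\<in>I. \<Sum>q\<in>I. 2 * (D p q * (?x p \<bullet> x.G (?x q))))"
    by (simp add: sum_distrib_left[symmetric])
  \<comment> \<open>Entrywise: (x + D)^2 - x^2 >= 2 D x.\<close>
  also have "\<dots> \<le> (\<Sum>p\<in>I. \<Sum>q\<in>I. (d p \<bullet> d.G (d q))\<^sup>2 - (?x p \<bullet> x.G (?x q))\<^sup>2)"
  proof (intro sum_mono)
    fix p q
    show "2 * (D p q * (?x p \<bullet> x.G (?x q))) \<le> (d p \<bullet> d.G (d q))\<^sup>2 - (?x p \<bullet> x.G (?x q))\<^sup>2"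
      using zero_le_power2[of "D p q"] unfolding D_def power2_eq_square by (simp add: algebra_simps)
  qed
  finally show ?thesis by (simp add: d.hs2_def x.hs2_def sum_subtractf)
qed


section \<open>Concentration of sums of independent bounded vectors\<close>

lemma exp_le_one_plus_quadratic:
  fixes x :: real
  assumes "x \<le> 1"
  shows "exp x \<le> 1 + x + x\<^sup>2"
proof (cases "0 \<le> x")
  case True
  then show ?thesis using exp_bound[of x] assms by simp
next
  case False
  define y where "y = - x"
  have "0 < y" using False by (simp add: y_def)
  \<comment> \<open>For negative arguments the claim is multiplied by exp y, which is at least 1 + y
    + y^2/2.\<close>
  have "1 \<le> (1 - y + y\<^sup>2) * (1 + y + y\<^sup>2 / 2)"
  proof -
    have "(1 - y + y\<^sup>2) * (1 + y + y\<^sup>2 / 2) = 1 + (y\<^sup>2 + y ^ 3 + y ^ 4) / 2"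
      by (simp add: field_simps power2_eq_square power3_eq_cube power4_eq_xxxx)
    then show ?thesis using \<open>0 < y\<close> by simp
  qed
  also have "\<dots> \<le> (1 - y + y\<^sup>2) * exp y"
  proof (rule mult_left_mono)
    show "1 + y + y\<^sup>2 / 2 \<le> exp y" using \<open>0 < y\<close> by (simp add: exp_lower_Taylor_quadratic)
    have "1 - y + y\<^sup>2 = (1 - y / 2)\<^sup>2 + 3 / 4 * y\<^sup>2" by (simp add: power2_eq_square field_simps)
    then show "0 \<le> 1 - y + y\<^sup>2" by simp
  qed
  finally have "exp (- y) \<le> (1 - y + y\<^sup>2) * exp y * exp (- y)" by simp
  then show ?thesis by (simp add: y_def mult.assoc exp_minus_inverse flip: exp_add)
qed

lemma power2_le_of_abs_le: "\<bar>x\<bar> \<le> c \<Longrightarrow> x\<^sup>2 \<le> c\<^sup>2" for x c :: real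
  using power_mono[of "\<bar>x\<bar>" c 2] by simp

text \<open>The centre \<open>w\<close> need not be the mean. The second moment about
  \<open>w\<close> dominates the variance, and the mean lies within \<open>B\<close> of
  \<open>w\<close>, so deviations from the mean are at most \<open>2 * B\<close>; this explains the
  factor 2 in the condition on \<open>\<theta>\<close>.\<close>

lemma (in prob_space) mgf_le_of_bounded:
  fixes W :: "'a \<Rightarrow> real"
  assumes [measurable]: "W \<in> borel_measurable M"
    and bound: "\<And>x. x \<in> space M \<Longrightarrow> \<bar>W x - w\<bar> \<le> B"
    and var: "expectation (\<lambda>x. (W x - w)\<^sup>2) \<le> V" and \<theta>: "0 \<le> \<theta>" "2 * B * \<theta> \<le> 1"
  shows "expectation (\<lambda>x. exp (\<theta> * W x)) \<le> exp (\<theta> * expectation W + \<theta>\<^sup>2 * V)"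
proof -
  have int_W: "integrable M W"
    by (rule integrable_const_bound[of _ "\<bar>w\<bar> + B"]) (use bound in fastforce)+
  define \<mu> where "\<mu> = expectation W"
  define D where "D x = W x - \<mu>" for x
  have [measurable]: "D \<in> borel_measurable M" by (simp add: D_def[abs_def])
  have "\<bar>\<mu> - w\<bar> \<le> B"
  proof -
    have "\<mu> - w = expectation (\<lambda>x. W x - w)" using int_W by (simp add: \<mu>_def prob_space)
    also have "\<bar>\<dots>\<bar> \<le> expectation (\<lambda>x. \<bar>W x - w\<bar>)" by (rule integral_abs_bound)
    also have "\<dots> \<le> expectation (\<lambda>x. B)"
      using int_W bound by (intro integral_mono) auto
    finally show ?thesis by (simp add: prob_space)
  qed
  then have D_bound: "\<bar>D x\<bar> \<le> 2 * B" if "x \<in> space M" for x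
    using bound[OF that] by (simp add: D_def)
  have int_D: "integrable M D"
    by (rule integrable_const_bound[of _ "2 * B"]) (use D_bound in auto)
  have int_D2: "integrable M (\<lambda>x. (D x)\<^sup>2)"
    by (rule integrable_const_bound[of _ "(2 * B)\<^sup>2"])
      (use power2_le_of_abs_le[OF D_bound] in \<open>auto intro!: AE_I2\<close>)
  have int_Ww: "integrable M (\<lambda>x. (W x - w)\<^sup>2)"
    by (rule integrable_const_bound[of _ "B\<^sup>2"])
      (use power2_le_of_abs_le[OF bound] in \<open>auto intro!: AE_I2\<close>)
  have "expectation D = 0" using int_W by (simp add: D_def[abs_def] \<mu>_def prob_space)
  have "expectation (\<lambda>x. (D x)\<^sup>2) \<le> V"
  proof -
    have "expectation (\<lambda>x. (W x - w)\<^sup>2) = expectation (\<lambda>x. (D x)\<^sup>2 + 2 * (\<mu> - w) * D x + (\<mu> - w)\<^sup>2)"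
      by (intro Bochner_Integration.integral_cong) (auto simp: D_def power2_eq_square algebra_simps)
    also have "\<dots> = expectation (\<lambda>x. (D x)\<^sup>2) + (\<mu> - w)\<^sup>2"
      using int_D int_D2 by (simp add: \<open>expectation D = 0\<close> prob_space)
    finally show ?thesis using var by (smt (verit) zero_le_power2)
  qed
  have \<theta>D: "\<theta> * D x \<le> 1" if "x \<in> space M" for x
    using mult_left_mono[OF abs_le_D1[OF D_bound[OF that]] \<theta>(1)] \<theta>(2) by (simp add: mult_ac)
  have "expectation (\<lambda>x. exp (\<theta> * D x)) \<le> expectation (\<lambda>x. 1 + \<theta> * D x + \<theta>\<^sup>2 * (D x)\<^sup>2)"
  proof (rule integral_mono)
    show "integrable M (\<lambda>x. exp (\<theta> * D x))"
      by (rule integrable_const_bound[of _ "exp 1"]) (use \<theta>D in auto)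
    show "integrable M (\<lambda>x. 1 + \<theta> * D x + \<theta>\<^sup>2 * (D x)\<^sup>2)" using int_D int_D2 by simp
    show "exp (\<theta> * D x) \<le> 1 + \<theta> * D x + \<theta>\<^sup>2 * (D x)\<^sup>2" if "x \<in> space M" for x
      using exp_le_one_plus_quadratic[OF \<theta>D[OF that]] by (simp add: power_mult_distrib)
  qed
  also have "\<dots> = 1 + \<theta>\<^sup>2 * expectation (\<lambda>x. (D x)\<^sup>2)"
    using int_D int_D2 by (simp add: \<open>expectation D = 0\<close> prob_space)
  also have "\<dots> \<le> 1 + \<theta>\<^sup>2 * V"
    using \<open>expectation (\<lambda>x. (D x)\<^sup>2) \<le> V\<close> by (simp add: mult_left_mono)
  also have "\<dots> \<le> exp (\<theta>\<^sup>2 * V)" by (rule exp_ge_add_one_self)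
  finally have "exp (\<theta> * \<mu>) * expectation (\<lambda>x. exp (\<theta> * D x)) \<le> exp (\<theta> * \<mu>) * exp (\<theta>\<^sup>2 * V)"
    by simp
  also have "exp (\<theta> * \<mu>) * expectation (\<lambda>x. exp (\<theta> * D x)) = expectation (\<lambda>x. exp (\<theta> * W x))"
    unfolding integral_mult_right_zero[symmetric] by (simp add: D_def algebra_simps flip: exp_add)
  finally show ?thesis by (simp add: \<mu>_def exp_add)
qed

text \<open>Puts the new coordinate outside, so that an induction hypothesis applies to the inner
  integral with that coordinate fixed.\<close>

lemma (in prob_space) PiM_integral_insert:
  fixes f :: "('j \<Rightarrow> 'a) \<Rightarrow> real"
  assumes J: "finite J" "j \<notin> J"
    and [measurable]: "f \<in> borel_measurable (Pi\<^sub>M (insert j J) (\<lambda>_. M))"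
    and bound: "\<And>Y. Y \<in> space (Pi\<^sub>M (insert j J) (\<lambda>_. M)) \<Longrightarrow> \<bar>f Y\<bar> \<le> c"
  shows "(\<integral>Y. f Y \<partial>Pi\<^sub>M (insert j J) (\<lambda>_. M)) = (\<integral>y. (\<integral>x. f (x(j := y)) \<partial>Pi\<^sub>M J (\<lambda>_. M)) \<partial>M)"
proof -
  interpret product_prob_space "\<lambda>_. M" UNIV by unfold_locales
  interpret J: prob_space "Pi\<^sub>M J (\<lambda>_. M)" by (intro prob_space_PiM) unfold_locales
  interpret JJ: prob_space "Pi\<^sub>M (insert j J) (\<lambda>_. M)" by (intro prob_space_PiM) unfold_locales
  interpret pair: pair_prob_space "Pi\<^sub>M J (\<lambda>_. M)" M by unfold_locales
  have int: "integrable (Pi\<^sub>M (insert j J) (\<lambda>_. M)) f"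
    by (rule JJ.integrable_const_bound[of _ c]) (use bound in auto)
  have "(\<integral>Y. f Y \<partial>Pi\<^sub>M (insert j J) (\<lambda>_. M)) = (\<integral>x. (\<integral>y. f (x(j := y)) \<partial>M) \<partial>Pi\<^sub>M J (\<lambda>_. M))"
    by (rule product_integral_insert[OF J int])
  also have "\<dots> = (\<integral>y. (\<integral>x. f (x(j := y)) \<partial>Pi\<^sub>M J (\<lambda>_. M)) \<partial>M)"
  proof (rule pair.Fubini_integral[symmetric])
    show "integrable (Pi\<^sub>M J (\<lambda>_. M) \<Otimes>\<^sub>M M) (\<lambda>(x, y). f (x(j := y)))"
    proof (rule pair.integrable_const_bound[of _ c])
      show "AE z in Pi\<^sub>M J (\<lambda>_. M) \<Otimes>\<^sub>M M. norm (case z of (x, y) \<Rightarrow> f (x(j := y))) \<le> c"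
        using bound J
        by (intro AE_I2) (auto simp: space_pair_measure space_PiM PiE_def extensional_def Pi_def)
    qed measurable
  qed
  finally show ?thesis .
qed

section \<open>Norms of sums of independent random vectors\<close>

lemma L2_set_diff_le: "\<bar>L2_set f A - L2_set g A\<bar> \<le> L2_set (\<lambda>i. f i - g i) A"
proof -
  have "L2_set f A \<le> L2_set (\<lambda>i. f i - g i) A + L2_set g A"
    using L2_set_triangle_ineq[of "\<lambda>i. f i - g i" g A] by simp
  moreover have "L2_set g A \<le> L2_set (\<lambda>i. g i - f i) A + L2_set f A"
    using L2_set_triangle_ineq[of "\<lambda>i. g i - f i" f A] by simp
  moreover have "L2_set (\<lambda>i. g i - f i) A = L2_set (\<lambda>i. f i - g i) A"
    by (simp add: L2_set_def power2_commute)
  ultimately show ?thesis by simp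
qed

lemma L2_set_sum_le: "L2_set (\<lambda>i. \<Sum>r\<in>J. f r i) A \<le> (\<Sum>r\<in>J. L2_set (f r) A)"
proof (induction J rule: infinite_finite_induct)
  case (insert r J)
  then show ?case using L2_set_triangle_ineq[of "f r" "\<lambda>i. \<Sum>r\<in>J. f r i" A] by simp
qed (auto simp: L2_set_0')

lemma power2_L2_set: "(L2_set f A)\<^sup>2 = (\<Sum>i\<in>A. (f i)\<^sup>2)"
  by (simp add: L2_set_def sum_nonneg)

text \<open>Vectors are families on a finite index set with Euclidean norm, so matrices with the
  Frobenius norm and scalars are both instances. \<open>V\<close> bounds the uncentred second
  moment.\<close>

locale bounded_random_vector = prob_space M for M :: "'p measure" +
  fixes X :: "'p \<Rightarrow> 'i \<Rightarrow> real" and I :: "'i set" and B V :: real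
  assumes fin: "finite I"
    and meas: "\<And>i. i \<in> I \<Longrightarrow> (\<lambda>p. X p i) \<in> borel_measurable M"
    and bound: "\<And>p. p \<in> space M \<Longrightarrow> L2_set (X p) I \<le> B"
    and second_moment: "expectation (\<lambda>p. (L2_set (X p) I)\<^sup>2) \<le> V"
begin

text \<open>The offset \<open>a\<close> holds the centring and the coordinates already revealed, so
  that inductions over \<open>J\<close> can generalise over it.\<close>

definition dev :: "('i \<Rightarrow> real) \<Rightarrow> 'j set \<Rightarrow> ('j \<Rightarrow> 'p) \<Rightarrow> real" where
  "dev a J Y = L2_set (\<lambda>i. a i + (\<Sum>r\<in>J. X (Y r) i)) I"

lemma X_bound:
  assumes "p \<in> space M" "i \<in> I"
  shows "\<bar>X p i\<bar> \<le> B"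
  using member_le_L2_set[OF fin assms(2), of "\<lambda>i. \<bar>X p i\<bar>"] bound[OF assms(1)]
  by (simp add: L2_set_def)

lemma X_integrable: "i \<in> I \<Longrightarrow> integrable M (\<lambda>p. X p i)"
  by (rule integrable_const_bound[of _ B]) (use X_bound meas in auto)

lemma X2_integrable: "i \<in> I \<Longrightarrow> integrable M (\<lambda>p. (X p i)\<^sup>2)"
  by (rule integrable_const_bound[of _ "B\<^sup>2"])
    (use power2_le_of_abs_le[OF X_bound] meas in \<open>auto intro!: AE_I2\<close>)

lemma dev_measurable [measurable]: "dev a J \<in> borel_measurable (Pi\<^sub>M J (\<lambda>_. M))"
proof -
  have "(\<lambda>Y. X (Y r) i) \<in> borel_measurable (Pi\<^sub>M J (\<lambda>_. M))" if "r \<in> J" "i \<in> I" for r i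
    by (rule measurable_compose[OF measurable_component_singleton[OF that(1)] meas[OF that(2)]])
  then show ?thesis unfolding dev_def[abs_def] L2_set_def by measurable
qed

lemma dev_nonneg: "0 \<le> dev a J Y" by (simp add: dev_def)

lemma dev_bound:
  assumes "Y \<in> space (Pi\<^sub>M J (\<lambda>_. M))"
  shows "dev a J Y \<le> L2_set a I + card J * B"
proof -
  have "(\<Sum>r\<in>J. L2_set (X (Y r)) I) \<le> (\<Sum>r\<in>J. B)"
    using assms by (intro sum_mono bound) (auto simp: space_PiM)
  then show ?thesis
    using L2_set_triangle_ineq[of a "\<lambda>i. \<Sum>r\<in>J. X (Y r) i" I] L2_set_sum_le[of "\<lambda>r. X (Y r)" J I]
    by (simp add: dev_def)
qed

lemma dev_insert:
  "finite J \<Longrightarrow> j \<notin> J \<Longrightarrow> dev a (insert j J) (x(j := y)) = dev (\<lambda>i. a i + X y i) J x"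
  unfolding dev_def by (intro L2_set_cong refl) (auto simp: add.assoc intro!: sum.cong)

lemma prob_space_PiM_M: "prob_space (Pi\<^sub>M J (\<lambda>_. M))"
  by (intro prob_space_PiM) unfold_locales

lemma dev_integrable: "integrable (Pi\<^sub>M J (\<lambda>_. M)) (dev a J)"
  by (rule finite_measure.integrable_const_bound[OF
        prob_space.finite_measure[OF prob_space_PiM_M], of _ "L2_set a I + card J * B"])
    (use dev_bound[of _ J a] dev_nonneg[of a J] in \<open>auto intro!: AE_I2 simp: abs_of_nonneg\<close>)

lemma integral_dev_measurable [measurable]:
  "(\<lambda>y. \<integral>x. dev (\<lambda>i. a i + X y i) J x \<partial>Pi\<^sub>M J (\<lambda>_. M)) \<in> borel_measurable M"
proof -
  interpret J: prob_space "Pi\<^sub>M J (\<lambda>_. M)" by (rule prob_space_PiM_M)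
  have X2: "(\<lambda>z. X (snd z r) i) \<in> borel_measurable (M \<Otimes>\<^sub>M Pi\<^sub>M J (\<lambda>_. M))"
    if "r \<in> J" "i \<in> I" for r i
    by (rule measurable_compose[OF _ meas[OF that(2)]]) (use that in measurable)
  have X1: "(\<lambda>z. X (fst z) i) \<in> borel_measurable (M \<Otimes>\<^sub>M Pi\<^sub>M J (\<lambda>_. M))"
    if "i \<in> I" for i
    by (rule measurable_compose[OF measurable_fst meas[OF that]])
  have "(\<lambda>(y, Y). dev (\<lambda>i. a i + X y i) J Y) \<in> borel_measurable (M \<Otimes>\<^sub>M Pi\<^sub>M J (\<lambda>_. M))"
    unfolding dev_def L2_set_def split_beta
    by (intro measurable_compose[OF _ borel_measurable_sqrt] borel_measurable_sum
        borel_measurable_power borel_measurable_add borel_measurable_const X1 X2)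
  then show ?thesis by (rule J.borel_measurable_lebesgue_integral)
qed

text \<open>Yurinskii's argument: revealing one coordinate changes the conditional expectation of the
  norm by at most the norm of that summand, so the scalar bound applies coordinate by coordinate.\<close>

lemma mgf_dev:
  assumes \<theta>: "0 \<le> \<theta>" "2 * B * \<theta> \<le> 1" and "finite J"
  shows "(\<integral>Y. exp (\<theta> * dev a J Y) \<partial>Pi\<^sub>M J (\<lambda>_. M))
    \<le> exp (\<theta> * (\<integral>Y. dev a J Y \<partial>Pi\<^sub>M J (\<lambda>_. M)) + card J * (\<theta>\<^sup>2 * V))"
  using \<open>finite J\<close>
proof (induction J arbitrary: a)
  case empty
  interpret E: prob_space "Pi\<^sub>M {} (\<lambda>_. M)" by (rule prob_space_PiM_M)
  show ?case by (simp add: dev_def E.prob_space)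
next
  case (insert j J)
  interpret J: prob_space "Pi\<^sub>M J (\<lambda>_. M)" by (rule prob_space_PiM_M)
  let ?a = "\<lambda>y i. a i + X y i"
  define F where "F y = (\<integral>x. dev (?a y) J x \<partial>Pi\<^sub>M J (\<lambda>_. M))" for y
  define w where "w = (\<integral>x. dev a J x \<partial>Pi\<^sub>M J (\<lambda>_. M))"
  have F_meas [measurable]: "F \<in> borel_measurable M" by (simp add: F_def[abs_def])
  have F_w: "\<bar>F y - w\<bar> \<le> L2_set (X y) I" for y
  proof -
    have "F y - w = (\<integral>x. dev (?a y) J x - dev a J x \<partial>Pi\<^sub>M J (\<lambda>_. M))"
      by (simp add: F_def w_def dev_integrable)
    also have "\<bar>\<dots>\<bar> \<le> (\<integral>x. \<bar>dev (?a y) J x - dev a J x\<bar> \<partial>Pi\<^sub>M J (\<lambda>_. M))"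
      by (rule integral_abs_bound)
    also have "\<dots> \<le> (\<integral>x. L2_set (X y) I \<partial>Pi\<^sub>M J (\<lambda>_. M))"
    proof (rule integral_mono)
      show "\<bar>dev (?a y) J x - dev a J x\<bar> \<le> L2_set (X y) I" for x
        using L2_set_diff_le[of "\<lambda>i. ?a y i + (\<Sum>r\<in>J. X (x r) i)" I "\<lambda>i. a i + (\<Sum>r\<in>J. X (x r) i)"]
        by (simp add: dev_def)
    qed (auto simp: dev_integrable)
    finally show ?thesis by (simp add: J.prob_space)
  qed
  have mean: "(\<integral>Y. dev a (insert j J) Y \<partial>Pi\<^sub>M (insert j J) (\<lambda>_. M)) = expectation F"
    by (subst PiM_integral_insert[where c = "L2_set a I + card (insert j J) * B"])
      (use insert dev_bound in \<open>auto simp: dev_insert F_def[abs_def] dev_nonneg simp del: card_insert_disjoint\<close>)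
  have "(\<integral>Y. exp (\<theta> * dev a (insert j J) Y) \<partial>Pi\<^sub>M (insert j J) (\<lambda>_. M))
      = expectation (\<lambda>y. \<integral>x. exp (\<theta> * dev (?a y) J x) \<partial>Pi\<^sub>M J (\<lambda>_. M))"
    by (subst PiM_integral_insert[where c = "exp (\<theta> * (L2_set a I + card (insert j J) * B))"])
      (use insert dev_bound \<theta>(1) in \<open>auto simp: dev_insert intro!: mult_left_mono simp del: card_insert_disjoint\<close>)
  also have "\<dots> \<le> expectation (\<lambda>y. exp (card J * (\<theta>\<^sup>2 * V)) * exp (\<theta> * F y))"
  proof (rule integral_mono_AE')
    show "integrable M (\<lambda>y. exp (card J * (\<theta>\<^sup>2 * V)) * exp (\<theta> * F y))"
    proof (intro integrable_mult_right integrable_const_bound[of _ "exp (\<theta> * (w + B))"] AE_I2)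
      fix y assume "y \<in> space M"
      then have "F y \<le> w + B" using F_w[of y] bound[of y] by linarith
      then show "norm (exp (\<theta> * F y)) \<le> exp (\<theta> * (w + B))" using \<theta>(1) by (simp add: mult_left_mono)
    qed simp
    show "AE y in M. (\<integral>x. exp (\<theta> * dev (?a y) J x) \<partial>Pi\<^sub>M J (\<lambda>_. M))
        \<le> exp (card J * (\<theta>\<^sup>2 * V)) * exp (\<theta> * F y)"
      using insert.IH by (auto simp: F_def add.commute simp flip: exp_add)
  qed auto
  also have "\<dots> = exp (card J * (\<theta>\<^sup>2 * V)) * expectation (\<lambda>y. exp (\<theta> * F y))" by simp
  also have "\<dots> \<le> exp (card J * (\<theta>\<^sup>2 * V)) * exp (\<theta> * expectation F + \<theta>\<^sup>2 * V)"
  proof (intro mult_left_mono mgf_le_of_bounded[where w = w and B = B] \<theta> F_meas)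
    show "\<bar>F y - w\<bar> \<le> B" if "y \<in> space M" for y
      using F_w[of y] bound[OF that] by linarith
    have "expectation (\<lambda>y. (F y - w)\<^sup>2) \<le> expectation (\<lambda>y. (L2_set (X y) I)\<^sup>2)"
    proof (rule integral_mono_AE')
      show "integrable M (\<lambda>y. (L2_set (X y) I)\<^sup>2)"
        unfolding power2_L2_set by (intro Bochner_Integration.integrable_sum X2_integrable)
      show "AE y in M. (F y - w)\<^sup>2 \<le> (L2_set (X y) I)\<^sup>2"
        using F_w by (intro AE_I2) (simp add: abs_le_square_iff[symmetric])
    qed auto
    then show "expectation (\<lambda>y. (F y - w)\<^sup>2) \<le> V" using second_moment by linarith
  qed simp
  also have "\<dots> = exp (\<theta> * (\<integral>Y. dev a (insert j J) Y \<partial>Pi\<^sub>M (insert j J) (\<lambda>_. M))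
      + card (insert j J) * (\<theta>\<^sup>2 * V))"
    using insert.hyps by (simp add: mean algebra_simps flip: exp_add)
  finally show ?case .
qed

text \<open>With the offset \<open>- card J\<close> times the mean the square vanishes and
  \<open>card J * V\<close> remains; other offsets arise only inside the induction.\<close>

lemma second_moment_dev:
  assumes "finite J"
  shows "(\<integral>Y. (dev a J Y)\<^sup>2 \<partial>Pi\<^sub>M J (\<lambda>_. M))
    \<le> (\<Sum>i\<in>I. (a i + card J * expectation (\<lambda>p. X p i))\<^sup>2) + card J * V"
  using assms
proof (induction J arbitrary: a)
  case empty
  interpret E: prob_space "Pi\<^sub>M {} (\<lambda>_. M)" by (rule prob_space_PiM_M)
  show ?case by (simp add: dev_def E.prob_space power2_L2_set)
next
  case (insert j J)
  let ?\<mu> = "\<lambda>i. expectation (\<lambda>p. X p i)"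
  let ?b = "\<lambda>i. a i + card J * ?\<mu> i"
  let ?g = "\<lambda>y. (\<Sum>i\<in>I. (?b i)\<^sup>2 + 2 * ?b i * X y i + (X y i)\<^sup>2) + card J * V"
  have le: "(\<integral>x. (dev (\<lambda>i. a i + X y i) J x)\<^sup>2 \<partial>Pi\<^sub>M J (\<lambda>_. M)) \<le> ?g y" for y
    using insert.IH[of "\<lambda>i. a i + X y i"] by (simp add: power2_eq_square algebra_simps)
  have "(\<integral>Y. (dev a (insert j J) Y)\<^sup>2 \<partial>Pi\<^sub>M (insert j J) (\<lambda>_. M))
      = expectation (\<lambda>y. \<integral>x. (dev (\<lambda>i. a i + X y i) J x)\<^sup>2 \<partial>Pi\<^sub>M J (\<lambda>_. M))"
    by (subst PiM_integral_insert[where c = "(L2_set a I + card (insert j J) * B)\<^sup>2"])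
      (use insert dev_bound in \<open>auto simp: dev_insert dev_nonneg intro!: power_mono simp del: card_insert_disjoint\<close>)
  also have "\<dots> \<le> expectation ?g"
  proof (rule integral_mono_AE')
    show "integrable M ?g"
      by (intro Bochner_Integration.integrable_add Bochner_Integration.integrable_sum integrable_mult_right
          X_integrable X2_integrable integrable_const)
    show "AE y in M. (\<integral>x. (dev (\<lambda>i. a i + X y i) J x)\<^sup>2 \<partial>Pi\<^sub>M J (\<lambda>_. M)) \<le> ?g y"
      by (intro AE_I2 le)
    show "AE y in M. 0 \<le> ?g y"
      by (intro AE_I2 order_trans[OF _ le] integral_nonneg) simp
  qed
  also have "expectation ?g = (\<Sum>i\<in>I. (?b i)\<^sup>2 + 2 * ?b i * ?\<mu> i) + expectation (\<lambda>p. (L2_set (X p) I)\<^sup>2) + card J * V"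
    unfolding power2_L2_set
    by (subst Bochner_Integration.integral_add Bochner_Integration.integral_sum;
        (intro Bochner_Integration.integrable_add Bochner_Integration.integrable_sum integrable_mult_right
          X_integrable X2_integrable integrable_const)?)+
      (simp_all add: X_integrable X2_integrable prob_space sum.distrib)
  \<comment> \<open>\<open>V\<close> bounds the uncentred moment, so the squared mean may be added;
    it completes the square.\<close>
  also have "\<dots> \<le> (\<Sum>i\<in>I. (?b i)\<^sup>2 + 2 * ?b i * ?\<mu> i + (?\<mu> i)\<^sup>2) + V + card J * V"
    using second_moment sum_mono[of I "\<lambda>i. (?b i)\<^sup>2 + 2 * ?b i * ?\<mu> i" "\<lambda>i. (?b i)\<^sup>2 + 2 * ?b i * ?\<mu> i + (?\<mu> i)\<^sup>2"]
    by simp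
  also have "\<dots> = (\<Sum>i\<in>I. (a i + card (insert j J) * ?\<mu> i)\<^sup>2) + card (insert j J) * V"
    using insert.hyps by (simp add: power2_eq_square algebra_simps)
  finally show ?case .
qed

lemma mean_dev_le:
  assumes "finite J"
  shows "(\<integral>Y. dev (\<lambda>i. - (card J * expectation (\<lambda>p. X p i))) J Y \<partial>Pi\<^sub>M J (\<lambda>_. M)) \<le> sqrt (card J * V)"
proof (rule real_le_rsqrt)
  interpret J: prob_space "Pi\<^sub>M J (\<lambda>_. M)" by (rule prob_space_PiM_M)
  let ?a = "\<lambda>i. - (card J * expectation (\<lambda>p. X p i))"
  have int2: "integrable (Pi\<^sub>M J (\<lambda>_. M)) (\<lambda>Y. (dev ?a J Y)\<^sup>2)"
    by (rule J.integrable_const_bound[of _ "(L2_set ?a I + card J * B)\<^sup>2"])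
      (use dev_bound dev_nonneg in \<open>auto intro!: AE_I2 power_mono\<close>)
  have "(J.expectation (dev ?a J))\<^sup>2 \<le> J.expectation (\<lambda>Y. (dev ?a J Y)\<^sup>2)"
    using J.variance_eq[OF dev_integrable int2] J.variance_positive[of "dev ?a J"] by simp
  also have "\<dots> \<le> card J * V" using second_moment_dev[OF assms, of ?a] by simp
  finally show "(J.expectation (dev ?a J))\<^sup>2 \<le> card J * V" .
qed

lemma mgf_centred_dev:
  assumes \<theta>: "0 \<le> \<theta>" "2 * B * \<theta> \<le> 1" and "finite J"
  shows "(\<integral>Y. exp (\<theta> * dev (\<lambda>i. - (card J * expectation (\<lambda>p. X p i))) J Y) \<partial>Pi\<^sub>M J (\<lambda>_. M))
    \<le> exp (\<theta> * sqrt (card J * V) + card J * (\<theta>\<^sup>2 * V))"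
  by (rule order_trans[OF mgf_dev[OF assms]])
    (use mean_dev_le[OF \<open>finite J\<close>] \<theta>(1) in \<open>simp add: mult_left_mono\<close>)

end


section \<open>Concentration of vector-valued U-statistics\<close>

text \<open>Permutations act transitively on ordered pairs of distinct elements, so the sum over
  permutations does not depend on the pair. Adding it up over all pairs counts the whole double sum
  once per permutation.\<close>

lemma sum_permutations_pair:
  fixes F :: "'a \<Rightarrow> 'a \<Rightarrow> real"
  assumes fin: "finite A" and ab: "a \<in> A" "b \<in> A" "a \<noteq> b"
  shows "real (card A) * (real (card A) - 1) * (\<Sum>\<pi> | \<pi> permutes A. F (\<pi> a) (\<pi> b))
    = fact (card A) * (\<Sum>i\<in>A. \<Sum>j\<in>A - {i}. F i j)"
proof -
  let ?P = "{\<pi>. \<pi> permutes A}"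
  define S where "S i j = (\<Sum>\<pi>\<in>?P. F (\<pi> i) (\<pi> j))" for i j
  have const: "S i j = S a b" if ij: "i \<in> A" "j \<in> A" "i \<noteq> j" for i j
  proof -
    \<comment> \<open>The first transposition sends \<open>a\<close> to \<open>i\<close> and
      \<open>b\<close> to \<open>c\<close>; the second sends \<open>c\<close> to \<open>j\<close>
      and fixes \<open>i\<close>, which differs from both.\<close>
    define c where "c = Transposition.transpose a i b"
    define \<tau> where "\<tau> = Transposition.transpose c j \<circ> Transposition.transpose a i"
    have "c \<in> A" "c \<noteq> i" using ab ij by (auto simp: c_def Transposition.transpose_def)
    have "Transposition.transpose a i permutes A" "Transposition.transpose c j permutes A"
      using ab ij \<open>c \<in> A\<close> by (auto intro: permutes_swap_id)
    then have "\<tau> permutes A" unfolding \<tau>_def by (rule permutes_compose)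
    have "\<tau> a = i" "\<tau> b = j"
      using \<open>c \<noteq> i\<close> ij by (auto simp: \<tau>_def c_def[symmetric])
    have "S a b = (\<Sum>\<pi>\<in>?P. F ((\<pi> \<circ> inv \<tau>) i) ((\<pi> \<circ> inv \<tau>) j))"
      unfolding S_def using \<open>\<tau> a = i\<close> \<open>\<tau> b = j\<close> permutes_inj[OF \<open>\<tau> permutes A\<close>]
      by (intro sum.cong refl) (auto simp: inv_f_eq)
    also have "\<dots> = S i j"
      unfolding S_def
      by (rule sum.reindex_bij_witness[of _ "\<lambda>\<pi>. \<pi> \<circ> \<tau>" "\<lambda>\<pi>. \<pi> \<circ> inv \<tau>"])
        (use \<open>\<tau> permutes A\<close> in \<open>auto simp: permutes_inv_o permutes_compose permutes_inv comp_assoc\<close>)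
    finally show ?thesis by simp
  qed
  have "(\<Sum>i\<in>A. \<Sum>j\<in>A - {i}. S i j) = (\<Sum>i\<in>A. \<Sum>j\<in>A - {i}. S a b)"
    by (intro sum.cong refl const) auto
  also have "\<dots> = real (card A) * (real (card A) - 1) * S a b"
  proof -
    have "1 \<le> card A" using fin ab by (auto simp: Suc_le_eq card_gt_0_iff)
    then show ?thesis using fin by (simp add: card_Diff_singleton of_nat_diff)
  qed
  finally have 1: "real (card A) * (real (card A) - 1) * S a b = (\<Sum>i\<in>A. \<Sum>j\<in>A - {i}. S i j)" by simp
  have "(\<Sum>i\<in>A. \<Sum>j\<in>A - {i}. S i j) = (\<Sum>z\<in>Sigma A (\<lambda>i. A - {i}). S (fst z) (snd z))"
    using fin by (simp add: sum.Sigma split_beta)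
  also have "\<dots> = (\<Sum>\<pi>\<in>?P. \<Sum>z\<in>Sigma A (\<lambda>i. A - {i}). F (\<pi> (fst z)) (\<pi> (snd z)))"
    unfolding S_def by (rule sum.swap)
  also have "\<dots> = (\<Sum>\<pi>\<in>?P. \<Sum>z\<in>Sigma A (\<lambda>i. A - {i}). F (fst z) (snd z))"
  proof (rule sum.cong[OF refl])
    fix \<pi> assume "\<pi> \<in> ?P"
    then have \<pi>: "\<pi> permutes A" by simp
    show "(\<Sum>z\<in>Sigma A (\<lambda>i. A - {i}). F (\<pi> (fst z)) (\<pi> (snd z))) = (\<Sum>z\<in>Sigma A (\<lambda>i. A - {i}). F (fst z) (snd z))"
      by (rule sum.reindex_bij_witness[of _ "map_prod (inv \<pi>) (inv \<pi>)" "map_prod \<pi> \<pi>"])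
        (use \<pi> permutes_inj[OF \<pi>] permutes_in_image[OF \<pi>] permutes_in_image[OF permutes_inv[OF \<pi>]]
           in \<open>auto simp: permutes_inverses inj_eq dest: injD[OF permutes_inj[OF permutes_inv[OF \<pi>]]]\<close>)
  qed
  also have "\<dots> = fact (card A) * (\<Sum>z\<in>Sigma A (\<lambda>i. A - {i}). F (fst z) (snd z))"
    using fin by (simp add: card_permutations[OF refl fin])
  also have "(\<Sum>z\<in>Sigma A (\<lambda>i. A - {i}). F (fst z) (snd z)) = (\<Sum>i\<in>A. \<Sum>j\<in>A - {i}. F i j)"
    using fin by (simp add: sum.Sigma split_beta)
  finally show ?thesis using 1 by (simp add: S_def)
qed

text \<open>Within one permutation the pairs thus form an i.i.d. sample, and an integral bound for
  the product measure carries over by \<open>integral_distr\<close>.\<close>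

lemma distr_PiM_disjoint_pairs:
  assumes P: "prob_space P" and J: "J \<noteq> {}"
    and ab: "\<And>r. r \<in> J \<Longrightarrow> a r \<in> I \<and> b r \<in> I \<and> a r \<noteq> b r"
    and disj: "\<And>r r'. r \<in> J \<Longrightarrow> r' \<in> J \<Longrightarrow> r \<noteq> r' \<Longrightarrow> {a r, b r} \<inter> {a r', b r'} = {}"
  shows "distr (Pi\<^sub>M I (\<lambda>_. P)) (Pi\<^sub>M J (\<lambda>_. P \<Otimes>\<^sub>M P)) (\<lambda>Y. \<lambda>r\<in>J. (Y (a r), Y (b r)))
    = Pi\<^sub>M J (\<lambda>_. P \<Otimes>\<^sub>M P)"
proof -
  interpret P: prob_space P by fact
  interpret prob_space "Pi\<^sub>M I (\<lambda>_. P)" by (intro prob_space_PiM P)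
  have comp: "distr (Pi\<^sub>M I (\<lambda>_. P)) P (\<lambda>Y. Y i) = P" if "i \<in> I" for i
    using distr_PiM_component[of I "\<lambda>_. P" i] P that by simp
  have "I \<noteq> {}" using J ab by auto
  have ind: "indep_vars (\<lambda>_. P) (\<lambda>i Y. Y i) I"
  proof (subst indep_vars_iff_distr_eq_PiM'[OF \<open>I \<noteq> {}\<close>])
    have "distr (Pi\<^sub>M I (\<lambda>_. P)) (Pi\<^sub>M I (\<lambda>_. P)) (\<lambda>x. \<lambda>i\<in>I. x i) = distr (Pi\<^sub>M I (\<lambda>_. P)) (Pi\<^sub>M I (\<lambda>_. P)) (\<lambda>x. x)"
      by (intro distr_cong refl) (auto simp: space_PiM PiE_restrict)
    also have "\<dots> = Pi\<^sub>M I (\<lambda>_. P)" by simp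
    also have "\<dots> = Pi\<^sub>M I (\<lambda>i. distr (Pi\<^sub>M I (\<lambda>_. P)) P (\<lambda>Y. Y i))"
      by (intro PiM_cong refl) (simp add: comp)
    finally show "distr (Pi\<^sub>M I (\<lambda>_. P)) (Pi\<^sub>M I (\<lambda>_. P)) (\<lambda>x. \<lambda>i\<in>I. x i)
        = Pi\<^sub>M I (\<lambda>i. distr (Pi\<^sub>M I (\<lambda>_. P)) P (\<lambda>Y. Y i))" .
  qed simp
  have pair: "distr (Pi\<^sub>M I (\<lambda>_. P)) (P \<Otimes>\<^sub>M P) (\<lambda>Y. (Y i, Y j)) = P \<Otimes>\<^sub>M P"
    if "i \<in> I" "j \<in> I" "i \<noteq> j" for i j
  proof -
    have "indep_var P (\<lambda>Y. Y i) P (\<lambda>Y. Y j)"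
    proof -
      have "indep_vars (\<lambda>b. Pi\<^sub>M (if b then {i} else {j}) (\<lambda>_. P))
          (\<lambda>b Y. restrict Y (if b then {i} else {j})) UNIV"
        using that by (intro indep_vars_restrict[OF ind]) (auto simp: disjoint_family_on_def)
      then have "indep_vars (\<lambda>b. P) (\<lambda>b Y. (restrict Y (if b then {i} else {j})) (if b then i else j)) UNIV"
        by (rule indep_vars_compose2[where Y = "\<lambda>b Z. Z (if b then i else j)"]) auto
      then show ?thesis unfolding indep_var_def
        by (rule iffD1[OF indep_vars_cong, rotated 3]) (auto split: bool.split)
    qed
    then show ?thesis using indep_var_distribution_eq[of P "\<lambda>Y. Y i" P "\<lambda>Y. Y j"] comp that by simp
  qed
  have "indep_vars (\<lambda>r. Pi\<^sub>M {a r, b r} (\<lambda>_. P)) (\<lambda>r Y. restrict Y {a r, b r}) J"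
    using ab disj by (intro indep_vars_restrict[OF ind]) (auto simp: disjoint_family_on_def)
  then have "indep_vars (\<lambda>r. P \<Otimes>\<^sub>M P) (\<lambda>r Y. (restrict Y {a r, b r} (a r), restrict Y {a r, b r} (b r))) J"
    by (rule indep_vars_compose2[where Y = "\<lambda>r Z. (Z (a r), Z (b r))"]) auto
  then have "indep_vars (\<lambda>r. P \<Otimes>\<^sub>M P) (\<lambda>r Y. (Y (a r), Y (b r))) J"
    by simp
  then have "distr (Pi\<^sub>M I (\<lambda>_. P)) (Pi\<^sub>M J (\<lambda>_. P \<Otimes>\<^sub>M P)) (\<lambda>Y. \<lambda>r\<in>J. (Y (a r), Y (b r)))
    = Pi\<^sub>M J (\<lambda>r. distr (Pi\<^sub>M I (\<lambda>_. P)) (P \<Otimes>\<^sub>M P) (\<lambda>Y. (Y (a r), Y (b r))))"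
    by (subst (asm) indep_vars_iff_distr_eq_PiM'[OF J]) (use ab in auto)
  also have "\<dots> = Pi\<^sub>M J (\<lambda>_. P \<Otimes>\<^sub>M P)"
    using ab by (intro PiM_cong refl) (simp add: pair)
  finally show ?thesis .
qed

locale bounded_pair_kernel = P: prob_space P + bounded_random_vector "P \<Otimes>\<^sub>M P" X I B V
  for P :: "'x measure" and X :: "'x \<times> 'x \<Rightarrow> 'i \<Rightarrow> real" and I B V
begin

definition ustat :: "nat \<Rightarrow> (nat \<Rightarrow> 'x) \<Rightarrow> 'i \<Rightarrow> real" where
  "ustat s Y i = (\<Sum>a\<in>{1..s}. \<Sum>b\<in>{1..s} - {a}. X (Y a, Y b) i) / (real s * (real s - 1))"

definition ustat_dev :: "nat \<Rightarrow> (nat \<Rightarrow> 'x) \<Rightarrow> real" where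
  "ustat_dev s Y = L2_set (\<lambda>i. ustat s Y i - expectation (\<lambda>p. X p i)) I"

lemma ustat_dev_measurable [measurable]: "ustat_dev s \<in> borel_measurable (Pi\<^sub>M {1..s} (\<lambda>_. P))"
proof -
  have "(\<lambda>Y. X (Y a, Y b) i) \<in> borel_measurable (Pi\<^sub>M {1..s} (\<lambda>_. P))"
    if "a \<in> {1..s}" "b \<in> {1..s} - {a}" "i \<in> I" for a b i
  proof (rule measurable_compose[OF _ meas[OF that(3)]])
    show "(\<lambda>Y. (Y a, Y b)) \<in> Pi\<^sub>M {1..s} (\<lambda>_. P) \<rightarrow>\<^sub>M P \<Otimes>\<^sub>M P"
      using that by (intro measurable_Pair measurable_component_singleton) auto
  qed
  then show ?thesis
    unfolding ustat_dev_def[abs_def] L2_set_def ustat_def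
    by (intro measurable_compose[OF _ borel_measurable_sqrt] borel_measurable_sum
        borel_measurable_power borel_measurable_diff borel_measurable_divide borel_measurable_const)
qed

text \<open>Hoeffding's device: the U-statistic is the average, over all permutations of the sample, of
  means over \<open>s div 2\<close> disjoint and hence independent pairs.\<close>

lemma ustat_dev_tail:
  assumes s: "2 \<le> s" and V: "0 < V" and q: "0 \<le> q"
    and B: "2 * B * sqrt (q / (real (s div 2) * V)) \<le> 1"
  shows "measure (Pi\<^sub>M {1..s} (\<lambda>_. P))
      {Y \<in> space (Pi\<^sub>M {1..s} (\<lambda>_. P)).
        sqrt (V / real (s div 2)) + 2 * sqrt (V * q / real (s div 2)) \<le> ustat_dev s Y}
    \<le> exp (- q)"
proof -
  let ?\<Omega> = "Pi\<^sub>M {1..s} (\<lambda>_. P)"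
  let ?S = "{\<pi>. \<pi> permutes {1..s}}"
  let ?\<mu> = "\<lambda>i. expectation (\<lambda>p. X p i)"
  define m where "m = s div 2"
  define J where "J = {..<m}"
  have m: "0 < m" "2 * m \<le> s" using s by (auto simp: m_def)
  have J: "finite J" "J \<noteq> {}" "card J = m" using m by (auto simp: J_def)
  interpret \<Omega>: prob_space ?\<Omega> by (intro prob_space_PiM P.prob_space_axioms)
  define c where "c i = - (card J * ?\<mu> i)" for i
  \<comment> \<open>For \<open>r < m\<close> the positions \<open>2 * r + 1\<close> and
    \<open>2 * r + 2\<close> run through 1, ..., 2 m; an odd \<open>s\<close> leaves out the last
    one.\<close>
  define pairs where "pairs \<pi> Y = (\<lambda>r\<in>J. (Y (\<pi> (2 * r + 1)), Y (\<pi> (2 * r + 2))))"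
    for \<pi> :: "nat \<Rightarrow> nat" and Y :: "nat \<Rightarrow> 'x"
  have pairs_distr: "distr ?\<Omega> (Pi\<^sub>M J (\<lambda>_. P \<Otimes>\<^sub>M P)) (pairs \<pi>) = Pi\<^sub>M J (\<lambda>_. P \<Otimes>\<^sub>M P)"
    and pairs_meas: "pairs \<pi> \<in> ?\<Omega> \<rightarrow>\<^sub>M Pi\<^sub>M J (\<lambda>_. P \<Otimes>\<^sub>M P)" if "\<pi> \<in> ?S" for \<pi>
  proof -
    have \<pi>: "\<pi> permutes {1..s}" using that by simp
    have inj: "\<pi> x = \<pi> y \<longleftrightarrow> x = y" for x y using permutes_inj[OF \<pi>] by (auto simp: inj_eq)
    have mem: "\<pi> (2 * r + 1) \<in> {1..s}" "\<pi> (2 * r + 2) \<in> {1..s}" if "r \<in> J" for r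
      unfolding permutes_in_image[OF \<pi>] using that m by (auto simp: J_def)
    show "distr ?\<Omega> (Pi\<^sub>M J (\<lambda>_. P \<Otimes>\<^sub>M P)) (pairs \<pi>) = Pi\<^sub>M J (\<lambda>_. P \<Otimes>\<^sub>M P)"
      unfolding pairs_def
    proof (rule distr_PiM_disjoint_pairs[OF P.prob_space_axioms J(2)])
      fix r r' assume "r \<in> J" "r' \<in> J" "r \<noteq> r'"
      then show "{\<pi> (2 * r + 1), \<pi> (2 * r + 2)} \<inter> {\<pi> (2 * r' + 1), \<pi> (2 * r' + 2)} = {}"
        unfolding inj disjoint_iff by (auto simp: inj; presburger)
    qed (use mem in \<open>simp_all add: inj\<close>)
    show "pairs \<pi> \<in> ?\<Omega> \<rightarrow>\<^sub>M Pi\<^sub>M J (\<lambda>_. P \<Otimes>\<^sub>M P)"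
      unfolding pairs_def
      by (intro measurable_restrict measurable_Pair measurable_component_singleton mem)
  qed
  \<comment> \<open>Chosen so that m \<theta>^2 V = q. The term \<open>2 * sqrt (V * q / m)\<close>
    of the threshold then contributes 2 q to the Chernoff exponent; one q cancels the quadratic part
    of the moment bound and the other is left.\<close>
  define \<theta> where "\<theta> = sqrt (q / (m * V))"
  have \<theta>: "0 \<le> \<theta>" "2 * B * \<theta> \<le> 1" using q V B by (auto simp: \<theta>_def m_def)
  have average: "real m * ustat_dev s Y \<le> (\<Sum>\<pi>\<in>?S. (1 / fact s) * dev c J (pairs \<pi> Y))" for Y
  proof -
    have U: "m * (ustat s Y i - ?\<mu> i)
        = (\<Sum>\<pi>\<in>?S. (1 / fact s) * (c i + (\<Sum>r\<in>J. X (pairs \<pi> Y r) i)))" for i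
    proof -
      have card: "real (card ?S) = fact s" using card_permutations[of "{1..s}" s] by simp
      have divide: "x = f * (y / d)" if "d * x = f * y" "d \<noteq> 0" for x y f d :: real
        using that by (simp add: field_simps)
      have "(\<Sum>\<pi>\<in>?S. \<Sum>r\<in>J. X (pairs \<pi> Y r) i)
          = (\<Sum>r\<in>J. \<Sum>\<pi>\<in>?S. X (Y (\<pi> (2 * r + 1)), Y (\<pi> (2 * r + 2))) i)"
        by (subst sum.swap) (simp add: pairs_def)
      also have "\<dots> = (\<Sum>r\<in>J. fact s * ustat s Y i)"
      proof (rule sum.cong[OF refl])
        fix r assume "r \<in> J"
        have "real s * (real s - 1) * (\<Sum>\<pi>\<in>?S. X (Y (\<pi> (2 * r + 1)), Y (\<pi> (2 * r + 2))) i)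
            = fact s * (\<Sum>a\<in>{1..s}. \<Sum>b\<in>{1..s} - {a}. X (Y a, Y b) i)"
          using sum_permutations_pair[of "{1..s}" "2 * r + 1" "2 * r + 2" "\<lambda>a b. X (Y a, Y b) i"]
            \<open>r \<in> J\<close> m by (simp add: J_def)
        moreover have "real s * (real s - 1) \<noteq> 0" using s by simp
        ultimately show "(\<Sum>\<pi>\<in>?S. X (Y (\<pi> (2 * r + 1)), Y (\<pi> (2 * r + 2))) i) = fact s * ustat s Y i"
          unfolding ustat_def by (rule divide)
      qed
      finally have "(\<Sum>\<pi>\<in>?S. \<Sum>r\<in>J. X (pairs \<pi> Y r) i) = m * (fact s * ustat s Y i)"
        by (simp add: J(3))
      then show ?thesis
        unfolding sum_distrib_left[symmetric] sum.distrib
        using card by (simp add: c_def J(3) algebra_simps)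
    qed
    have "real m * ustat_dev s Y = L2_set (\<lambda>i. m * (ustat s Y i - ?\<mu> i)) I"
      unfolding ustat_dev_def by (rule L2_set_right_distrib) simp
    also have "\<dots> \<le> (\<Sum>\<pi>\<in>?S. L2_set (\<lambda>i. (1 / fact s) * (c i + (\<Sum>r\<in>J. X (pairs \<pi> Y r) i))) I)"
      unfolding U by (rule L2_set_sum_le)
    also have "\<dots> = (\<Sum>\<pi>\<in>?S. (1 / fact s) * dev c J (pairs \<pi> Y))"
      unfolding dev_def by (intro sum.cong refl L2_set_right_distrib[symmetric]) simp
    finally show ?thesis .
  qed
  \<comment> \<open>Convexity of exp takes the average outside, so dependence between different
    permutations does no harm.\<close>
  have exp_average: "exp (\<theta> * (real m * ustat_dev s Y))
      \<le> (\<Sum>\<pi>\<in>?S. (1 / fact s) * exp (\<theta> * dev c J (pairs \<pi> Y)))" for Y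
  proof -
    have "exp (\<theta> * (real m * ustat_dev s Y)) \<le> exp (\<Sum>\<pi>\<in>?S. (1 / fact s) *\<^sub>R (\<theta> * dev c J (pairs \<pi> Y)))"
      using mult_left_mono[OF average \<theta>(1)] by (simp add: sum_distrib_left mult_ac)
    also have "\<dots> \<le> (\<Sum>\<pi>\<in>?S. (1 / fact s) * exp (\<theta> * dev c J (pairs \<pi> Y)))"
    proof (rule convex_on_sum[OF _ _ exp_convex])
      show "?S \<noteq> {}" using permutes_id[of "{1..s}"] by blast
    qed (use card_permutations[of "{1..s}" s] finite_permutations[of "{1..s}"] in auto)
    finally show ?thesis .
  qed
  have term_meas: "(\<lambda>Y. exp (\<theta> * dev c J (pairs \<pi> Y))) \<in> borel_measurable ?\<Omega>" if "\<pi> \<in> ?S" for \<pi>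
    by (rule measurable_compose[OF pairs_meas[OF that], of "\<lambda>Z. exp (\<theta> * dev c J Z)"]) measurable
  have term_int: "integrable ?\<Omega> (\<lambda>Y. exp (\<theta> * dev c J (pairs \<pi> Y)))" if "\<pi> \<in> ?S" for \<pi>
  proof (rule \<Omega>.integrable_const_bound[of _ "exp (\<theta> * (L2_set c I + card J * B))"])
    show "AE Y in ?\<Omega>. norm (exp (\<theta> * dev c J (pairs \<pi> Y))) \<le> exp (\<theta> * (L2_set c I + card J * B))"
      using dev_bound[of _ J c] measurable_space[OF pairs_meas[OF that]] \<theta>(1)
      by (intro AE_I2) (auto intro!: mult_left_mono)
  qed (rule term_meas[OF that])
  have term_le: "(\<integral>Y. exp (\<theta> * dev c J (pairs \<pi> Y)) \<partial>?\<Omega>)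
      \<le> exp (\<theta> * sqrt (m * V) + m * (\<theta>\<^sup>2 * V))" if "\<pi> \<in> ?S" for \<pi>
  proof -
    have "(\<integral>Y. exp (\<theta> * dev c J (pairs \<pi> Y)) \<partial>?\<Omega>)
        = (\<integral>Z. exp (\<theta> * dev c J Z) \<partial>distr ?\<Omega> (Pi\<^sub>M J (\<lambda>_. P \<Otimes>\<^sub>M P)) (pairs \<pi>))"
      by (rule integral_distr[OF pairs_meas[OF that], symmetric]) measurable
    also have "\<dots> \<le> exp (\<theta> * sqrt (card J * V) + card J * (\<theta>\<^sup>2 * V))"
      unfolding pairs_distr[OF that] c_def by (rule mgf_centred_dev[OF \<theta> J(1)])
    finally show ?thesis by (simp add: J(3))
  qed
  let ?t = "sqrt (V / m) + 2 * sqrt (V * q / m)"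
  have m\<theta>2: "m * (\<theta>\<^sup>2 * V) = q" using V q m by (simp add: \<theta>_def)
  have int: "integrable ?\<Omega> (\<lambda>Y. exp (\<theta> * (real m * ustat_dev s Y)))"
  proof (rule Bochner_Integration.integrable_bound)
    show "integrable ?\<Omega> (\<lambda>Y. \<Sum>\<pi>\<in>?S. (1 / fact s) * exp (\<theta> * dev c J (pairs \<pi> Y)))"
      by (intro Bochner_Integration.integrable_sum integrable_mult_right term_int)
    show "AE Y in ?\<Omega>. norm (exp (\<theta> * (real m * ustat_dev s Y)))
        \<le> norm (\<Sum>\<pi>\<in>?S. (1 / fact s) * exp (\<theta> * dev c J (pairs \<pi> Y)))"
      using exp_average by (intro AE_I2) (auto intro: order_trans[OF _ abs_ge_self])
  qed measurable
  have "(\<integral>Y. exp (\<theta> * (real m * ustat_dev s Y)) \<partial>?\<Omega>)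
      \<le> (\<integral>Y. (\<Sum>\<pi>\<in>?S. (1 / fact s) * exp (\<theta> * dev c J (pairs \<pi> Y))) \<partial>?\<Omega>)"
    by (intro integral_mono int exp_average Bochner_Integration.integrable_sum integrable_mult_right term_int)
  also have "\<dots> = (\<Sum>\<pi>\<in>?S. (1 / fact s) * (\<integral>Y. exp (\<theta> * dev c J (pairs \<pi> Y)) \<partial>?\<Omega>))"
    by (subst Bochner_Integration.integral_sum) (intro integrable_mult_right term_int, assumption, simp)
  also have "\<dots> \<le> (\<Sum>\<pi>\<in>?S. (1 / fact s) * exp (\<theta> * sqrt (m * V) + m * (\<theta>\<^sup>2 * V)))"
    by (intro sum_mono mult_left_mono term_le) auto
  also have "\<dots> = exp (\<theta> * sqrt (m * V) + q)"
    unfolding m\<theta>2 using card_permutations[of "{1..s}" s] by simp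
  finally have mgf: "(\<integral>Y. exp (\<theta> * (real m * ustat_dev s Y)) \<partial>?\<Omega>) \<le> exp (\<theta> * sqrt (m * V) + q)" .
  have \<theta>t: "\<theta> * (m * ?t) = \<theta> * sqrt (m * V) + 2 * q"
  proof -
    have "m * sqrt (V / m) = sqrt ((real m)\<^sup>2 * (V / m))"
      unfolding real_sqrt_mult by simp
    also have "(real m)\<^sup>2 * (V / m) = m * V" using m by (simp add: power2_eq_square)
    finally have "m * sqrt (V / m) = sqrt (m * V)" .
    moreover have "\<theta> * (m * sqrt (V * q / m)) = q"
    proof -
      have "\<theta> * sqrt (V * q / m) = sqrt ((q / m)\<^sup>2)"
        unfolding \<theta>_def real_sqrt_mult[symmetric] using V by (simp add: power2_eq_square)
      then have "\<theta> * sqrt (V * q / m) = q / m" using q by simp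
      then show ?thesis using m by (simp add: field_simps)
    qed
    ultimately show ?thesis by (simp add: distrib_left)
  qed
  have "measure ?\<Omega> {Y \<in> space ?\<Omega>. ?t \<le> ustat_dev s Y}
      \<le> measure ?\<Omega> {Y \<in> space ?\<Omega>. exp (\<theta> * (m * ?t)) \<le> exp (\<theta> * (real m * ustat_dev s Y))}"
  proof (rule \<Omega>.finite_measure_mono)
    have "exp (\<theta> * (m * ?t)) \<le> exp (\<theta> * (real m * ustat_dev s Y))" if "?t \<le> ustat_dev s Y" for Y
      unfolding exp_le_cancel_iff by (intro mult_left_mono that \<theta>(1)) simp
    then show "{Y \<in> space ?\<Omega>. ?t \<le> ustat_dev s Y}
        \<subseteq> {Y \<in> space ?\<Omega>. exp (\<theta> * (m * ?t)) \<le> exp (\<theta> * (real m * ustat_dev s Y))}" by blast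
  qed measurable
  also have "\<dots> \<le> (\<integral>Y. exp (\<theta> * (real m * ustat_dev s Y)) \<partial>?\<Omega>) / exp (\<theta> * (m * ?t))"
    by (rule integral_Markov_inequality_measure[OF int, of "space ?\<Omega>"]) auto
  also have "\<dots> \<le> exp (\<theta> * sqrt (m * V) + q) / exp (\<theta> * (m * ?t))"
    using mgf by (intro divide_right_mono) auto
  also have "\<dots> = exp (- q)" unfolding \<theta>t exp_diff[symmetric] by simp
  finally show ?thesis by (simp add: m_def)
qed

end


section \<open>Positive operators with a complete system of eigenvectors\<close>

text \<open>\<open>v_complete\<close> says that \<open>A\<close> vanishes on the orthogonal
  complement of the eigenvectors, so every basis containing them diagonalises \<open>A\<close>, with
  eigenvalue 0 on the added vectors.\<close>

locale eigen_system = positive_regularization A l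
  for A :: "'h::{real_inner,banach} \<Rightarrow> 'h" and l +
  fixes lam :: "nat \<Rightarrow> real" and v :: "nat \<Rightarrow> 'h" and c :: real
  assumes lam_pos: "0 < lam i" and lam_dec: "decseq lam"
    and v_inner: "v i \<bullet> v j = (if i = j then 1 else 0)"
    and v_eigen: "A (v i) = lam i *\<^sub>R v i"
    and v_complete: "(\<And>i. f \<bullet> v i = 0) \<Longrightarrow> A f = 0"
    and lam_sum: "(\<Sum>i<n. lam i) \<le> c"
begin

definition rho :: "nat \<Rightarrow> real" where "rho i = lam i / (lam i + l)"

lemma rho_bounds: "0 \<le> rho i" "rho i \<le> 1" "rho i \<le> lam i / l"
  using lam_pos[of i] l by (auto simp: rho_def field_simps)

lemma v_inj: "inj v"
proof (rule injI)
  fix i j assume "v i = v j"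
  then show "i = j" using v_inner[of i i] v_inner[of i j] by (auto split: if_splits)
qed

lemma v_orthonormal: "orthonormal_set (range v)"
  by (auto simp: orthonormal_set_def pairwise_def orthogonal_def v_inner norm_eq_1)

lemma rho_summable: "summable rho"
proof (rule summable_comparison_test)
  have "summable lam"
    using lam_pos lam_sum by (intro summableI_nonneg_bounded[of lam c]) (auto intro: less_imp_le)
  then show "summable (\<lambda>i. lam i / l)" by (rule summable_divide)
  show "\<exists>N. \<forall>n\<ge>N. norm (rho n) \<le> lam n / l" using rho_bounds by (auto simp: abs_of_nonneg)
qed

lemma rho2_summable: "summable (\<lambda>i. (rho i)\<^sup>2)"
proof (rule summable_comparison_test[OF _ rho_summable])
  show "\<exists>N. \<forall>n\<ge>N. norm ((rho n)\<^sup>2) \<le> rho n"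
    using rho_bounds by (auto simp: power2_eq_square mult_left_le)
qed

definition B :: "'h set" where "B = (SOME E. range v \<subseteq> E \<and> orthonormal_basis E)"

lemma B: "range v \<subseteq> B" "orthonormal_basis B"
proof -
  have "range v \<subseteq> B \<and> orthonormal_basis B"
    unfolding B_def by (rule someI_ex) (rule orthonormal_set_extend_basis[OF v_orthonormal])
  then show "range v \<subseteq> B" "orthonormal_basis B" by auto
qed

lemma eigen_outside:
  assumes "b \<in> B - range v"
  shows "A b = 0"
proof (rule v_complete)
  fix i
  have "orthonormal_set B" using B(2) by (rule orthonormal_basis_orthonormal_set)
  moreover have "b \<in> B" "v i \<in> B" "b \<noteq> v i" using assms B(1) by auto
  ultimately show "b \<bullet> v i = 0" by (simp add: orthonormal_set_inner)
qed

definition eig :: "'h \<Rightarrow> real" where "eig b = (if b \<in> range v then lam (inv v b) else 0)"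

lemma eig_v [simp]: "eig (v i) = lam i"
  by (simp add: eig_def v_inj)

lemma A_basis: "b \<in> B \<Longrightarrow> A b = eig b *\<^sub>R b"
  using eigen_outside[of b] by (cases "b \<in> range v") (auto simp: v_eigen eig_def v_inj)

lemma eig_bounds: "0 \<le> eig b" "eig b \<le> lam 0"
  using lam_pos lam_dec by (auto simp: eig_def less_imp_le decseqD)

definition wt :: "'h \<Rightarrow> real" where "wt b = eig b / (eig b + l)"

lemma wt_v [simp]: "wt (v i) = rho i" by (simp add: wt_def rho_def)

lemma wt_nonneg: "0 \<le> wt b" using eig_bounds[of b] l by (simp add: wt_def)

lemma A_G_basis: "b \<in> B \<Longrightarrow> A (G b) = wt b *\<^sub>R b"
  using G_eigen[OF A_basis eig_bounds(1), of b] by (simp add: A.scaleR A_basis wt_def)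

lemma has_sum_basis:
  fixes f :: "real \<Rightarrow> real"
  assumes "summable (\<lambda>i. f (rho i))" "\<And>x. 0 \<le> f x" "f 0 = 0"
  shows "((\<lambda>b. f (wt b)) has_sum (\<Sum>i. f (rho i))) B"
proof -
  have "((\<lambda>i. f (rho i)) has_sum (\<Sum>i. f (rho i))) UNIV"
    using assms by (intro sums_nonneg_imp_has_sum summable_sums) auto
  then have "((\<lambda>b. f (wt b)) has_sum (\<Sum>i. f (rho i))) (range v)"
    using v_inj by (subst has_sum_reindex) (auto simp: comp_def)
  then show ?thesis
    by (rule has_sum_cong_neutral[THEN iffD1, rotated 3])
      (use B(1) assms(3) in \<open>auto simp: wt_def eig_def\<close>)
qed

lemma onorm_le: "onorm A \<le> lam 0"
proof (rule onorm_bound)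
  show "0 \<le> lam 0" using lam_pos by (simp add: less_imp_le)
  fix f
  have "(norm (A f))\<^sup>2 \<le> (lam 0)\<^sup>2 * (norm f)\<^sup>2"
  proof (rule has_sum_mono)
    show "((\<lambda>b. (A f \<bullet> b)\<^sup>2) has_sum (norm (A f))\<^sup>2) B" by (rule parseval[OF B(2)])
    show "((\<lambda>b. (lam 0)\<^sup>2 * (f \<bullet> b)\<^sup>2) has_sum (lam 0)\<^sup>2 * (norm f)\<^sup>2) B"
      by (intro has_sum_cmult_right parseval[OF B(2)])
    show "(A f \<bullet> b)\<^sup>2 \<le> (lam 0)\<^sup>2 * (f \<bullet> b)\<^sup>2" if "b \<in> B" for b
      using eig_bounds[of b] by (simp add: A_sym A_basis[OF that] power_mult_distrib mult_right_mono power_mono)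
  qed
  then have "(norm (A f))\<^sup>2 \<le> (lam 0 * norm f)\<^sup>2" by (simp add: power_mult_distrib)
  then show "norm (A f) \<le> lam 0 * norm f"
    by (rule power2_le_imp_le) (use lam_pos[of 0] in simp)
qed

text \<open>N2 has to be bounded from above, so the unspecified basis in \<open>hs_norm\<close> is
  compared in one direction with the eigenbasis.\<close>

lemma hs_norm_whitened_le: "(hs_norm (whitened A l))\<^sup>2 \<le> (\<Sum>i. (rho i)\<^sup>2)"
proof -
  have "((\<lambda>b. (wt b)\<^sup>2) has_sum (\<Sum>i. (rho i)\<^sup>2)) B"
    by (rule has_sum_basis[of "\<lambda>x. x\<^sup>2"]) (use rho2_summable in auto)
  then have hs: "((\<lambda>b. (norm (A (G b)))\<^sup>2) has_sum (\<Sum>i. (rho i)\<^sup>2)) B"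
  proof (rule has_sum_cong[THEN iffD1, rotated])
    fix b assume b: "b \<in> B"
    have "norm b = 1"
      using b orthonormal_basis_orthonormal_set[OF B(2)] by (simp add: orthonormal_set_def)
    then show "(wt b)\<^sup>2 = (norm (A (G b)))\<^sup>2" by (simp add: A_G_basis[OF b])
  qed
  have "infsum (\<lambda>e. (norm (A (G e)))\<^sup>2) (SOME E. orthonormal_basis E) \<le> infsum (\<lambda>b. (norm (A (G b)))\<^sup>2) B"
    by (rule hs_sum_le_basis(2)[OF A_G_sym orthonormal_basis_orthonormal_set[OF orthonormal_basis_some]
          B(2) has_sum_imp_summable[OF hs]])
  then show ?thesis using infsumI[OF hs] by (simp add: hs_norm_whitened)
qed

text \<open>Here the trace is bounded from below: it will replace the sum of the
  \<open>rho i\<close> in a bound on the features.\<close>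

lemma sum_rho_le_trace: "(\<Sum>i<n. rho i) \<le> op_trace (whitened A l)"
proof -
  define E where "E = (SOME E :: 'h set. orthonormal_basis E)"
  have E: "orthonormal_basis E" unfolding E_def by (rule orthonormal_basis_some)
  have form: "((\<lambda>b. wt b * (f \<bullet> b)\<^sup>2) has_sum (A (G f) \<bullet> f)) B" for f
    using parseval_inner[OF B(2), of "A (G f)" f]
    by (rule has_sum_cong[THEN iffD1, rotated])
      (simp add: A_G_sym A_G_basis power2_eq_square)
  \<comment> \<open>Convergence in the unspecified basis comes first: \<open>infsum\<close> of a
    family without a sum is 0, which would falsify the bound.\<close>
  have finite_le: "(\<Sum>e\<in>F. A (G e) \<bullet> e) \<le> (\<Sum>i. rho i)" if F: "finite F" "F \<subseteq> E" for F
  proof (rule has_sum_mono)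
    show "((\<lambda>b. \<Sum>e\<in>F. wt b * (e \<bullet> b)\<^sup>2) has_sum (\<Sum>e\<in>F. A (G e) \<bullet> e)) B"
      by (intro has_sum_sum F form)
    show "(wt has_sum (\<Sum>i. rho i)) B"
    proof -
      have "((\<lambda>b. \<bar>wt b\<bar>) has_sum (\<Sum>i. \<bar>rho i\<bar>)) B"
        using rho_bounds by (intro has_sum_basis) (auto simp: abs_of_nonneg rho_summable)
      then show ?thesis using rho_bounds wt_nonneg by (simp add: abs_of_nonneg)
    qed
    fix b assume "b \<in> B"
    then have "norm b = 1"
      using orthonormal_basis_orthonormal_set[OF B(2)] by (simp add: orthonormal_set_def)
    have "orthonormal_set F"
      using orthonormal_set_subset[OF orthonormal_basis_orthonormal_set[OF E] F(2)] .
    then have "(\<Sum>e\<in>F. (e \<bullet> b)\<^sup>2) \<le> 1"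
      using bessel[OF _ F(1), of b] \<open>norm b = 1\<close> by (simp add: inner_commute)
    then show "(\<Sum>e\<in>F. wt b * (e \<bullet> b)\<^sup>2) \<le> wt b"
      using wt_nonneg[of b] by (simp add: sum_distrib_left[symmetric] mult_left_le)
  qed
  have nonneg: "0 \<le> A (G e) \<bullet> e" for e
    using form[of e] by (rule has_sum_nonneg) (simp add: wt_nonneg)
  have summable: "(\<lambda>e. A (G e) \<bullet> e) summable_on E"
    using finite_le nonneg by (intro nonneg_bdd_above_summable_on) (auto intro!: bdd_aboveI2)
  have "(\<Sum>i<n. rho i * (norm (v i))\<^sup>2) \<le> infsum (\<lambda>e. A (G e) \<bullet> e) E"
  proof (rule has_sum_mono)
    show "((\<lambda>e. \<Sum>i<n. rho i * (v i \<bullet> e)\<^sup>2) has_sum (\<Sum>i<n. rho i * (norm (v i))\<^sup>2)) E"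
      by (intro has_sum_sum has_sum_cmult_right parseval E) simp
    show "((\<lambda>e. A (G e) \<bullet> e) has_sum infsum (\<lambda>e. A (G e) \<bullet> e) E) E" using summable by simp
    fix e
    have "(\<Sum>i<n. rho i * (v i \<bullet> e)\<^sup>2) = (\<Sum>b\<in>v ` {..<n}. wt b * (e \<bullet> b)\<^sup>2)"
      using v_inj by (subst sum.reindex) (auto simp: inner_commute intro: inj_on_subset)
    also have "\<dots> \<le> A (G e) \<bullet> e"
      using form[of e] B(1) by (intro finite_sum_le_has_sum) (auto simp: wt_nonneg)
    finally show "(\<Sum>i<n. rho i * (v i \<bullet> e)\<^sup>2) \<le> A (G e) \<bullet> e" .
  qed
  moreover have "norm (v i) = 1" for i using v_inner[of i i] by (simp add: norm_eq_1)
  ultimately show ?thesis by (simp add: op_trace_def whitened_eq E_def)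
qed

end


section \<open>The covariance operator of a kernel\<close>

lemma eq_if_inner_eq: "(\<And>f. x \<bullet> f = y \<bullet> f) \<Longrightarrow> x = y" for x y :: "'h::real_inner"
  using inner_eq_zero_iff[of "x - y"] by (simp add: inner_diff_left)

lemma abs_integral_le:
  fixes f g :: "'a \<Rightarrow> real"
  assumes "integrable M f" "integrable M g" "\<And>x. \<bar>f x\<bar> \<le> g x"
  shows "\<bar>\<integral>x. f x \<partial>M\<bar> \<le> (\<integral>x. g x \<partial>M)"
  by (rule order_trans[OF integral_abs_bound]) (intro integral_mono integrable_abs assms)

lemma L2_fun_mult_integrable:
  assumes "g \<in> L2_fun P" "h \<in> L2_fun P"
  shows "integrable P (\<lambda>x. g x * h x)"
proof (rule Bochner_Integration.integrable_bound)
  show "integrable P (\<lambda>x. (g x)\<^sup>2 + (h x)\<^sup>2)" using assms by (simp add: L2_fun_def)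
  show "(\<lambda>x. g x * h x) \<in> borel_measurable P" using assms by (auto simp: L2_fun_def)
  have "\<bar>g x * h x\<bar> \<le> (g x)\<^sup>2 + (h x)\<^sup>2" for x
    using sum_squares_bound[of "\<bar>g x\<bar>" "\<bar>h x\<bar>"] mult_nonneg_nonneg[of "\<bar>g x\<bar>" "\<bar>h x\<bar>"]
    by (simp add: abs_mult mult.assoc del: zero_le_mult_iff mult_nonneg_nonneg)
  then show "AE x in P. norm (g x * h x) \<le> norm ((g x)\<^sup>2 + (h x)\<^sup>2)" by simp
qed

lemma L2_fun_diff_scaled:
  assumes "g \<in> L2_fun P" "h \<in> L2_fun P"
  shows "(\<lambda>x. g x - a * h x) \<in> L2_fun P"
proof -
  have "integrable P (\<lambda>x. (g x)\<^sup>2 - 2 * a * (g x * h x) + a\<^sup>2 * (h x)\<^sup>2)"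
    using assms L2_fun_mult_integrable[OF assms] by (simp add: L2_fun_def)
  then have "integrable P (\<lambda>x. (g x - a * h x)\<^sup>2)"
    by (simp add: power2_eq_square algebra_simps)
  then show ?thesis using assms by (auto simp: L2_fun_def)
qed

lemma L2_inner_commute: "L2_inner P g h = L2_inner P h g"
  by (simp add: L2_inner_def mult.commute)

text \<open>Elements of L2 are representatives, so norm 0 means equality almost everywhere only;
  pairing with \<open>f\<close> turns it into an equation.\<close>

lemma L2_inner_eq_scaled_if_norm_zero:
  assumes gh: "g \<in> L2_fun P" "h \<in> L2_fun P" and f: "f \<in> L2_fun P"
    and zero: "L2_norm P (\<lambda>x. g x - a * h x) = 0"
  shows "L2_inner P f g = a * L2_inner P f h"
proof -
  let ?d = "\<lambda>x. g x - a * h x"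
  have d: "?d \<in> L2_fun P" using gh by (rule L2_fun_diff_scaled)
  have "(\<integral>x. (?d x)\<^sup>2 \<partial>P) = 0"
    using zero by (simp add: L2_norm_def L2_inner_def power2_eq_square)
  then have "AE x in P. (?d x)\<^sup>2 = 0"
    using d by (subst (asm) integral_nonneg_eq_0_iff_AE) (auto simp: L2_fun_def)
  then have "AE x in P. f x * g x = a * (f x * h x)" by eventually_elim simp
  then have "L2_inner P f g = (\<integral>x. a * (f x * h x) \<partial>P)"
    unfolding L2_inner_def using L2_fun_mult_integrable[OF f gh(1)] L2_fun_mult_integrable[OF f gh(2)]
    by (intro integral_cong_AE) auto
  then show ?thesis by (simp add: L2_inner_def)
qed

locale kernel_model = P0: prob_space P0
  for P0 :: "'x::second_countable_topology measure" +
  fixes evl :: "'h::{real_inner,banach} \<Rightarrow> 'x \<Rightarrow> real"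
    and K :: "'x \<Rightarrow> 'x \<Rightarrow> real"
    and \<kappa> :: real
  assumes rkhs: "rkhs evl K"
    and K_cont: "continuous_on UNIV (\<lambda>(x, y). K x y)"
    and K_bound: "K x x \<le> \<kappa>"
    and sets_P0: "sets P0 = sets borel"
begin

definition k :: "'x \<Rightarrow> 'h" where "k = kernel_at evl K"

lemma k: "evl (k x) = (\<lambda>y. K y x)" "evl f x = f \<bullet> k x"
proof -
  obtain h where h: "evl h = (\<lambda>y. K y x)" "\<And>f. evl f x = f \<bullet> h"
    using rkhs unfolding rkhs_def by blast
  have "k x = h"
    unfolding k_def kernel_at_def h(1)[symmetric] using rkhs by (simp add: rkhs_def)
  then show "evl (k x) = (\<lambda>y. K y x)" "evl f x = f \<bullet> k x" using h by auto
qed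

lemma K_eq: "K y x = k x \<bullet> k y"
  using k(1)[of x] k(2)[of "k x" y] by (metis)

lemma norm_k: "(norm (k x))\<^sup>2 \<le> \<kappa>"
  using K_bound[of x] by (simp add: K_eq power2_norm_eq_inner)

lemma \<kappa>_nonneg: "0 \<le> \<kappa>"
  using norm_k[of undefined] zero_le_power2 order_trans by blast

lemma norm_k_le: "norm (k x) \<le> sqrt \<kappa>"
  using norm_k by (simp add: real_le_rsqrt)

lemma norm_k_diff: "(norm (k x - k y))\<^sup>2 \<le> 4 * \<kappa>"
proof -
  have "norm (k x - k y) \<le> 2 * sqrt \<kappa>"
    using norm_triangle_ineq4[of "k x" "k y"] norm_k_le[of x] norm_k_le[of y] by simp
  from power_mono[OF this, of 2] show ?thesis using \<kappa>_nonneg by (simp add: power_mult_distrib)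
qed

text \<open>The distance of two features is a continuous expression in the kernel.\<close>

lemma k_continuous: "continuous_on UNIV k"
  unfolding continuous_on_def
proof (intro ballI)
  fix x
  have K2: "continuous_on UNIV (\<lambda>y. K (f y) (g y))" if "continuous_on UNIV f" "continuous_on UNIV g"
    for f g :: "'x \<Rightarrow> 'x"
    using continuous_on_compose2[OF K_cont continuous_on_Pair[OF that]] by simp
  have "continuous_on UNIV (\<lambda>y. sqrt (K y y - 2 * K y x + K x x))"
    by (intro continuous_intros K2)
  then have "((\<lambda>y. sqrt (K y y - 2 * K y x + K x x)) \<longlongrightarrow> sqrt (K x x - 2 * K x x + K x x)) (at x within UNIV)"
    unfolding continuous_on_def by blast
  moreover have "sqrt (K y y - 2 * K y x + K x x) = dist (k y) (k x)" for y
    unfolding dist_norm norm_eq_sqrt_inner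
    by (simp add: K_eq inner_simps inner_commute)
  ultimately show "(k \<longlongrightarrow> k x) (at x within UNIV)"
    by (subst tendsto_dist_iff) simp
qed

lemma evl_measurable [measurable]: "(\<lambda>x. f \<bullet> k x) \<in> borel_measurable P0"
proof -
  have "(\<lambda>x. f \<bullet> k x) \<in> borel_measurable borel"
    by (intro borel_measurable_continuous_onI continuous_intros k_continuous)
  then show ?thesis by (simp only: measurable_cong_sets[OF sets_P0 refl])
qed

text \<open>Continuity gives Borel measurability on the product space; second countability
  identifies its Borel sets with the product sigma-algebra.\<close>

lemma inner_k_measurable: "(\<lambda>z. k (fst z) \<bullet> k (snd z)) \<in> borel_measurable (P0 \<Otimes>\<^sub>M P0)"
proof -
  have "(\<lambda>(x, y). K x y) \<in> borel_measurable borel"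
    by (rule borel_measurable_continuous_onI[OF K_cont])
  then have [measurable]: "(\<lambda>(x, y). K x y) \<in> borel_measurable (borel \<Otimes>\<^sub>M borel)"
    by (simp only: borel_prod)
  have "(\<lambda>z. (\<lambda>(x, y). K x y) (snd z, fst z)) \<in> borel_measurable (borel \<Otimes>\<^sub>M borel)"
    by measurable
  then have "(\<lambda>z. K (snd z) (fst z)) \<in> borel_measurable (borel \<Otimes>\<^sub>M borel)" by simp
  moreover have "borel_measurable (P0 \<Otimes>\<^sub>M P0)
      = (borel_measurable (borel \<Otimes>\<^sub>M borel) :: ('x \<times> 'x \<Rightarrow> real) set)"
    by (rule measurable_cong_sets[OF sets_pair_measure_cong[OF sets_P0 sets_P0] refl])
  ultimately show ?thesis by (simp only: K_eq)
qed

lemma inner_bounded_integrable: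
  assumes [measurable]: "(\<lambda>x. f \<bullet> z x) \<in> borel_measurable P0" and "\<And>x. norm (z x) \<le> b"
  shows "integrable P0 (\<lambda>x. f \<bullet> z x)"
proof (rule P0.integrable_const_bound[of _ "norm f * b"])
  show "AE x in P0. norm (f \<bullet> z x) \<le> norm f * b"
    unfolding real_norm_def
    by (intro AE_I2 order_trans[OF Cauchy_Schwarz_ineq2 mult_left_mono[OF assms(2)]]) simp
qed measurable

text \<open>The mean embedding is taken in the weak sense, as the Riesz representative of the
  expectation functional.\<close>

lemma mean_exists: "\<exists>m. \<forall>f. (\<integral>x. f \<bullet> k x \<partial>P0) = m \<bullet> f"
proof -
  have int: "integrable P0 (\<lambda>x. f \<bullet> k x)" for f
    by (rule inner_bounded_integrable[OF evl_measurable norm_k_le])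
  have "bounded_linear (\<lambda>f. \<integral>x. f \<bullet> k x \<partial>P0)"
  proof (rule bounded_linear_intro)
    show "norm (\<integral>x. f \<bullet> k x \<partial>P0) \<le> norm f * sqrt \<kappa>" for f
    proof -
      have le: "norm (f \<bullet> k x) \<le> norm f * sqrt \<kappa>" for x
        unfolding real_norm_def
        by (rule order_trans[OF Cauchy_Schwarz_ineq2 mult_left_mono[OF norm_k_le]]) simp
      have "norm (\<integral>x. f \<bullet> k x \<partial>P0) \<le> (\<integral>x. norm f * sqrt \<kappa> \<partial>P0)"
        unfolding real_norm_def
        by (rule abs_integral_le[OF int P0.integrable_const le[unfolded real_norm_def]])
      then show ?thesis by (simp add: P0.prob_space)
    qed
  qed (simp_all add: inner_simps int)
  from riesz_closed_subspace[OF subspace_UNIV closed_UNIV this] show ?thesis by auto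
qed

definition mean :: 'h where "mean = (SOME m. \<forall>f. (\<integral>x. f \<bullet> k x \<partial>P0) = m \<bullet> f)"

lemma mean: "(\<integral>x. f \<bullet> k x \<partial>P0) = f \<bullet> mean"
proof -
  have "\<forall>f. (\<integral>x. f \<bullet> k x \<partial>P0) = mean \<bullet> f" unfolding mean_def by (rule someI_ex[OF mean_exists])
  then show ?thesis unfolding inner_commute[of f mean] by blast
qed

definition z :: "'x \<Rightarrow> 'h" where "z x = k x - mean"

lemma centred_incl: "centred_incl P0 evl f = (\<lambda>x. f \<bullet> z x)"
  by (simp add: centred_incl_def z_def k(2) mean inner_diff_right)

lemma norm_z_le: "norm (z x) \<le> 2 * sqrt \<kappa>"
proof -
  have "(norm mean)\<^sup>2 = (\<integral>x. mean \<bullet> k x \<partial>P0)" by (simp add: mean power2_norm_eq_inner)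
  also have "\<dots> \<le> (\<integral>x. norm mean * sqrt \<kappa> \<partial>P0)"
    by (intro integral_mono inner_bounded_integrable[OF evl_measurable norm_k_le] P0.integrable_const
        order_trans[OF norm_cauchy_schwarz] mult_left_mono norm_k_le) auto
  finally have "norm mean * norm mean \<le> norm mean * sqrt \<kappa>" by (simp add: P0.prob_space power2_eq_square)
  then have "norm mean \<le> sqrt \<kappa>" using \<kappa>_nonneg by (cases "mean = 0") (auto simp: mult_le_cancel_left)
  then show ?thesis
    using norm_triangle_ineq4[of "k x" mean] norm_k_le[of x] by (simp add: z_def)
qed

lemma z_measurable [measurable]: "(\<lambda>x. f \<bullet> z x) \<in> borel_measurable P0"
  by (simp add: z_def inner_diff_right)

lemma inner_z_le: "\<bar>f \<bullet> z x\<bar> \<le> norm f * (2 * sqrt \<kappa>)"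
  by (rule order_trans[OF Cauchy_Schwarz_ineq2 mult_left_mono[OF norm_z_le]]) simp

lemma centred_incl_L2: "centred_incl P0 evl f \<in> L2_fun P0"
proof -
  have "integrable P0 (\<lambda>x. (f \<bullet> z x)\<^sup>2)"
    by (rule P0.integrable_const_bound[of _ "(norm f * (2 * sqrt \<kappa>))\<^sup>2"])
      (use power2_le_of_abs_le[OF inner_z_le] in auto)
  then show ?thesis by (simp add: L2_fun_def centred_incl)
qed

lemma zz_integrable: "integrable P0 (\<lambda>x. (f \<bullet> z x) * (g \<bullet> z x))"
  using L2_fun_mult_integrable[OF centred_incl_L2 centred_incl_L2, of f g] by (simp add: centred_incl)

lemma centred_incl_adj:
  assumes g: "g \<in> L2_fun P0"
  shows "centred_incl_adj P0 evl g \<bullet> f = L2_inner P0 g (centred_incl P0 evl f)"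
proof -
  have int: "integrable P0 (\<lambda>x. g x * (f \<bullet> z x))" for f
    using L2_fun_mult_integrable[OF g centred_incl_L2, of f] by (simp add: centred_incl)
  have "(\<lambda>_. 1) \<in> L2_fun P0" by (simp add: L2_fun_def)
  then have int_g: "integrable P0 g" using L2_fun_mult_integrable[OF g, of "\<lambda>_. 1"] by simp
  have "bounded_linear (\<lambda>f. \<integral>x. g x * (f \<bullet> z x) \<partial>P0)"
  proof (rule bounded_linear_intro)
    show "norm (\<integral>x. g x * (f \<bullet> z x) \<partial>P0) \<le> norm f * ((\<integral>x. \<bar>g x\<bar> \<partial>P0) * (2 * sqrt \<kappa>))" for f
    proof -
      have "norm (\<integral>x. g x * (f \<bullet> z x) \<partial>P0) \<le> (\<integral>x. \<bar>g x\<bar> * (norm f * (2 * sqrt \<kappa>)) \<partial>P0)"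
        unfolding real_norm_def
        by (rule abs_integral_le[OF int]) (use int_g inner_z_le in \<open>auto simp: abs_mult intro!: mult_left_mono\<close>)
      then show ?thesis by (simp add: mult_ac)
    qed
  qed (simp_all add: inner_simps int distrib_left mult.left_commute)
  from riesz_closed_subspace[OF subspace_UNIV closed_UNIV this]
  obtain h where h: "\<And>f. h \<bullet> f = L2_inner P0 g (centred_incl P0 evl f)"
    by (auto simp: L2_inner_def centred_incl)
  have "centred_incl_adj P0 evl g = h"
    unfolding centred_incl_adj_def
  proof (rule the_equality)
    fix h' assume "\<forall>f. h' \<bullet> f = L2_inner P0 g (centred_incl P0 evl f)"
    then have "h' \<bullet> f = h \<bullet> f" for f by (simp only: h)
    then show "h' = h" by (rule eq_if_inner_eq)
  qed (simp add: h)
  then show ?thesis using h by simp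
qed

lemma cov_inner: "cov_op P0 evl f \<bullet> g = (\<integral>x. (f \<bullet> z x) * (g \<bullet> z x) \<partial>P0)"
  unfolding cov_op_def comp_apply centred_incl_adj[OF centred_incl_L2]
  by (simp add: L2_inner_def centred_incl)

lemma cov_positive: "positive_op (cov_op P0 evl)"
  unfolding positive_op_def
proof (intro conjI allI)
  let ?C = "cov_op P0 evl"
  show "bounded_linear ?C"
  proof (rule bounded_linear_intro)
    show "?C (f + g) = ?C f + ?C g" for f g
      by (rule eq_if_inner_eq) (simp add: cov_inner inner_simps zz_integrable distrib_right)
    show "?C (r *\<^sub>R f) = r *\<^sub>R ?C f" for r f
      by (rule eq_if_inner_eq) (simp add: cov_inner mult.assoc)
    show "norm (?C f) \<le> norm f * (2 * sqrt \<kappa>)\<^sup>2" for f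
    proof -
      let ?g = "?C f"
      have "(norm ?g)\<^sup>2 = (\<integral>x. (f \<bullet> z x) * (?g \<bullet> z x) \<partial>P0)"
        unfolding cov_inner[symmetric] by (simp add: power2_norm_eq_inner)
      also have "\<dots> \<le> (\<integral>x. (norm f * (2 * sqrt \<kappa>)) * (norm ?g * (2 * sqrt \<kappa>)) \<partial>P0)"
      proof (intro integral_mono zz_integrable P0.integrable_const)
        fix x
        have "(f \<bullet> z x) * (?g \<bullet> z x) \<le> \<bar>f \<bullet> z x\<bar> * \<bar>?g \<bullet> z x\<bar>" by (simp flip: abs_mult)
        also have "\<dots> \<le> (norm f * (2 * sqrt \<kappa>)) * (norm ?g * (2 * sqrt \<kappa>))"
          using \<kappa>_nonneg by (intro mult_mono inner_z_le) auto
        finally show "(f \<bullet> z x) * (?g \<bullet> z x) \<le> (norm f * (2 * sqrt \<kappa>)) * (norm ?g * (2 * sqrt \<kappa>))" .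
      qed
      finally have "norm ?g * norm ?g \<le> norm ?g * (norm f * (2 * sqrt \<kappa>)\<^sup>2)"
        by (simp add: P0.prob_space power2_eq_square mult_ac)
      then show ?thesis by (cases "?g = 0") (auto simp: mult_le_cancel_left)
    qed
  qed
  show "?C f \<bullet> g = f \<bullet> ?C g" for f g
    unfolding inner_commute[of f] cov_inner by (simp add: mult.commute)
  show "0 \<le> ?C f \<bullet> f" for f by (simp add: cov_inner)
qed

text \<open>A difference of features equals the difference of their centred versions, and the cross
  terms have mean zero. This is the reason for the factor 1/2 in the empirical covariance.\<close>

lemma cov_inner_pair:
  "(\<integral>p. (f \<bullet> (k (fst p) - k (snd p))) * (g \<bullet> (k (fst p) - k (snd p))) \<partial>(P0 \<Otimes>\<^sub>M P0))
    = 2 * (cov_op P0 evl f \<bullet> g)"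
proof -
  interpret pair: pair_prob_space P0 P0 by unfold_locales
  have [measurable]: "(\<lambda>p. f \<bullet> z (fst p)) \<in> borel_measurable (P0 \<Otimes>\<^sub>M P0)"
    "(\<lambda>p. f \<bullet> z (snd p)) \<in> borel_measurable (P0 \<Otimes>\<^sub>M P0)" for f
    by (auto intro!: measurable_compose[OF measurable_fst z_measurable] measurable_compose[OF measurable_snd z_measurable])
  have bounded: "\<bar>(f \<bullet> z x) * (g \<bullet> z y)\<bar> \<le> (norm f * (2 * sqrt \<kappa>)) * (norm g * (2 * sqrt \<kappa>))" for f g x y
    unfolding abs_mult using \<kappa>_nonneg by (intro mult_mono inner_z_le) auto
  have z_int: "integrable P0 (\<lambda>x. f \<bullet> z x)" for f
    by (rule inner_bounded_integrable[OF z_measurable norm_z_le])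
  have z0: "(\<integral>x. f \<bullet> z x \<partial>P0) = 0" for f
    using inner_bounded_integrable[OF evl_measurable norm_k_le, of f]
    by (simp add: z_def inner_diff_right mean P0.prob_space)
  let ?g = "\<lambda>x y. (f \<bullet> z x) * (g \<bullet> z x) - (f \<bullet> z x) * (g \<bullet> z y) - (f \<bullet> z y) * (g \<bullet> z x) + (f \<bullet> z y) * (g \<bullet> z y)"
  have int: "integrable (P0 \<Otimes>\<^sub>M P0) (\<lambda>(x, y). ?g x y)"
  proof (rule pair.integrable_const_bound[of _ "4 * ((norm f * (2 * sqrt \<kappa>)) * (norm g * (2 * sqrt \<kappa>)))"])
    have "\<bar>?g x y\<bar> \<le> 4 * ((norm f * (2 * sqrt \<kappa>)) * (norm g * (2 * sqrt \<kappa>)))" for x y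
      using bounded[of f x g x] bounded[of f x g y] bounded[of f y g x] bounded[of f y g y] by linarith
    then show "AE p in P0 \<Otimes>\<^sub>M P0. norm (case p of (x, y) \<Rightarrow> ?g x y)
        \<le> 4 * ((norm f * (2 * sqrt \<kappa>)) * (norm g * (2 * sqrt \<kappa>)))" by auto
  qed (simp add: split_beta')
  have "(\<integral>p. (f \<bullet> (k (fst p) - k (snd p))) * (g \<bullet> (k (fst p) - k (snd p))) \<partial>(P0 \<Otimes>\<^sub>M P0))
      = (\<integral>p. (case p of (x, y) \<Rightarrow> ?g x y) \<partial>(P0 \<Otimes>\<^sub>M P0))"
    by (intro Bochner_Integration.integral_cong refl) (auto simp: z_def inner_simps algebra_simps)
  also have "\<dots> = (\<integral>x. (\<integral>y. ?g x y \<partial>P0) \<partial>P0)"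
    using pair.integral_fst'[OF int] by simp
  also have "\<dots> = (\<integral>x. (f \<bullet> z x) * (g \<bullet> z x) + (cov_op P0 evl f \<bullet> g) \<partial>P0)"
    by (simp add: cov_inner zz_integrable z_int z0 P0.prob_space)
  also have "\<dots> = 2 * (cov_op P0 evl f \<bullet> g)"
    by (simp add: cov_inner zz_integrable P0.prob_space)
  finally show ?thesis .
qed

end

section \<open>Eigenvectors of the covariance operator\<close>

locale spectral_kernel_model = kernel_model P0 evl K \<kappa>
  for P0 :: "'x::second_countable_topology measure"
    and evl :: "'h::{real_inner,banach} \<Rightarrow> 'x \<Rightarrow> real" and K \<kappa> +
  fixes lam :: "nat \<Rightarrow> real" and e :: "nat \<Rightarrow> 'x \<Rightarrow> real" and l :: real
  assumes spectral: "spectral_decomposition P0 (integral_op P0 evl) lam e" and l_pos: "0 < l"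
begin

abbreviation "adj \<equiv> centred_incl_adj P0 evl"
abbreviation "incl \<equiv> centred_incl P0 evl"

lemma lam_pos: "0 < lam i" and lam_dec: "decseq lam" and e_L2: "e i \<in> L2_fun P0"
  and e_inner: "L2_inner P0 (e i) (e j) = (if i = j then 1 else 0)"
  and T_limit: "g \<in> L2_fun P0 \<Longrightarrow>
    (\<lambda>n. L2_norm P0 (\<lambda>x. incl (adj g) x - (\<Sum>i<n. lam i * L2_inner P0 (e i) g * e i x))) \<longlonglongrightarrow> 0"
  using spectral by (auto simp: spectral_decomposition_def integral_op_def)

text \<open>For \<open>n > j\<close> the partial sums at \<open>e j\<close> all equal
  \<open>lam j\<close> times \<open>e j\<close>, so the norms converging to 0 are eventually
  constant.\<close>

lemma T_e: "L2_inner P0 f (incl (adj (e j))) = lam j * L2_inner P0 f (e j)" if "f \<in> L2_fun P0"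
proof (rule L2_inner_eq_scaled_if_norm_zero[OF centred_incl_L2 e_L2 that])
  have sum: "(\<Sum>i<n. lam i * L2_inner P0 (e i) (e j) * e i x) = lam j * e j x" if "j < n" for n x
  proof -
    have "(\<Sum>i<n. lam i * L2_inner P0 (e i) (e j) * e i x) = (\<Sum>i<n. if i = j then lam j * e j x else 0)"
      by (intro sum.cong refl) (simp add: e_inner)
    then show ?thesis using that by simp
  qed
  let ?c = "L2_norm P0 (\<lambda>x. incl (adj (e j)) x - lam j * e j x)"
  have "(\<lambda>n. ?c) \<longlonglongrightarrow> 0"
    using T_limit[OF e_L2[of j]]
    by (rule Lim_transform_eventually) (use eventually_gt_at_top[of j] in eventually_elim, simp add: sum)
  then show "?c = 0" using LIMSEQ_const_iff by blast
qed

text \<open>\<open>adj (e i)\<close> has norm \<open>sqrt (lam i)\<close>, so these are unit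
  vectors: the singular vectors of the centred inclusion on the Hilbert space side.\<close>

definition v :: "nat \<Rightarrow> 'h" where "v i = (1 / sqrt (lam i)) *\<^sub>R adj (e i)"

lemma adj_e: "adj (e i) = sqrt (lam i) *\<^sub>R v i"
  using lam_pos[of i] by (simp add: v_def)

lemma v_inner: "v i \<bullet> v j = (if i = j then 1 else 0)"
proof -
  have "adj (e i) \<bullet> adj (e j) = lam j * (if i = j then 1 else 0)"
    by (simp add: centred_incl_adj[OF e_L2] T_e[OF e_L2] e_inner)
  then show ?thesis using lam_pos[of i] by (auto simp: v_def)
qed

lemma v_eigen: "cov_op P0 evl (v i) = lam i *\<^sub>R v i"
proof (rule eq_if_inner_eq)
  fix f
  interpret C: bounded_linear "cov_op P0 evl" using cov_positive by (simp add: positive_op_def)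
  have "cov_op P0 evl (adj (e i)) \<bullet> f = L2_inner P0 (incl f) (incl (adj (e i)))"
    by (simp add: cov_op_def centred_incl_adj[OF centred_incl_L2] L2_inner_commute)
  also have "\<dots> = lam i * (adj (e i) \<bullet> f)"
    by (simp add: T_e[OF centred_incl_L2] centred_incl_adj[OF e_L2] L2_inner_commute)
  finally show "cov_op P0 evl (v i) \<bullet> f = (lam i *\<^sub>R v i) \<bullet> f"
    by (simp add: v_def C.scaleR)
qed

text \<open>Orthogonality to all \<open>v i\<close> makes \<open>incl f\<close> orthogonal to all
  \<open>e i\<close>, so the integral operator kills it; pairing the result with
  \<open>incl f\<close> gives the squared norm of the covariance at \<open>f\<close>.\<close>

lemma v_complete:
  assumes "\<And>i. f \<bullet> v i = 0"
  shows "cov_op P0 evl f = 0"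
proof -
  have "L2_inner P0 (e i) (incl f) = 0" for i
    using assms[of i] by (simp add: centred_incl_adj[OF e_L2, symmetric] adj_e inner_commute)
  then have "(\<lambda>n. L2_norm P0 (incl (adj (incl f)))) \<longlonglongrightarrow> 0"
    using T_limit[OF centred_incl_L2[of f]] by simp
  then have "L2_norm P0 (incl (adj (incl f))) = 0" using LIMSEQ_const_iff by blast
  then have "L2_inner P0 (incl f) (incl (adj (incl f))) = 0 * L2_inner P0 (incl f) (incl f)"
    by (intro L2_inner_eq_scaled_if_norm_zero centred_incl_L2) simp
  then have "cov_op P0 evl f \<bullet> cov_op P0 evl f = 0"
    by (simp add: cov_op_def centred_incl_adj[OF centred_incl_L2])
  then show ?thesis by simp
qed

lemma v_orthonormal: "orthonormal_set (v ` S)"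
  by (auto simp: orthonormal_set_def pairwise_def orthogonal_def v_inner norm_eq_1)

lemma v_inj: "inj v"
proof (rule injI)
  fix i j assume "v i = v j"
  then show "i = j" using v_inner[of i i] v_inner[of i j] by (auto split: if_splits)
qed

lemma v_bessel: "(\<Sum>i<n. (f \<bullet> v i)\<^sup>2) \<le> (norm f)\<^sup>2"
  using bessel[OF v_orthonormal, of "{..<n}" f] v_inj
  by (simp add: sum.reindex inj_on_subset)

text \<open>The sum is the mean of a Bessel sum of the centred feature, whose norm is at most
  \<open>2 * sqrt \<kappa>\<close>.\<close>

lemma lam_sum: "(\<Sum>i<n. lam i) \<le> 4 * \<kappa>"
proof -
  have "(\<Sum>i<n. lam i) = (\<Sum>i<n. cov_op P0 evl (v i) \<bullet> v i)"
    by (simp add: v_eigen v_inner)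
  also have "\<dots> = (\<integral>x. (\<Sum>i<n. (v i \<bullet> z x) * (v i \<bullet> z x)) \<partial>P0)"
    by (simp add: cov_inner zz_integrable)
  also have "\<dots> \<le> (\<integral>x. 4 * \<kappa> \<partial>P0)"
  proof (rule integral_mono)
    fix x
    have "(\<Sum>i<n. (v i \<bullet> z x) * (v i \<bullet> z x)) \<le> (norm (z x))\<^sup>2"
      using v_bessel[where f = "z x"] by (simp add: power2_eq_square inner_commute)
    also have "\<dots> \<le> 4 * \<kappa>"
      using power_mono[OF norm_z_le[of x], of 2] \<kappa>_nonneg by (simp add: power_mult_distrib)
    finally show "(\<Sum>i<n. (v i \<bullet> z x) * (v i \<bullet> z x)) \<le> 4 * \<kappa>" .
  qed (auto simp: zz_integrable)
  finally show ?thesis by (simp add: P0.prob_space)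
qed

sublocale cov: eigen_system "cov_op P0 evl" l lam v "4 * \<kappa>"
  by unfold_locales
    (use cov_positive l_pos lam_pos lam_dec v_inner v_eigen v_complete lam_sum in auto)

lemma eigen_fun_eq: "eigen_fun P0 evl lam e i = (1 / sqrt (lam i)) *\<^sub>R v i"
  using lam_pos[of i] by (simp add: eigen_fun_def adj_e real_sqrt_divide field_simps real_div_sqrt)

end


section \<open>The truncated empirical covariance\<close>

context kernel_model
begin

definition pairs :: "nat \<Rightarrow> (nat \<times> nat) set" where
  "pairs s = Sigma {1..s} (\<lambda>i. {1..s} - {i})"

definition d :: "nat \<Rightarrow> (nat \<Rightarrow> 'x) \<Rightarrow> nat \<times> nat \<Rightarrow> 'h" where
  "d s Y p = (1 / sqrt (2 * real s * (real s - 1))) *\<^sub>R (k (Y (fst p)) - k (Y (snd p)))"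

lemma finite_pairs [simp]: "finite (pairs s)" by (simp add: pairs_def)

lemma emp_cov_op_eq:
  assumes "2 \<le> s"
  shows "emp_cov_op evl K s Y = frame_op (d s Y) (pairs s)"
proof
  fix f
  let ?c = "2 * real s * (real s - 1)"
  let ?D = "\<lambda>p. k (Y (fst p)) - k (Y (snd p))"
  have "0 \<le> ?c" using assms by simp
  then have sq: "1 / sqrt ?c * (1 / sqrt ?c) = 1 / ?c"
    by (simp add: real_sqrt_mult_self)
  have "emp_cov_op evl K s Y f = (1 / ?c) *\<^sub>R (\<Sum>p\<in>pairs s. (?D p \<bullet> f) *\<^sub>R ?D p)"
    by (simp add: emp_cov_op_def tensor_def k_def[symmetric] pairs_def sum.Sigma split_beta)
  also have "\<dots> = (\<Sum>p\<in>pairs s. (1 / sqrt ?c * (1 / sqrt ?c) * (?D p \<bullet> f)) *\<^sub>R ?D p)"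
    unfolding sq by (simp add: scaleR_sum_right)
  also have "\<dots> = frame_op (d s Y) (pairs s) f"
    unfolding frame_op_def d_def by (intro sum.cong refl) (simp add: mult_ac)
  finally show "emp_cov_op evl K s Y f = frame_op (d s Y) (pairs s) f" .
qed

lemma emp_N2_eq:
  assumes "2 \<le> s" "0 < l"
  shows "(emp_N2 evl K s l Y)\<^sup>2 = finite_frame.hs2 (d s Y) (pairs s) l"
proof -
  interpret finite_frame "d s Y" "pairs s" l using assms by unfold_locales
  show ?thesis
    by (simp add: emp_N2_def emp_cov_op_eq[OF assms(1)] hs_norm_whitened_frame_op)
qed

text \<open>\<open>measure\<close> is 0 on non-measurable sets, so the final lower bound requires a
  measurable event.\<close>

lemma emp_N2_measurable:
  assumes s: "2 \<le> s" and l: "0 < l"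
  shows "(\<lambda>Y. (emp_N2 evl K s l Y)\<^sup>2) \<in> borel_measurable (Pi\<^sub>M {1..s} (\<lambda>_. P0))"
  unfolding emp_N2_eq[OF assms]
proof (rule hs2_measurable[OF finite_pairs l])
  let ?M = "Pi\<^sub>M {1..s} (\<lambda>_. P0)"
  let ?c = "2 * real s * (real s - 1)"
  have kk: "(\<lambda>Y. k (Y i) \<bullet> k (Y j)) \<in> borel_measurable ?M" if "i \<in> {1..s}" "j \<in> {1..s}" for i j
  proof -
    have "(\<lambda>Y. (Y i, Y j)) \<in> ?M \<rightarrow>\<^sub>M P0 \<Otimes>\<^sub>M P0"
      using that by (intro measurable_Pair measurable_component_singleton) auto
    from measurable_compose[OF this inner_k_measurable] show ?thesis by simp
  qed
  fix p q assume "p \<in> pairs s" "q \<in> pairs s"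
  then have mem: "fst p \<in> {1..s}" "snd p \<in> {1..s}" "fst q \<in> {1..s}" "snd q \<in> {1..s}"
    by (auto simp: pairs_def)
  show "(\<lambda>Y. d s Y p \<bullet> d s Y q) \<in> borel_measurable ?M"
    unfolding d_def inner_scaleR_left inner_scaleR_right inner_diff_left inner_diff_right
    by (intro borel_measurable_times borel_measurable_const borel_measurable_diff kk mem)
next
  fix Y p
  have "(norm (d s Y p))\<^sup>2 = (1 / sqrt (2 * real s * (real s - 1)))\<^sup>2 * (norm (k (Y (fst p)) - k (Y (snd p))))\<^sup>2"
    unfolding d_def norm_scaleR power_mult_distrib power2_abs ..
  also have "\<dots> \<le> (1 / sqrt (2 * real s * (real s - 1)))\<^sup>2 * (4 * \<kappa>)"
    by (intro mult_left_mono norm_k_diff) simp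
  finally show "(norm (d s Y p))\<^sup>2 \<le> (1 / sqrt (2 * real s * (real s - 1)))\<^sup>2 * (4 * \<kappa>)" .
qed

end

context spectral_kernel_model
begin

text \<open>Large eigenvalues are cut at \<open>3 l\<close>.  This changes \<open>\<lambda> / (\<lambda> + l)\<close> by a factor of at least
  \<open>3/4\<close>, and makes the truncated feature vectors bounded by the whitened ones.\<close>

definition t :: "nat \<Rightarrow> real" where "t j = sqrt (min 1 (3 * l / lam j))"
text \<open>The eigenvalues of T Sigma T. The next two definitions are h and the weight M of the
  overview at these cut values.\<close>

definition sig :: "nat \<Rightarrow> real" where "sig j = min (lam j) (3 * l)"
definition a :: "nat \<Rightarrow> real" where "a j = sig j / (sig j + l)"
definition m :: "nat \<Rightarrow> real" where "m j = sig j / (sig j + l) ^ 3"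

lemma t2: "(t j)\<^sup>2 = min 1 (3 * l / lam j)"
  using lam_pos[of j] l_pos by (simp add: t_def)

text \<open>Equality holds at \<open>lam j = 3 * l\<close>, where the two branches of the minimum
  meet. Multiplied by \<open>lam j\<close>, this bounds the cut eigenvalue by \<open>4 * l\<close>
  times the whitened one.\<close>

lemma t2_le: "(t j)\<^sup>2 \<le> 4 * l / (lam j + l)"
proof (cases "lam j \<le> 3 * l")
  case True
  have "(t j)\<^sup>2 \<le> 1" by (simp add: t2)
  also have "1 \<le> 4 * l / (lam j + l)" using True lam_pos[of j] l_pos by (simp add: field_simps)
  finally show ?thesis .
next
  case False
  have "(t j)\<^sup>2 \<le> 3 * l / lam j" by (simp add: t2)
  also have "\<dots> \<le> 4 * l / (lam j + l)"
    using False lam_pos[of j] l_pos by (simp add: field_simps)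
  finally show ?thesis .
qed

lemma sig_eq: "(t j)\<^sup>2 * lam j = sig j"
  using lam_pos[of j] by (simp add: t2 sig_def min_mult_distrib_right)

lemma sig_pos: "0 < sig j" using lam_pos l_pos by (simp add: sig_def)

lemma a_nonneg: "0 \<le> a j" using sig_pos[of j] l_pos by (simp add: a_def)

lemma m_nonneg: "0 \<le> m j" using sig_pos[of j] l_pos by (simp add: m_def)

lemma a_ge_rho: "3 / 4 * cov.rho j \<le> a j"
proof (cases "lam j \<le> 3 * l")
  case True
  then have "a j = cov.rho j" by (simp add: a_def sig_def cov.rho_def)
  then show ?thesis using cov.rho_bounds[of j] by simp
next
  case False
  then have "a j = 3 / 4" using l_pos by (simp add: a_def sig_def)
  then show ?thesis using cov.rho_bounds[of j] by simp
qed

lemma m_le: "m j \<le> 4 / (27 * l\<^sup>2)"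
proof -
  let ?x = "sig j"
  \<comment> \<open>x/(x + l)^3 is largest at x = l/2, hence the double root there.\<close>
  have "0 \<le> (2 * ?x - l)\<^sup>2 * (?x + 4 * l)" using sig_pos[of j] l_pos by simp
  also have "\<dots> = 4 * (?x + l) ^ 3 - 27 * ?x * l\<^sup>2"
    by (simp add: power2_eq_square power3_eq_cube algebra_simps)
  finally show ?thesis
    using sig_pos[of j] l_pos by (simp add: m_def divide_le_eq field_simps)
qed

text \<open>Eigenvalue by eigenvalue, this is l tr(M Sigma) <= tr h(Sigma)^2, which makes the errors
  relative.\<close>

lemma l_m_sig_le: "l * (m j * sig j) \<le> (a j)\<^sup>2"
proof -
  have "l * (m j * sig j) = (a j)\<^sup>2 * (l / (sig j + l))"
    by (simp add: m_def a_def power2_eq_square power3_eq_cube)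
  also have "\<dots> \<le> (a j)\<^sup>2 * 1"
    using sig_pos[of j] l_pos by (intro mult_left_mono) auto
  finally show ?thesis by simp
qed

definition T :: "nat \<Rightarrow> 'h \<Rightarrow> 'h" where "T n f = (\<Sum>j<n. (t j * (v j \<bullet> f)) *\<^sub>R v j)"

lemma norm_combination_v: "(norm (\<Sum>j<n. c j *\<^sub>R v j))\<^sup>2 = (\<Sum>j<n. (c j)\<^sup>2)"
proof -
  have "(norm (\<Sum>j<n. c j *\<^sub>R v j))\<^sup>2 = (\<Sum>i<n. \<Sum>j<n. c i * c j * (v i \<bullet> v j))"
    unfolding power2_norm_eq_inner inner_sum_left
    by (simp add: inner_sum_right sum_distrib_left mult_ac)
  also have "\<dots> = (\<Sum>i<n. \<Sum>j<n. if i = j then (c i)\<^sup>2 else 0)"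
    by (intro sum.cong refl) (simp add: v_inner power2_eq_square)
  finally show ?thesis by simp
qed

lemma T_inner_v: "j < n \<Longrightarrow> T n f \<bullet> v j = t j * (v j \<bullet> f)"
proof -
  assume "j < n"
  have "T n f \<bullet> v j = (\<Sum>i<n. if i = j then t j * (v j \<bullet> f) else 0)"
    unfolding T_def inner_sum_left by (intro sum.cong refl) (simp add: v_inner)
  then show ?thesis using \<open>j < n\<close> by simp
qed

lemma T_expand: "T n f = (\<Sum>j<n. (T n f \<bullet> v j) *\<^sub>R v j)"
  unfolding T_def[of n f] by (intro sum.cong refl) (simp add: T_inner_v[unfolded T_def])

lemma T_linear: "linear (T n)"
  by (rule linearI)
    (simp_all add: T_def inner_simps distrib_left scaleR_add_left sum.distrib scaleR_sum_right mult_ac)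

lemma T_sym: "T n f \<bullet> g = f \<bullet> T n g"
  unfolding inner_commute[of f] by (simp add: T_def inner_sum_left mult_ac)

lemma T_contraction: "norm (T n f) \<le> norm f"
proof -
  have "(norm (T n f))\<^sup>2 = (\<Sum>j<n. (t j * (v j \<bullet> f))\<^sup>2)" unfolding T_def by (rule norm_combination_v)
  also have "\<dots> \<le> (\<Sum>j<n. (f \<bullet> v j)\<^sup>2)"
  proof (rule sum_mono)
    fix j
    have "(t j)\<^sup>2 * (v j \<bullet> f)\<^sup>2 \<le> 1 * (v j \<bullet> f)\<^sup>2" by (intro mult_right_mono) (auto simp: t2)
    then show "(t j * (v j \<bullet> f))\<^sup>2 \<le> (f \<bullet> v j)\<^sup>2" by (simp add: power_mult_distrib inner_commute)
  qed
  also have "\<dots> \<le> (norm f)\<^sup>2" by (rule v_bessel)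
  finally show ?thesis by (rule power2_le_imp_le) simp
qed

text \<open>Coordinates of T applied to a feature difference. Division by sqrt 2 makes their second
  moment matrix diagonal with entries \<open>sig\<close>.\<close>

definition xi :: "'x \<times> 'x \<Rightarrow> nat \<Rightarrow> real" where
  "xi p j = t j * (v j \<bullet> (k (fst p) - k (snd p))) / sqrt 2"

definition U :: "nat \<Rightarrow> (nat \<Rightarrow> 'x) \<Rightarrow> nat \<Rightarrow> nat \<Rightarrow> real" where
  "U s Y i j = (\<Sum>a\<in>{1..s}. \<Sum>b\<in>{1..s} - {a}. xi (Y a, Y b) i * xi (Y a, Y b) j) / (real s * (real s - 1))"

definition N :: "nat \<Rightarrow> real" where "N n = (\<Sum>j<n. (a j)\<^sup>2)"

lemma frame_T_inner:
  assumes "2 \<le> s" "i < n" "j < n"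
  shows "frame_op (\<lambda>p. T n (d s Y p)) (pairs s) (v i) \<bullet> v j = U s Y i j"
proof -
  let ?c = "2 * real s * (real s - 1)"
  have c: "0 < ?c" using assms by simp
  have x: "T n (d s Y p) \<bullet> v i = xi (Y (fst p), Y (snd p)) i * (sqrt 2 / sqrt ?c)" if "i < n" for p i
    using that by (simp add: T_inner_v d_def xi_def)
  have sq: "(sqrt 2 / sqrt ?c) * (sqrt 2 / sqrt ?c) = 1 / (real s * (real s - 1))"
    using c by (simp add: real_sqrt_mult_self[of ?c] times_divide_times_eq del: real_sqrt_mult)
  have "frame_op (\<lambda>p. T n (d s Y p)) (pairs s) (v i) \<bullet> v j
      = (\<Sum>p\<in>pairs s. (sqrt 2 / sqrt ?c) * (sqrt 2 / sqrt ?c)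
          * (xi (Y (fst p), Y (snd p)) i * xi (Y (fst p), Y (snd p)) j))"
    unfolding frame_op_inner x[OF assms(2)] x[OF assms(3)] by (intro sum.cong refl) (simp only: mult_ac)
  also have "\<dots> = (1 / (real s * (real s - 1)))
      * (\<Sum>p\<in>pairs s. xi (Y (fst p), Y (snd p)) i * xi (Y (fst p), Y (snd p)) j)"
    unfolding sq by (rule sum_distrib_left[symmetric])
  also have "\<dots> = U s Y i j"
    by (simp add: U_def pairs_def sum.Sigma split_beta)
  finally show ?thesis .
qed

text \<open>The vectors \<open>T n (d s Y p)\<close> lie in the span of the first \<open>n\<close>
  eigenvectors, so finitely many entries give the full norm; the finite rank of \<open>T n\<close>
  serves this.\<close>

lemma norm_frame_T:
  assumes "2 \<le> s" "i < n"
  shows "(norm (frame_op (\<lambda>p. T n (d s Y p)) (pairs s) (v i)))\<^sup>2 = (\<Sum>j<n. (U s Y i j)\<^sup>2)"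
proof -
  let ?x = "\<lambda>p. T n (d s Y p)"
  let ?S = "frame_op ?x (pairs s)"
  have "?S (v i) = (\<Sum>p\<in>pairs s. (?x p \<bullet> v i) *\<^sub>R (\<Sum>j<n. (?x p \<bullet> v j) *\<^sub>R v j))"
    unfolding frame_op_def T_expand[symmetric] ..
  also have "\<dots> = (\<Sum>j<n. \<Sum>p\<in>pairs s. ((?x p \<bullet> v i) * (?x p \<bullet> v j)) *\<^sub>R v j)"
    unfolding scaleR_sum_right scaleR_scaleR by (rule sum.swap)
  also have "\<dots> = (\<Sum>j<n. (?S (v i) \<bullet> v j) *\<^sub>R v j)"
    by (simp add: frame_op_inner scaleR_sum_left)
  also have "\<dots> = (\<Sum>j<n. U s Y i j *\<^sub>R v j)"
    using frame_T_inner[OF assms] by (intro sum.cong refl) simp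
  finally show ?thesis by (simp add: norm_combination_v)
qed

text \<open>Squared Hilbert-Schmidt norm of (S - Sigma) M^(1/2) for the truncated matrices;
  \<open>lin\<close> below is the trace error.\<close>

definition quad :: "nat \<Rightarrow> nat \<Rightarrow> (nat \<Rightarrow> 'x) \<Rightarrow> real" where
  "quad n s Y = (\<Sum>i<n. \<Sum>j<n. m i * (U s Y i j - (if i = j then sig i else 0))\<^sup>2)"

definition lin :: "nat \<Rightarrow> nat \<Rightarrow> (nat \<Rightarrow> 'x) \<Rightarrow> real" where
  "lin n s Y = (\<Sum>i<n. l * m i * (sig i - U s Y i i))"

text \<open>The empirical quantity is tested against its population value; the tangent inequality
  \<open>h(S) \<ge> r S + S r - r (S\<^sup>2 + l S) r\<close> at \<open>r = 1 / (sig + l)\<close> leaves the square of the fluctuation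
  and a linear term.\<close>

lemma emp_N2_lower:
  assumes s: "2 \<le> s" and nonneg: "0 \<le> N n - quad n s Y - lin n s Y"
  shows "(N n - quad n s Y - lin n s Y)\<^sup>2 \<le> N n * (emp_N2 evl K s l Y)\<^sup>2"
proof -
  let ?x = "\<lambda>p. T n (d s Y p)"
  interpret x: finite_frame ?x "pairs s" l using l_pos by unfold_locales
  let ?H = "\<lambda>i. v i \<bullet> frame_op ?x (pairs s) (x.G (v i))"
  have "N n - quad n s Y - lin n s Y \<le> (\<Sum>i<n. a i * ?H i)"
  proof -
    have row: "(a i)\<^sup>2 - (\<Sum>j<n. m i * (U s Y i j - (if i = j then sig i else 0))\<^sup>2)
        - l * m i * (sig i - U s Y i i) \<le> a i * ?H i" if "i < n" for i
    proof -
      let ?r = "1 / (sig i + l)"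
      have pos: "0 < sig i + l" using sig_pos[of i] l_pos by simp
      have cross: "(\<Sum>j<n. (U s Y i j - (if i = j then sig i else 0))\<^sup>2)
          = (\<Sum>j<n. (U s Y i j)\<^sup>2) - 2 * sig i * U s Y i i + (sig i)\<^sup>2"
      proof -
        have "(U s Y i j - (if i = j then sig i else 0))\<^sup>2
            = (U s Y i j)\<^sup>2 + (if i = j then (sig i)\<^sup>2 - 2 * sig i * U s Y i i else 0)" for j
          by (simp add: power2_diff)
        then show ?thesis using that by (simp add: sum.distrib)
      qed
      \<comment> \<open>These identities turn the tangent inequality, multiplied by
        \<open>a i\<close>, into the weight \<open>m i\<close>; by \<open>cross\<close> the matrix
        terms then form a complete square.\<close>
      have coeff: "a i * ?r\<^sup>2 = m i" "a i * ?r = m i * (sig i + l)" "(a i)\<^sup>2 = m i * (sig i * (sig i + l))"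
        using pos by (simp_all add: a_def m_def power2_eq_square power3_eq_cube)
      have "(a i)\<^sup>2 - (\<Sum>j<n. m i * (U s Y i j - (if i = j then sig i else 0))\<^sup>2)
          - l * m i * (sig i - U s Y i i)
        = m i * (sig i * (sig i + l)) - m i * ((\<Sum>j<n. (U s Y i j)\<^sup>2) - 2 * sig i * U s Y i i + (sig i)\<^sup>2)
          - l * m i * (sig i - U s Y i i)"
        unfolding sum_distrib_left[symmetric] cross coeff(3) ..
      also have "\<dots> = 2 * (m i * (sig i + l)) * U s Y i i - m i * ((\<Sum>j<n. (U s Y i j)\<^sup>2) + l * U s Y i i)"
        by (simp add: power2_eq_square algebra_simps)
      also have "\<dots> = a i * (2 * ?r * U s Y i i - ?r\<^sup>2 * ((\<Sum>j<n. (U s Y i j)\<^sup>2) + l * U s Y i i))"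
      proof -
        have "a i * (2 * ?r * u - ?r\<^sup>2 * w) = 2 * (a i * ?r) * u - (a i * ?r\<^sup>2) * w" for u w
          by (simp only: right_diff_distrib mult_ac)
        then show ?thesis unfolding coeff by simp
      qed
      also have "\<dots> \<le> a i * ?H i"
        using x.inner_A_G_lower[of ?r "v i"] frame_T_inner[OF s that that, of Y] norm_frame_T[OF s that, of Y]
        by (intro mult_left_mono a_nonneg) (simp add: inner_commute)
      finally show ?thesis .
    qed
    have "N n - quad n s Y - lin n s Y
        = (\<Sum>i<n. (a i)\<^sup>2 - (\<Sum>j<n. m i * (U s Y i j - (if i = j then sig i else 0))\<^sup>2)
          - l * m i * (sig i - U s Y i i))"
      unfolding N_def quad_def lin_def sum_subtractf ..
    also have "\<dots> \<le> (\<Sum>i<n. a i * ?H i)" by (intro sum_mono row) simp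
    finally show ?thesis .
  qed
  then have "(N n - quad n s Y - lin n s Y)\<^sup>2 \<le> (\<Sum>i<n. a i * ?H i)\<^sup>2"
    using nonneg by (intro power_mono)
  also have "\<dots> \<le> (\<Sum>i<n. (a i)\<^sup>2) * (\<Sum>i<n. (?H i)\<^sup>2)"
    by (rule Cauchy_Schwarz_ineq_sum)
  also have "\<dots> \<le> N n * (emp_N2 evl K s l Y)\<^sup>2"
    unfolding N_def
  proof (rule mult_left_mono)
    have "(\<Sum>i<n. (?H i)\<^sup>2) = (\<Sum>b\<in>v ` {..<n}. (b \<bullet> frame_op ?x (pairs s) (x.G b))\<^sup>2)"
      using v_inj by (subst sum.reindex) (auto intro: inj_on_subset)
    also have "\<dots> \<le> x.hs2" by (rule x.hs2_ge_diagonal) (auto intro: v_orthonormal)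
    also have "\<dots> \<le> finite_frame.hs2 (d s Y) (pairs s) l"
      by (rule hs2_contraction_le[OF finite_pairs l_pos T_linear T_sym T_contraction])
    also have "\<dots> = (emp_N2 evl K s l Y)\<^sup>2" using emp_N2_eq[OF s l_pos] by simp
    finally show "(\<Sum>i<n. (?H i)\<^sup>2) \<le> (emp_N2 evl K s l Y)\<^sup>2" .
  qed (simp add: sum_nonneg)
  finally show ?thesis .
qed

end


section \<open>Fluctuations of the truncated empirical covariance\<close>

context spectral_kernel_model
begin

lemma xi_measurable [measurable]: "(\<lambda>p. xi p j) \<in> borel_measurable (P0 \<Otimes>\<^sub>M P0)"
proof -
  have [measurable]: "(\<lambda>p. f \<bullet> k (fst p)) \<in> borel_measurable (P0 \<Otimes>\<^sub>M P0)"
    "(\<lambda>p. f \<bullet> k (snd p)) \<in> borel_measurable (P0 \<Otimes>\<^sub>M P0)" for f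
    by (auto intro!: measurable_compose[OF measurable_fst evl_measurable]
        measurable_compose[OF measurable_snd evl_measurable])
  show ?thesis unfolding xi_def inner_diff_right by measurable
qed

lemma xi_mean: "(\<integral>p. xi p i * xi p j \<partial>(P0 \<Otimes>\<^sub>M P0)) = (if i = j then sig i else 0)"
proof -
  have "xi p i * xi p j = (t i * t j / 2)
      * ((v i \<bullet> (k (fst p) - k (snd p))) * (v j \<bullet> (k (fst p) - k (snd p))))" for p
    by (simp add: xi_def field_simps)
  then have "(\<integral>p. xi p i * xi p j \<partial>(P0 \<Otimes>\<^sub>M P0)) = (t i * t j / 2) * (2 * (cov_op P0 evl (v i) \<bullet> v j))"
    by (simp only: integral_mult_right_zero cov_inner_pair)
  then show ?thesis using sig_eq[of j] by (simp add: v_eigen v_inner power2_eq_square mult_ac)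
qed

text \<open>The value of b for the first sample size condition.\<close>

lemma xi_sum_le: "(\<Sum>j<n. (xi p j)\<^sup>2) \<le> 2 * \<kappa>"
proof -
  let ?D = "k (fst p) - k (snd p)"
  have "(\<Sum>j<n. (xi p j)\<^sup>2) \<le> (\<Sum>j<n. (?D \<bullet> v j)\<^sup>2 / 2)"
  proof (rule sum_mono)
    fix j
    have "(t j)\<^sup>2 * (v j \<bullet> ?D)\<^sup>2 \<le> 1 * (v j \<bullet> ?D)\<^sup>2" by (intro mult_right_mono) (auto simp: t2)
    then show "(xi p j)\<^sup>2 \<le> (?D \<bullet> v j)\<^sup>2 / 2"
      by (simp add: xi_def power_mult_distrib power_divide inner_commute)
  qed
  also have "\<dots> \<le> (norm ?D)\<^sup>2 / 2"
    using v_bessel[where f = ?D] by (simp add: sum_divide_distrib[symmetric])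
  also have "\<dots> \<le> 2 * \<kappa>" using norm_k_diff[of "fst p" "snd p"] by simp
  finally show ?thesis .
qed

lemma xi_sq_le: "(xi p j)\<^sup>2 \<le> 2 * \<kappa>"
proof -
  have "(xi p j)\<^sup>2 \<le> (\<Sum>i<Suc j. (xi p i)\<^sup>2)" by (simp add: sum_nonneg)
  then show ?thesis using xi_sum_le[of p "Suc j"] by linarith
qed

lemma xi_sq_integrable: "integrable (P0 \<Otimes>\<^sub>M P0) (\<lambda>p. (xi p j)\<^sup>2)"
proof -
  interpret pair: pair_prob_space P0 P0 by unfold_locales
  show ?thesis by (rule pair.integrable_const_bound[of _ "2 * \<kappa>"]) (auto simp: xi_sq_le)
qed

text \<open>The value of b for the second condition. A coordinate is
  \<open>t j * sqrt (lam j)\<close> times a difference of eigenfunction values, over sqrt 2;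
  \<open>t2_le\<close> replaces the eigenvalue by its whitened version, so that N1 appears.\<close>

lemma xi_sum_le_sup_norm:
  assumes C: "\<And>i x. \<bar>evl (eigen_fun P0 evl lam e i) x\<bar> \<le> C"
  shows "(\<Sum>j<n. (xi p j)\<^sup>2) \<le> 8 * l * C\<^sup>2 * N1 P0 evl l"
proof -
  have "(\<Sum>j<n. (xi p j)\<^sup>2) \<le> (\<Sum>j<n. 8 * l * C\<^sup>2 * cov.rho j)"
  proof (rule sum_mono)
    fix j
    let ?\<phi> = "\<lambda>x. evl (eigen_fun P0 evl lam e j) x"
    have \<phi>: "v j \<bullet> k x = sqrt (lam j) * ?\<phi> x" for x
      using lam_pos[of j] by (simp add: k(2) eigen_fun_eq)
    have "(?\<phi> (fst p) - ?\<phi> (snd p))\<^sup>2 \<le> (2 * C)\<^sup>2"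
      using C[of j "fst p"] C[of j "snd p"] by (intro power2_le_of_abs_le) linarith
    moreover have "(xi p j)\<^sup>2 = (t j)\<^sup>2 * (lam j * (?\<phi> (fst p) - ?\<phi> (snd p))\<^sup>2) / 2"
      using lam_pos[of j]
      by (simp add: xi_def inner_diff_right \<phi> power_mult_distrib power_divide flip: right_diff_distrib)
    ultimately have "(xi p j)\<^sup>2 \<le> (t j)\<^sup>2 * (lam j * (2 * C)\<^sup>2) / 2"
      using lam_pos[of j] by (simp only:) (intro divide_right_mono mult_left_mono, auto)
    also have "\<dots> \<le> 4 * l / (lam j + l) * (lam j * (2 * C)\<^sup>2) / 2"
      using lam_pos[of j] by (intro divide_right_mono mult_right_mono t2_le) auto
    also have "\<dots> = 8 * l * C\<^sup>2 * cov.rho j" 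
      using lam_pos[of j] l_pos by (simp add: cov.rho_def field_simps power2_eq_square)
    finally show "(xi p j)\<^sup>2 \<le> 8 * l * C\<^sup>2 * cov.rho j" .
  qed
  also have "\<dots> = 8 * l * C\<^sup>2 * (\<Sum>j<n. cov.rho j)" by (simp add: sum_distrib_left)
  also have "\<dots> \<le> 8 * l * C\<^sup>2 * N1 P0 evl l"
    unfolding N1_def using l_pos by (intro mult_left_mono cov.sum_rho_le_trace) simp
  finally show ?thesis .
qed

definition X1 :: "nat \<Rightarrow> 'x \<times> 'x \<Rightarrow> nat \<times> nat \<Rightarrow> real" where
  "X1 n p ij = sqrt (m (fst ij)) * (xi p (fst ij) * xi p (snd ij))"

text \<open>A scalar indexed by \<open>unit\<close>, so that the bound for vectors applies to the
  linear term as well.\<close>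

definition X2 :: "nat \<Rightarrow> 'x \<times> 'x \<Rightarrow> unit \<Rightarrow> real" where
  "X2 n p u = (\<Sum>i<n. l * m i * (xi p i)\<^sup>2)"

lemma weighted_xi_le:
  assumes b: "(\<Sum>j<n. (xi p j)\<^sup>2) \<le> b"
  shows "(\<Sum>i<n. m i * (xi p i)\<^sup>2) \<le> 4 / (27 * l\<^sup>2) * b"
proof -
  have "(\<Sum>i<n. m i * (xi p i)\<^sup>2) \<le> (\<Sum>i<n. 4 / (27 * l\<^sup>2) * (xi p i)\<^sup>2)"
    by (intro sum_mono mult_right_mono m_le) simp
  also have "\<dots> = 4 / (27 * l\<^sup>2) * (\<Sum>i<n. (xi p i)\<^sup>2)" by (simp only: sum_distrib_left)
  also have "\<dots> \<le> 4 / (27 * l\<^sup>2) * b" using b by (intro mult_left_mono) auto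
  finally show ?thesis .
qed

lemma weighted_xi_mean:
  "l * (\<integral>p. (\<Sum>i<n. m i * (xi p i)\<^sup>2) \<partial>(P0 \<Otimes>\<^sub>M P0)) \<le> N n"
proof -
  have "(\<integral>p. (\<Sum>i<n. m i * (xi p i)\<^sup>2) \<partial>(P0 \<Otimes>\<^sub>M P0)) = (\<Sum>i<n. m i * sig i)"
    using xi_mean by (simp add: xi_sq_integrable power2_eq_square)
      (simp add: xi_sq_integrable[unfolded power2_eq_square])
  then show ?thesis unfolding N_def by (simp add: sum_distrib_left l_m_sig_le sum_mono)
qed

lemma weighted_xi_integrable: "integrable (P0 \<Otimes>\<^sub>M P0) (\<lambda>p. \<Sum>i<n. m i * (xi p i)\<^sup>2)"
  by (intro Bochner_Integration.integrable_sum integrable_mult_right xi_sq_integrable)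

text \<open>\<open>X1\<close> is the rank-one matrix built from M^(1/2) xi and xi, so its squared
  norm factorises. In the second moment one factor is bounded by b and the other is
  averaged.\<close>

lemma X1_L2: "(L2_set (X1 n p) ({..<n} \<times> {..<n}))\<^sup>2 = (\<Sum>i<n. m i * (xi p i)\<^sup>2) * (\<Sum>j<n. (xi p j)\<^sup>2)"
proof -
  have "(L2_set (X1 n p) ({..<n} \<times> {..<n}))\<^sup>2 = (\<Sum>i<n. \<Sum>j<n. (m i * (xi p i)\<^sup>2) * (xi p j)\<^sup>2)"
    unfolding power2_L2_set X1_def
    by (simp add: sum.cartesian_product[symmetric] split_beta power_mult_distrib m_nonneg mult_ac
        sum.cartesian_product')
  then show ?thesis by (simp only: sum_product)
qed

lemma X1_kernel:
  assumes b: "\<And>p. (\<Sum>j<n. (xi p j)\<^sup>2) \<le> b"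
  shows "bounded_pair_kernel P0 (X1 n) ({..<n} \<times> {..<n}) (sqrt (4 / 27) * (b / l)) (b / l * N n)"
proof -
  interpret pair: pair_prob_space P0 P0 by unfold_locales
  have b0: "0 \<le> b" using b[of undefined] sum_nonneg[of "{..<n}" "\<lambda>j. (xi undefined j)\<^sup>2"] by simp
  have w0: "0 \<le> (\<Sum>i<n. m i * (xi p i)\<^sup>2)" for p by (intro sum_nonneg mult_nonneg_nonneg m_nonneg) simp
  show ?thesis
  proof unfold_locales
    show "finite ({..<n} \<times> {..<n})" by simp
    show "(\<lambda>p. X1 n p i) \<in> borel_measurable (P0 \<Otimes>\<^sub>M P0)" for i unfolding X1_def by measurable
    show "L2_set (X1 n p) ({..<n} \<times> {..<n}) \<le> sqrt (4 / 27) * (b / l)" for p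
    proof (rule power2_le_imp_le)
      have "(L2_set (X1 n p) ({..<n} \<times> {..<n}))\<^sup>2 \<le> (4 / (27 * l\<^sup>2) * b) * b"
        unfolding X1_L2 using b0 by (intro mult_mono weighted_xi_le b) (auto intro: sum_nonneg)
      also have "\<dots> = (sqrt (4 / 27) * (b / l))\<^sup>2"
        unfolding power_mult_distrib by (simp add: power2_eq_square)
      finally show "(L2_set (X1 n p) ({..<n} \<times> {..<n}))\<^sup>2 \<le> (sqrt (4 / 27) * (b / l))\<^sup>2" .
    qed (use b0 l_pos in simp)
    have "(\<integral>p. (L2_set (X1 n p) ({..<n} \<times> {..<n}))\<^sup>2 \<partial>(P0 \<Otimes>\<^sub>M P0))
        \<le> (\<integral>p. b * (\<Sum>i<n. m i * (xi p i)\<^sup>2) \<partial>(P0 \<Otimes>\<^sub>M P0))"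
    proof (rule integral_mono_AE')
      show "AE p in P0 \<Otimes>\<^sub>M P0. (L2_set (X1 n p) ({..<n} \<times> {..<n}))\<^sup>2 \<le> b * (\<Sum>i<n. m i * (xi p i)\<^sup>2)"
        unfolding X1_L2 by (intro AE_I2) (use mult_left_mono[OF b w0] in \<open>simp add: mult.commute\<close>)
    qed (use b0 w0 weighted_xi_integrable in \<open>auto intro!: integrable_mult_right\<close>)
    also have "\<dots> = b / l * (l * (\<integral>p. (\<Sum>i<n. m i * (xi p i)\<^sup>2) \<partial>(P0 \<Otimes>\<^sub>M P0)))"
      using l_pos by simp
    also have "\<dots> \<le> b / l * N n"
      using b0 l_pos by (intro mult_left_mono weighted_xi_mean) simp
    finally show "(\<integral>p. (L2_set (X1 n p) ({..<n} \<times> {..<n}))\<^sup>2 \<partial>(P0 \<Otimes>\<^sub>M P0)) \<le> b / l * N n" .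
  qed
qed

lemma X2_eq: "X2 n p u = l * (\<Sum>i<n. m i * (xi p i)\<^sup>2)"
  by (simp add: X2_def sum_distrib_left mult.assoc)

text \<open>For a nonnegative variable the second moment is at most the supremum times the mean, and
  the mean is at most \<open>N n\<close>.\<close>

lemma X2_kernel:
  assumes b: "\<And>p. (\<Sum>j<n. (xi p j)\<^sup>2) \<le> b"
  shows "bounded_pair_kernel P0 (X2 n) {()} (4 / 27 * (b / l)) (4 / 27 * (b / l) * N n)"
proof -
  interpret pair: pair_prob_space P0 P0 by unfold_locales
  have b0: "0 \<le> b" using b[of undefined] sum_nonneg[of "{..<n}" "\<lambda>j. (xi undefined j)\<^sup>2"] by simp
  have w0: "0 \<le> (\<Sum>i<n. m i * (xi p i)\<^sup>2)" for p by (intro sum_nonneg mult_nonneg_nonneg m_nonneg) simp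
  have X2_nonneg: "0 \<le> X2 n p u" for p u using w0[of p] l_pos by (simp add: X2_eq)
  have L2: "L2_set (X2 n p) {()} = X2 n p ()" for p
    using X2_nonneg by (simp add: L2_set_def)
  have X2_le: "X2 n p u \<le> 4 / 27 * (b / l)" for p u
  proof -
    have "X2 n p u \<le> l * (4 / (27 * l\<^sup>2) * b)"
      unfolding X2_eq using l_pos by (intro mult_left_mono weighted_xi_le b) simp
    then show ?thesis using l_pos by (simp add: power2_eq_square)
  qed
  show ?thesis
  proof unfold_locales
    show "(\<lambda>p. X2 n p i) \<in> borel_measurable (P0 \<Otimes>\<^sub>M P0)" for i unfolding X2_def by measurable
    show "L2_set (X2 n p) {()} \<le> 4 / 27 * (b / l)" for p unfolding L2 by (rule X2_le)
    have "(\<integral>p. (L2_set (X2 n p) {()})\<^sup>2 \<partial>(P0 \<Otimes>\<^sub>M P0))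
        \<le> (\<integral>p. 4 / 27 * (b / l) * (l * (\<Sum>i<n. m i * (xi p i)\<^sup>2)) \<partial>(P0 \<Otimes>\<^sub>M P0))"
      unfolding L2
    proof (rule integral_mono_AE')
      show "AE p in P0 \<Otimes>\<^sub>M P0. (X2 n p ())\<^sup>2 \<le> 4 / 27 * (b / l) * (l * (\<Sum>i<n. m i * (xi p i)\<^sup>2))"
        unfolding X2_eq[symmetric, where u = "()"] power2_eq_square[of "X2 n _ ()"]
        by (intro AE_I2 mult_right_mono X2_le X2_nonneg)
      show "integrable (P0 \<Otimes>\<^sub>M P0) (\<lambda>p. 4 / 27 * (b / l) * (l * (\<Sum>i<n. m i * (xi p i)\<^sup>2)))"
        by (intro integrable_mult_right weighted_xi_integrable)
    qed (use b0 l_pos w0 in auto)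
    also have "\<dots> = 4 / 27 * (b / l) * (l * (\<integral>p. (\<Sum>i<n. m i * (xi p i)\<^sup>2) \<partial>(P0 \<Otimes>\<^sub>M P0)))"
      by (simp only: integral_mult_right_zero)
    also have "\<dots> \<le> 4 / 27 * (b / l) * N n"
      using b0 l_pos by (intro mult_left_mono weighted_xi_mean) simp
    finally show "(\<integral>p. (L2_set (X2 n p) {()})\<^sup>2 \<partial>(P0 \<Otimes>\<^sub>M P0)) \<le> 4 / 27 * (b / l) * N n" .
  qed simp
qed

lemma quad_eq_ustat_dev:
  assumes b: "\<And>p. (\<Sum>j<n. (xi p j)\<^sup>2) \<le> b"
  shows "quad n s Y = (bounded_pair_kernel.ustat_dev P0 (X1 n) ({..<n} \<times> {..<n}) s Y)\<^sup>2"
proof -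
  interpret X1: bounded_pair_kernel P0 "X1 n" "{..<n} \<times> {..<n}" "sqrt (4 / 27) * (b / l)" "b / l * N n"
    by (rule X1_kernel[OF b])
  have ustat: "X1.ustat s Y ij = sqrt (m (fst ij)) * U s Y (fst ij) (snd ij)" for ij
    by (simp add: X1.ustat_def X1_def U_def sum_distrib_left)
  have mean: "(\<integral>p. X1 n p ij \<partial>(P0 \<Otimes>\<^sub>M P0)) = sqrt (m (fst ij)) * (if fst ij = snd ij then sig (fst ij) else 0)" for ij
    by (simp add: X1_def xi_mean)
  have "(X1.ustat_dev s Y)\<^sup>2
      = (\<Sum>ij\<in>{..<n} \<times> {..<n}. m (fst ij) * (U s Y (fst ij) (snd ij) - (if fst ij = snd ij then sig (fst ij) else 0))\<^sup>2)"
    unfolding X1.ustat_dev_def power2_L2_set ustat mean right_diff_distrib[symmetric] power_mult_distrib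
    by (simp add: m_nonneg)
  also have "\<dots> = quad n s Y"
    unfolding quad_def sum.cartesian_product by (intro sum.cong refl) (simp add: split_beta)
  finally show ?thesis by simp
qed

lemma lin_eq_ustat_dev:
  assumes b: "\<And>p. (\<Sum>j<n. (xi p j)\<^sup>2) \<le> b"
  shows "\<bar>lin n s Y\<bar> = bounded_pair_kernel.ustat_dev P0 (X2 n) {()} s Y"
proof -
  interpret X2: bounded_pair_kernel P0 "X2 n" "{()}" "4 / 27 * (b / l)" "4 / 27 * (b / l) * N n"
    by (rule X2_kernel[OF b])
  have ustat: "X2.ustat s Y u = (\<Sum>i<n. l * m i * U s Y i i)" for u
  proof -
    have "(\<Sum>c\<in>{1..s}. \<Sum>d\<in>{1..s} - {c}. X2 n (Y c, Y d) u)
        = (\<Sum>c\<in>{1..s}. \<Sum>i<n. \<Sum>d\<in>{1..s} - {c}. l * m i * (xi (Y c, Y d) i)\<^sup>2)"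
      unfolding X2_def by (intro sum.cong refl sum.swap)
    also have "\<dots> = (\<Sum>i<n. \<Sum>c\<in>{1..s}. \<Sum>d\<in>{1..s} - {c}. l * m i * (xi (Y c, Y d) i)\<^sup>2)"
      by (rule sum.swap)
    finally show ?thesis
      by (simp add: X2.ustat_def U_def sum_divide_distrib sum_distrib_left power2_eq_square)
  qed
  have mean: "(\<integral>p. X2 n p u \<partial>(P0 \<Otimes>\<^sub>M P0)) = (\<Sum>i<n. l * m i * sig i)" for u
    unfolding X2_def using xi_mean xi_sq_integrable by (simp add: power2_eq_square)
  have "X2.ustat_dev s Y = \<bar>- lin n s Y\<bar>"
    by (simp add: X2.ustat_dev_def L2_set_def ustat mean lin_def right_diff_distrib sum_subtractf)
  then show ?thesis by simp
qed

end


section \<open>The lower bound\<close>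

text \<open>The quartic in \<open>y\<close> is positive by a small margin (about \<open>0.01\<close>, near \<open>y = 1 / 10\<close>); on each of
  the five intervals below, the square of \<open>u\<close> is replaced by its tangent at \<open>c\<close>, which makes the
  claim concave in \<open>y\<close>.\<close>

lemma constant_le_square:
  fixes y \<beta> :: real
  assumes y: "0 < y" and pos: "0 < 4 / 9 - 16 / (3 * sqrt 3) * y - 32 / 9 * y\<^sup>2"
    and \<beta>: "0 \<le> \<beta>" "\<beta> \<le> 4087 / 1000 * y\<^sup>2"
  defines "u \<equiv> 1 - 5 * \<beta> - 2 * sqrt (20 / 27 * \<beta>)"
  shows "0 \<le> u" and "4 / 9 - 16 / (3 * sqrt 3) * y - 32 / 9 * y\<^sup>2 \<le> 9 / 16 * (49 / 50) * u\<^sup>2"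
    and "y < 127 / 1000"
proof -
  \<comment> \<open>A polynomial minorant of \<open>u\<close>: 4087/200 is 5 times 4.087, and 87/25
    is twice the 87/50 bounding the root.\<close>
  define w where "w = 1 - 4087 / 200 * y\<^sup>2 - 87 / 25 * y"
  have "sqrt 3 \<le> 17321 / 10000" by (rule real_le_lsqrt) (simp_all add: power2_eq_square)
  then have s3: "3079 / 1000 * y \<le> 16 / (3 * sqrt 3) * y"
    using y by (intro mult_right_mono) (simp_all add: field_simps)
  then have "0 < 4 / 9 - 3079 / 1000 * y - 32 / 9 * y\<^sup>2" using pos by linarith
  note y_bound = this
  show y_less: "y < 127 / 1000"
  proof (rule ccontr)
    assume "\<not> y < 127 / 1000"
    then have "127 / 1000 \<le> y" by simp
    from power_mono[OF this, of 2] this y_bound show False by (simp add: power2_eq_square)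
  qed
  \<comment> \<open>87/50 barely suffices: 20/27 * 4.087 is about 3.0274, and 1.74^2 =
    3.0276.\<close>
  have "sqrt (20 / 27 * \<beta>) \<le> 87 / 50 * y"
  proof (rule real_le_lsqrt)
    have "20 / 27 * \<beta> \<le> 20 / 27 * (4087 / 1000 * y\<^sup>2)" using \<beta> by simp
    also have "\<dots> \<le> (87 / 50 * y)\<^sup>2" by (simp add: power_mult_distrib) (simp add: power2_eq_square)
    finally show "20 / 27 * \<beta> \<le> (87 / 50 * y)\<^sup>2" .
  qed (use y \<beta> in auto)
  then have "w \<le> u" using \<beta> by (simp add: u_def w_def)
  have "0 \<le> w"
  proof -
    have "y * y \<le> 127 / 1000 * y" using y_less y by (intro mult_right_mono) auto
    then show ?thesis using y_less by (simp add: w_def power2_eq_square)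
  qed
  then show "0 \<le> u" using \<open>w \<le> u\<close> by simp
  \<comment> \<open>Replacing \<open>y\<^sup>2\<close> by its chord leaves a linear inequality on
    each interval, which concavity permits. The witnesses \<open>c\<close> are values that
    \<open>w\<close> takes there.\<close>
  have chord: "y\<^sup>2 \<le> (lo + hi) * y - lo * hi" if "lo \<le> y" "y \<le> hi" for lo hi
    using mult_nonneg_nonneg[of "y - lo" "hi - y"] that by (simp add: power2_eq_square algebra_simps)
  have "\<exists>c. 4 / 9 - 3079 / 1000 * y - 7111 / 2000 * y\<^sup>2 \<le> 9 / 16 * (49 / 50) * (2 * c * w - c * c)"
  proof -
    consider "0 \<le> y" "y \<le> 1 / 20" | "1 / 20 \<le> y" "y \<le> 3 / 40" | "3 / 40 \<le> y" "y \<le> 9 / 100"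
      | "9 / 100 \<le> y" "y \<le> 21 / 200" | "21 / 200 \<le> y" "y \<le> 127 / 1000" using y y_less by linarith
    then show ?thesis
    proof cases
      case 1
      with chord[OF 1] show ?thesis unfolding w_def by (intro exI[of _ "17 / 20"]) (simp add: algebra_simps)
    next
      case 2
      with chord[OF 2] show ?thesis unfolding w_def by (intro exI[of _ "7 / 10"]) (simp add: algebra_simps)
    next
      case 3
      with chord[OF 3] show ?thesis unfolding w_def by (intro exI[of _ "57 / 100"]) (simp add: algebra_simps)
    next
      case 4
      with chord[OF 4] show ?thesis unfolding w_def by (intro exI[of _ "47 / 100"]) (simp add: algebra_simps)
    next
      case 5
      with chord[OF 5] show ?thesis unfolding w_def by (intro exI[of _ "8 / 25"]) (simp add: algebra_simps)
    qed
  qed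
  then obtain c where c: "4 / 9 - 3079 / 1000 * y - 7111 / 2000 * y\<^sup>2 \<le> 9 / 16 * (49 / 50) * (2 * c * w - c\<^sup>2)"
    unfolding power2_eq_square[of c] by (auto simp: power2_eq_square)
  have "2 * c * w - c\<^sup>2 \<le> w\<^sup>2"
    using zero_le_power2[of "w - c"] by (simp add: power2_eq_square algebra_simps)
  also have "w\<^sup>2 \<le> u\<^sup>2" using \<open>0 \<le> w\<close> \<open>w \<le> u\<close> by (intro power_mono)
  finally have "9 / 16 * (49 / 50) * (2 * c * w - c\<^sup>2) \<le> 9 / 16 * (49 / 50) * u\<^sup>2" by simp
  then show "4 / 9 - 16 / (3 * sqrt 3) * y - 32 / 9 * y\<^sup>2 \<le> 9 / 16 * (49 / 50) * u\<^sup>2"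
    using c s3 zero_le_power2[of y] by linarith
qed

text \<open>Cauchy-Schwarz for (1, 2) and (1, sqrt q), whence 5 = 1 + 4.\<close>

lemma tail_threshold_le:
  fixes A q :: real
  assumes "0 \<le> A" "0 \<le> q"
  shows "sqrt A + 2 * sqrt (A * q) \<le> sqrt (5 * A * (1 + q))"
proof (rule real_le_rsqrt)
  have "0 \<le> (2 * sqrt A - sqrt (A * q))\<^sup>2" by simp
  then show "(sqrt A + 2 * sqrt (A * q))\<^sup>2 \<le> 5 * A * (1 + q)"
    using assms by (simp add: power2_sum power2_diff power_mult_distrib algebra_simps)
qed

section \<open>Assembling the probability bound\<close>

context spectral_kernel_model
begin

lemma emp_N2_lower_bound:
  fixes c1 \<delta> b :: real
  assumes s: "2 \<le> s" and c1: "0 < c1" and \<delta>: "0 < \<delta>" "\<delta> < 1 / 3" and l_le: "l \<le> lam 0"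
    and b: "\<And>p n. (\<Sum>j<n. (xi p j)\<^sup>2) \<le> b"
    and cond: "b * ln (2 / \<delta>) / l \<le> 2 * real s / c1"
    and r_pos: "0 < 4 / 9 - 16 / (3 * sqrt (3 * c1)) - 32 / (9 * c1)"
  shows "1 - 3 * \<delta> \<le> measure (Pi\<^sub>M {1..s} (\<lambda>_. P0))
    {Y \<in> space (Pi\<^sub>M {1..s} (\<lambda>_. P0)).
      (4 / 9 - 16 / (3 * sqrt (3 * c1)) - 32 / (9 * c1)) * (N2 P0 evl l)\<^sup>2 \<le> (emp_N2 evl K s l Y)\<^sup>2}"
proof -
  let ?\<Omega> = "Pi\<^sub>M {1..s} (\<lambda>_. P0)"
  interpret \<Omega>: prob_space ?\<Omega> by (intro prob_space_PiM P0.prob_space_axioms)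
  interpret pair: pair_prob_space P0 P0 by unfold_locales
  define r where "r = 4 / 9 - 16 / (3 * sqrt (3 * c1)) - 32 / (9 * c1)"
  define y where "y = 1 / sqrt c1"
  have y: "0 < y" "y\<^sup>2 = 1 / c1" using c1 by (auto simp: y_def power_divide)
  have r_eq: "r = 4 / 9 - 16 / (3 * sqrt 3) * y - 32 / 9 * y\<^sup>2"
    unfolding r_def y(2) by (simp add: y_def real_sqrt_mult mult.assoc)
  define L where "L = ln (2 / \<delta>)"
  \<comment> \<open>Each of the two bad events gets probability \<open>exp (- q)\<close>, which is
    3/2 \<delta>. Since \<open>L = ln 3 + q\<close> and ln 3 >= 1, the factor \<open>1 + q\<close>
    is absorbed into \<open>L\<close>.\<close>
  define q where "q = ln (2 / (3 * \<delta>))"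
  have q0: "0 \<le> q" using \<delta> by (simp add: q_def field_simps)
  have qL: "1 + q \<le> L"
  proof -
    have "ln (3 * (2 / (3 * \<delta>))) = ln 3 + q" unfolding q_def using \<delta> by (intro ln_mult_pos) auto
    then have "L = ln 3 + q" by (simp add: L_def)
    moreover have "1 \<le> ln (3::real)" using exp_le by (subst ln_ge_iff) auto
    ultimately show ?thesis by simp
  qed
  have L: "3 / 2 \<le> L"
  proof -
    have "(exp (3 / 2 :: real))\<^sup>2 = exp 1 ^ 3" by (simp flip: exp_of_nat_mult exp_double)
    also have "\<dots> \<le> 3 ^ 3" by (intro power_mono exp_le) simp
    also have "\<dots> \<le> (6::real)\<^sup>2" by simp
    finally have "exp (3 / 2 :: real) \<le> 6" by (rule power2_le_imp_le) simp
    also have "6 \<le> 2 / \<delta>" using \<delta> by (simp add: field_simps)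
    finally show ?thesis unfolding L_def using \<delta> by (subst ln_ge_iff) auto
  qed
  have sig0: "l \<le> sig 0" using l_le l_pos by (simp add: sig_def)
  \<comment> \<open>\<open>b\<close> dominates the mean square of coordinate 0, which is
    \<open>sig 0\<close>. Through \<open>cond\<close> this will force \<open>s\<close> to be
    large.\<close>
  have b_l: "l \<le> b"
  proof -
    have "sig 0 = (\<integral>p. (xi p 0)\<^sup>2 \<partial>(P0 \<Otimes>\<^sub>M P0))"
      using xi_mean[of 0 0] by (simp add: power2_eq_square)
    also have "\<dots> \<le> (\<integral>p. b \<partial>(P0 \<Otimes>\<^sub>M P0))"
      using b[of _ 1] by (intro integral_mono xi_sq_integrable) auto
    finally show ?thesis using sig0 by (simp add: pair.prob_space)
  qed
  have b_pos: "0 < b" using b_l l_pos by simp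
  define M where "M = real (s div 2)"
  have M: "0 < M" "(real s - 1) / 2 \<le> M"
  proof -
    show "0 < M" using s by (simp add: M_def)
    have "s \<le> 2 * (s div 2) + 1" by presburger
    then have "real s \<le> 2 * M + 1" unfolding M_def by linarith
    then show "(real s - 1) / 2 \<le> M" by simp
  qed
  \<comment> \<open>Relative noise level: outside the bad events \<open>quad\<close> is at most 5
    \<beta> N' and \<open>lin\<close> at most 2 sqrt(20/27 \<beta>) N', which together make up
    \<open>u\<close>.\<close>
  define \<beta> where "\<beta> = b * L / (l * M)"
  have \<beta>0: "0 \<le> \<beta>" using b_pos L l_pos M by (simp add: \<beta>_def)
  have y_less: "y < 127 / 1000" 
    using constant_le_square(3)[of y 0] y(1) r_pos unfolding r_def[symmetric] r_eq by simp
  have c1_ge: "62 \<le> c1"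
  proof -
    have "y\<^sup>2 \<le> (127 / 1000)\<^sup>2" using y y_less by (intro power_mono) auto
    then have "1 / c1 \<le> 1 / 62" unfolding y(2) by (simp add: power2_eq_square)
    then show ?thesis using c1 by (simp add: field_simps)
  qed
  \<comment> \<open>L c1 / 2 >= 46.5 by L >= 3/2 and c1 >= 62. Then 4 s/(s - 1) <= 4 * 47/46 <
    4.087, the constant of \<open>constant_le_square\<close>.\<close>
  have s47: "47 \<le> s"
  proof -
    have "L \<le> b * L / l" using b_l l_pos L by (simp add: field_simps mult_right_mono)
    then have "L \<le> 2 * real s / c1" using cond by (simp only: L_def)
    then have "L * c1 \<le> 2 * real s" using c1 by (simp add: pos_le_divide_eq)
    moreover have "3 / 2 * 62 \<le> L * c1" using L c1_ge by (intro mult_mono) auto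
    ultimately show ?thesis by linarith
  qed
  have \<beta>_le: "\<beta> \<le> 4087 / 1000 * y\<^sup>2"
  proof -
    have "\<beta> = (b * L / l) / M" by (simp add: \<beta>_def)
    also have "\<dots> \<le> (2 * real s / c1) / M" using cond M by (intro divide_right_mono) (auto simp: L_def)
    also have "\<dots> \<le> (2 * real s / c1) / ((real s - 1) / 2)"
      using M s47 c1 by (intro divide_left_mono) auto
    also have "\<dots> = 4 * (real s / (real s - 1)) * (1 / c1)" by simp
    also have "\<dots> \<le> 4087 / 1000 * (1 / c1)"
      using s47 c1 by (intro mult_right_mono) (auto simp: field_simps)
    finally show ?thesis by (simp add: y)
  qed
  define u where "u = 1 - 5 * \<beta> - 2 * sqrt (20 / 27 * \<beta>)"
  have u: "0 \<le> u" "r \<le> 9 / 16 * (49 / 50) * u\<^sup>2"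
    using constant_le_square(1,2)[OF y(1) _ \<beta>0 \<beta>_le] r_pos unfolding u_def r_def[symmetric] r_eq by auto
  define S where "S = (\<Sum>i. (cov.rho i)\<^sup>2)"
  have rho0: "0 < cov.rho 0" using lam_pos[of 0] l_pos by (simp add: cov.rho_def)
  have "0 < S"
    unfolding S_def using cov.rho2_summable rho0 by (intro suminf_pos2[where i = 0]) auto
  obtain n where n: "1 \<le> n" "49 / 50 * S \<le> (\<Sum>i<n. (cov.rho i)\<^sup>2)"
  proof -
    have "(\<lambda>n. \<Sum>i<n. (cov.rho i)\<^sup>2) \<longlonglongrightarrow> S"
      unfolding S_def by (rule summable_LIMSEQ[OF cov.rho2_summable])
    then have "\<forall>\<^sub>F n in sequentially. 49 / 50 * S < (\<Sum>i<n. (cov.rho i)\<^sup>2)"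
      using \<open>0 < S\<close> by (intro order_tendstoD) auto
    then have "\<forall>\<^sub>F n in sequentially. 1 \<le> n \<and> 49 / 50 * S < (\<Sum>i<n. (cov.rho i)\<^sup>2)"
      by (intro eventually_conj eventually_ge_at_top)
    then obtain n where "1 \<le> n" "49 / 50 * S < (\<Sum>i<n. (cov.rho i)\<^sup>2)"
      using eventually_happens'[OF sequentially_bot] by blast
    then show thesis using that[of n] by simp
  qed
  define N' where "N' = N n"
  have N_S: "9 / 16 * (49 / 50) * S \<le> N'"
  proof -
    have "9 / 16 * (49 / 50 * S) \<le> 9 / 16 * (\<Sum>i<n. (cov.rho i)\<^sup>2)" using n(2) by simp
    also have "\<dots> = (\<Sum>i<n. (3 / 4 * cov.rho i)\<^sup>2)"
      by (simp add: sum_distrib_left power_mult_distrib power_divide)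
    also have "\<dots> \<le> N'"
      unfolding N'_def N_def using cov.rho_bounds(1) by (intro sum_mono power_mono a_ge_rho) simp
    finally show ?thesis by simp
  qed
  \<comment> \<open>This is where \<open>l \<le> lam 0\<close> is needed: the first cut eigenvalue
    contributes at least h(l)^2 = 1/4. It secures the range condition of the tail bounds and gives
    sqrt N' <= 2 N'.\<close>
  have N_ge: "1 / 4 \<le> N'"
  proof -
    have "1 / 2 \<le> a 0" using sig0 l_pos by (simp add: a_def field_simps)
    then have "(1 / 2)\<^sup>2 \<le> (a 0)\<^sup>2" by (intro power_mono) auto
    also have "\<dots> \<le> N'"
      unfolding N'_def N_def using n(1) by (intro member_le_sum[where i = 0]) auto
    finally show ?thesis by (simp add: power_divide)
  qed
  \<comment> \<open>The common square of both range conditions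
    \<open>2 * B * \<theta> \<le> 1\<close>: for \<open>X1\<close> and for \<open>X2\<close> the
    quotient B^2/V is 4/27 (b/l)/N'.\<close>
  have small: "16 / 27 * (b / l) * q / (M * N') \<le> 1"
  proof -
    have "b / l * q / M \<le> \<beta>"
      using qL q0 b_pos l_pos M unfolding \<beta>_def by (simp add: field_simps mult_left_mono)
    moreover have "y\<^sup>2 \<le> (127 / 1000)\<^sup>2" using y y_less by (intro power_mono) auto
    ultimately have "b / l * q / M \<le> 1 / 10" using \<beta>_le by (simp add: power2_eq_square)
    from frac_le[OF _ this _ N_ge] have "b / l * q / M / N' \<le> (1 / 10) / (1 / 4)" by simp
    moreover have "16 / 27 * z \<le> 1" if "z \<le> (1 / 10) / (1 / 4)" for z :: real using that by simp
    ultimately have "16 / 27 * (b / l * q / M / N') \<le> 1" by blast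
    then show ?thesis by simp
  qed
  have small_sqrt: "2 * (sqrt (4 / 27) * (b / l)) * sqrt (q / (M * (b / l * N'))) \<le> 1"
  proof -
    have "(2 * (sqrt (4 / 27) * (b / l)) * sqrt (q / (M * (b / l * N'))))\<^sup>2
        = 4 * (4 / 27 * (b / l)\<^sup>2) * (q / (M * (b / l * N')))"
      unfolding power_mult_distrib using q0 M b_pos l_pos N_ge by simp
    also have "\<dots> = 16 / 27 * (b / l) * q / (M * N')"
      using b_pos l_pos by (simp add: power2_eq_square)
    finally have "(2 * (sqrt (4 / 27) * (b / l)) * sqrt (q / (M * (b / l * N'))))\<^sup>2 \<le> 1\<^sup>2"
      using small by simp
    then show ?thesis by (rule power2_le_imp_le) simp
  qed
  have small_sqrt2: "2 * (4 / 27 * (b / l)) * sqrt (q / (M * (4 / 27 * (b / l) * N'))) \<le> 1"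
  proof -
    have "(2 * (4 / 27 * (b / l)) * sqrt (q / (M * (4 / 27 * (b / l) * N'))))\<^sup>2
        = 4 * (4 / 27 * (b / l))\<^sup>2 * (q / (M * (4 / 27 * (b / l) * N')))"
      unfolding power_mult_distrib using q0 M b_pos l_pos N_ge by simp
    also have "\<dots> = 16 / 27 * (b / l) * q / (M * N')"
      using b_pos l_pos by (simp add: power2_eq_square mult_ac)
    finally have "(2 * (4 / 27 * (b / l)) * sqrt (q / (M * (4 / 27 * (b / l) * N'))))\<^sup>2 \<le> 1\<^sup>2"
      using small by simp
    then show ?thesis by (rule power2_le_imp_le) simp
  qed
  interpret X1: bounded_pair_kernel P0 "X1 n" "{..<n} \<times> {..<n}" "sqrt (4 / 27) * (b / l)" "b / l * N'"
    unfolding N'_def by (rule X1_kernel[OF b])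
  interpret X2: bounded_pair_kernel P0 "X2 n" "{()}" "4 / 27 * (b / l)" "4 / 27 * (b / l) * N'"
    unfolding N'_def by (rule X2_kernel[OF b])
  define \<tau> where "\<tau> V = sqrt (V / M) + 2 * sqrt (V * q / M)" for V
  define bad1 where "bad1 = {Y \<in> space ?\<Omega>. \<tau> (b / l * N') \<le> X1.ustat_dev s Y}"
  define bad2 where "bad2 = {Y \<in> space ?\<Omega>. \<tau> (4 / 27 * (b / l) * N') \<le> X2.ustat_dev s Y}"
  define good where "good = {Y \<in> space ?\<Omega>. r * (N2 P0 evl l)\<^sup>2 \<le> (emp_N2 evl K s l Y)\<^sup>2}"
  have exp_q: "exp (- q) = 3 / 2 * \<delta>" using \<delta> by (simp add: q_def exp_minus field_simps)
  have bad1: "measure ?\<Omega> bad1 \<le> 3 / 2 * \<delta>"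
    unfolding bad1_def \<tau>_def M_def exp_q[symmetric]
    by (rule X1.ustat_dev_tail[OF s _ q0]) (use small_sqrt b_pos l_pos N_ge in \<open>auto simp: M_def\<close>)
  have bad2: "measure ?\<Omega> bad2 \<le> 3 / 2 * \<delta>"
    unfolding bad2_def \<tau>_def M_def exp_q[symmetric]
    by (rule X2.ustat_dev_tail[OF s _ q0]) (use small_sqrt2 b_pos l_pos N_ge in \<open>auto simp: M_def\<close>)
  have \<tau>_le: "\<tau> (c * (b / l) * N') \<le> sqrt (5 * c * \<beta> * N')" if "0 \<le> c" for c
  proof -
    let ?A = "c * (b / l) * N' / M"
    have A: "0 \<le> ?A" using that b_pos l_pos N_ge M by simp
    have "\<tau> (c * (b / l) * N') \<le> sqrt (5 * ?A * (1 + q))"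
      using tail_threshold_le[OF A q0] by (simp add: \<tau>_def)
    also have "\<dots> \<le> sqrt (5 * ?A * L)" using A qL by (intro real_sqrt_le_mono mult_left_mono) auto
    also have "5 * ?A * L = 5 * c * \<beta> * N'" by (simp add: \<beta>_def)
    finally show ?thesis .
  qed
  have "space ?\<Omega> - (bad1 \<union> bad2) \<subseteq> good"
  proof
    fix Y assume Y: "Y \<in> space ?\<Omega> - (bad1 \<union> bad2)"
    have "X1.ustat_dev s Y \<le> sqrt (5 * \<beta> * N')"
      using Y \<tau>_le[of 1] by (auto simp: bad1_def)
    then have "quad n s Y \<le> (sqrt (5 * \<beta> * N'))\<^sup>2"
      unfolding quad_eq_ustat_dev[OF b] by (intro power_mono) (auto simp: X1.ustat_dev_def)
    then have quad: "quad n s Y \<le> 5 * \<beta> * N'" using \<beta>0 N_ge by simp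
    have "\<bar>lin n s Y\<bar> \<le> sqrt (5 * (4 / 27) * \<beta> * N')"
      using Y \<tau>_le[of "4 / 27"] unfolding lin_eq_ustat_dev[OF b] by (auto simp: bad2_def)
    \<comment> \<open>The linear error is of order sqrt N'; with N' >= 1/4 it becomes a multiple of
      N' like the quadratic one.\<close>
    also have "\<dots> \<le> sqrt (20 / 27 * \<beta> * (2 * N')\<^sup>2)"
    proof (rule real_sqrt_le_mono)
      have "N' \<le> (2 * N')\<^sup>2" using mult_right_mono[of "1 / 4" N' N'] N_ge by (simp add: power2_eq_square)
      then have "20 / 27 * \<beta> * N' \<le> 20 / 27 * \<beta> * (2 * N')\<^sup>2" using \<beta>0 by (intro mult_left_mono) auto
      then show "5 * (4 / 27) * \<beta> * N' \<le> 20 / 27 * \<beta> * (2 * N')\<^sup>2" by simp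
    qed
    also have "\<dots> = sqrt (20 / 27 * \<beta>) * (2 * N')"
    proof -
      have "sqrt ((2 * N')\<^sup>2) = 2 * N'" using N_ge by (intro real_sqrt_unique) auto
      then show ?thesis unfolding real_sqrt_mult[of "20 / 27 * \<beta>"] by (simp only:)
    qed
    finally have "lin n s Y \<le> sqrt (20 / 27 * \<beta>) * (2 * N')" by simp
    with quad have low: "N' * u \<le> N n - quad n s Y - lin n s Y"
      by (simp add: u_def N'_def algebra_simps)
    have "0 \<le> N' * u" using N_ge u(1) by simp
    then have "(N' * u)\<^sup>2 \<le> (N n - quad n s Y - lin n s Y)\<^sup>2" using low by (intro power_mono)
    also have "\<dots> \<le> N' * (emp_N2 evl K s l Y)\<^sup>2"
      unfolding N'_def using low \<open>0 \<le> N' * u\<close> by (intro emp_N2_lower[OF s]) (simp add: N'_def)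
    finally have "N' * (N' * u\<^sup>2) \<le> N' * (emp_N2 evl K s l Y)\<^sup>2"
      by (simp add: power2_eq_square mult_ac)
    then have emp: "N' * u\<^sup>2 \<le> (emp_N2 evl K s l Y)\<^sup>2" using N_ge by simp
    have "r * (N2 P0 evl l)\<^sup>2 \<le> r * S"
      unfolding S_def N2_def using r_pos by (intro mult_left_mono cov.hs_norm_whitened_le) (simp add: r_def)
    also have "\<dots> \<le> 9 / 16 * (49 / 50) * u\<^sup>2 * S" using u(2) \<open>0 < S\<close> by (intro mult_right_mono) auto
    also have "\<dots> = (9 / 16 * (49 / 50) * S) * u\<^sup>2" by (simp only: mult_ac)
    also have "\<dots> \<le> N' * u\<^sup>2" using N_S by (intro mult_right_mono) auto
    finally show "Y \<in> good" using emp Y by (simp add: good_def)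
  qed
  have sets: "bad1 \<in> sets ?\<Omega>" "bad2 \<in> sets ?\<Omega>" "good \<in> sets ?\<Omega>"
    unfolding bad1_def bad2_def good_def using emp_N2_measurable[OF s l_pos] by measurable
  have "1 - measure ?\<Omega> (bad1 \<union> bad2) = measure ?\<Omega> (space ?\<Omega> - (bad1 \<union> bad2))"
    using sets by (subst \<Omega>.prob_compl) auto
  also have "\<dots> \<le> measure ?\<Omega> good"
    using \<open>space ?\<Omega> - (bad1 \<union> bad2) \<subseteq> good\<close> sets by (intro \<Omega>.finite_measure_mono)
  finally have "1 - measure ?\<Omega> (bad1 \<union> bad2) \<le> measure ?\<Omega> good" .
  moreover have "measure ?\<Omega> (bad1 \<union> bad2) \<le> 3 * \<delta>"
    using measure_Un_le[OF sets(1,2)] bad1 bad2 by linarith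
  ultimately show ?thesis unfolding good_def r_def by linarith
qed

end

theorem lemmaA7:
  fixes evl :: "'h::{real_inner,banach} \<Rightarrow> 'x::second_countable_topology \<Rightarrow> real"
    and K :: "'x \<Rightarrow> 'x \<Rightarrow> real"
    and P0 :: "'x measure"
    and lam :: "nat \<Rightarrow> real"
    and e :: "nat \<Rightarrow> 'x \<Rightarrow> real"
    and \<kappa> c1 \<delta> l :: real
    and s :: nat
  assumes "rkhs evl K"
    and "continuous_on UNIV (\<lambda>(x, y). K x y)"
    and "\<And>x. K x x \<le> \<kappa>"
    and "prob_space P0"
    and "sets P0 = sets borel"
    and "spectral_decomposition P0 (integral_op P0 evl) lam e"
    and "s \<ge> 2"
    and "c1 > 0"
    and "\<delta> > 0"
    and "l > 0"
  shows "(max (140 * \<kappa> / real s * ln (16 * \<kappa> * real s / \<delta>))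
              (4 * c1 * \<kappa> / real s * ln (2 / \<delta>)) \<le> l \<and>
          l \<le> onorm (cov_op P0 evl)
          \<longrightarrow> measure (Pi\<^sub>M {1..s} (\<lambda>_. P0))
                {Y \<in> space (Pi\<^sub>M {1..s} (\<lambda>_. P0)).
                   (emp_N2 evl K s l Y)\<^sup>2
                     \<ge> (4 / 9 - 16 / (3 * sqrt (3 * c1)) - 32 / (9 * c1)) * (N2 P0 evl l)\<^sup>2}
              \<ge> 1 - 3 * \<delta>)
       \<and> (\<forall>C. bdd_above (range (\<lambda>i. sup_norm (evl (eigen_fun P0 evl lam e i)))) \<and>
          C = (SUP i. sup_norm (evl (eigen_fun P0 evl lam e i))) \<and>
          l \<le> onorm (cov_op P0 evl) \<and>
          C\<^sup>2 * N1 P0 evl l * max (4 * c1 * ln (2 / \<delta>)) (136 * ln (8 * N1 P0 evl l / \<delta>)) \<le> real s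
          \<longrightarrow> measure (Pi\<^sub>M {1..s} (\<lambda>_. P0))
                {Y \<in> space (Pi\<^sub>M {1..s} (\<lambda>_. P0)).
                   (emp_N2 evl K s l Y)\<^sup>2
                     \<ge> (4 / 9 - 16 / (3 * sqrt (3 * c1)) - 32 / (9 * c1)) * (N2 P0 evl l)\<^sup>2}
              \<ge> 1 - 3 * \<delta>)"
proof -
  interpret P0: prob_space P0 by fact
  interpret spectral_kernel_model P0 evl K \<kappa> lam e l
    by unfold_locales (use assms in auto)
  let ?\<Omega> = "Pi\<^sub>M {1..s} (\<lambda>_. P0)"
  let ?r = "4 / 9 - 16 / (3 * sqrt (3 * c1)) - 32 / (9 * c1)"
  let ?good = "{Y \<in> space ?\<Omega>. (emp_N2 evl K s l Y)\<^sup>2 \<ge> ?r * (N2 P0 evl l)\<^sup>2}"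
  interpret \<Omega>: prob_space ?\<Omega> by (intro prob_space_PiM P0.prob_space_axioms)
  have main: "1 - 3 * \<delta> \<le> measure ?\<Omega> ?good"
    if l_le: "l \<le> onorm (cov_op P0 evl)"
      and b: "\<And>p n. (\<Sum>j<n. (xi p j)\<^sup>2) \<le> b"
      and cond: "b * ln (2 / \<delta>) / l \<le> 2 * real s / c1" for b
  proof -
    \<comment> \<open>For \<delta> >= 1/3 the claimed probability is at most 0; for a nonpositive
      factor the event is the whole space.\<close>
    consider "1 / 3 \<le> \<delta>" | "\<delta> < 1 / 3" "?r \<le> 0" | "\<delta> < 1 / 3" "0 < ?r" by linarith
    then show ?thesis
    proof cases
      case 1
      then show ?thesis using measure_nonneg[of ?\<Omega> ?good] by linarith
    next
      case 2
      have "?r * (N2 P0 evl l)\<^sup>2 \<le> (emp_N2 evl K s l Y)\<^sup>2" for Y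
        using 2(2) by (intro order_trans[OF mult_nonpos_nonneg zero_le_power2]) auto
      then have "?good = space ?\<Omega>" by auto
      then show ?thesis using assms(9) \<Omega>.prob_space by simp
    next
      case 3
      have "l \<le> lam 0" using l_le cov.onorm_le by simp
      then show ?thesis using assms 3 b cond by (intro emp_N2_lower_bound)
    qed
  qed
  show ?thesis
  proof (intro conjI impI allI; elim conjE)
    assume max: "max (140 * \<kappa> / real s * ln (16 * \<kappa> * real s / \<delta>)) (4 * c1 * \<kappa> / real s * ln (2 / \<delta>)) \<le> l"
      and l_le: "l \<le> onorm (cov_op P0 evl)"
    have "4 * c1 * \<kappa> / real s * ln (2 / \<delta>) \<le> l" using max by simp
    then have "4 * c1 * \<kappa> * ln (2 / \<delta>) \<le> l * real s" using assms(7) by (simp add: field_simps)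
    moreover have "0 \<le> l * real s" using assms(10) by simp
    ultimately have "2 * \<kappa> * ln (2 / \<delta>) * c1 \<le> 2 * real s * l" by (simp add: mult_ac)
    then have "2 * \<kappa> * ln (2 / \<delta>) / l \<le> 2 * real s / c1"
      using assms(8,10) by (simp add: field_simps)
    then show "1 - 3 * \<delta> \<le> measure ?\<Omega> ?good" by (rule main[OF l_le xi_sum_le])
  next
    fix C
    assume bdd: "bdd_above (range (\<lambda>i. sup_norm (evl (eigen_fun P0 evl lam e i))))"
      and C: "C = (SUP i. sup_norm (evl (eigen_fun P0 evl lam e i)))"
      and l_le: "l \<le> onorm (cov_op P0 evl)"
      and s_ge: "C\<^sup>2 * N1 P0 evl l * max (4 * c1 * ln (2 / \<delta>)) (136 * ln (8 * N1 P0 evl l / \<delta>)) \<le> real s"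
    have C_bound: "\<bar>evl (eigen_fun P0 evl lam e i) x\<bar> \<le> C" for i x
    proof -
      let ?f = "eigen_fun P0 evl lam e i"
      \<comment> \<open>\<open>sup_norm\<close> is a conditional supremum, so each eigenfunction
        must be known to be bounded before its values are compared with it.\<close>
      have "\<bar>evl ?f x\<bar> \<le> norm ?f * sqrt \<kappa>" for x
        using order_trans[OF Cauchy_Schwarz_ineq2 mult_left_mono[OF norm_k_le norm_ge_zero], of ?f x]
        by (simp only: k(2)[of ?f x])
      then have "bdd_above (range (\<lambda>x. \<bar>evl ?f x\<bar>))" by (rule bdd_aboveI2)
      then have "\<bar>evl ?f x\<bar> \<le> sup_norm (evl ?f)"
        unfolding sup_norm_def by (rule cSUP_upper[OF UNIV_I])
      also have "\<dots> \<le> C" unfolding C by (rule cSUP_upper[OF UNIV_I bdd])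
      finally show ?thesis .
    qed
    \<comment> \<open>Nonnegativity of the trace comes from the empty partial sum.\<close>
    have "0 \<le> N1 P0 evl l" using cov.sum_rho_le_trace[of 0] by (simp add: N1_def)
    then have "0 \<le> C\<^sup>2 * N1 P0 evl l" by simp
    then have "C\<^sup>2 * N1 P0 evl l * (4 * c1 * ln (2 / \<delta>)) \<le> real s"
      by (rule order_trans[OF mult_left_mono[OF max.cobounded1] s_ge])
    then have "8 * l * C\<^sup>2 * N1 P0 evl l * ln (2 / \<delta>) / l \<le> 2 * real s / c1"
      using assms(8,10) by (simp add: field_simps)
    then show "1 - 3 * \<delta> \<le> measure ?\<Omega> ?good" by (rule main[OF l_le xi_sum_le_sup_norm[OF C_bound]])
  qed
qed

end
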